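(* Let $\Gamma$ be an icc countable discrete group and let $\Gamma\curvearrowright A$ and $\Gamma\curvearrowright B$ be trace preserving actions on tracial von Neumann algebras with $\Gamma\curvearrowright B$ compact and $A$ a $\mathrm{II}_1$ factor. Consider the diagonal action $\Gamma\curvearrowright A\bar\otimes B$ and let $(A\bar\otimes B)\rtimes\Gamma$ be the corresponding crossed product von Neumann algebra. Then for any von Neumann subalgebra $A\rtimes\Gamma\subseteq N\subseteq(A\bar\otimes B)\rtimes\Gamma$ one can find a $\Gamma$-invariant von Neumann subalgebra $C\subseteq B$ such that $N=(A\bar\otimes C)\rtimes\Gamma$.
   Context: A group is icc if all its nontrivial conjugacy classes are infinite. A trace preserving action $\Gamma\curvearrowright^{\sigma}B$ on a tracial von Neumann algebra is compact if there exists $\mathcal F\subseteq B$ with $\overline{\mathrm{span}\,\mathcal F}^{\|\cdot\|_2}=L^2(B)$ such that for every $f\in\mathcal F$ and $\varepsilon>0$ there exist $\xi_1,\dots,\xi_n\in L^2(B)$ such that for every $\gamma\in\Gamma$ one can find scalars $\kappa_i(\gamma)\in\mathbb C$, with $\sup_{i,\gamma}|\kappa_i(\gamma)|<\infty$, satisfying $\|\sigma_\gamma(f)-\sum_{i=1}^n\kappa_i(\gamma)\xi_i\|_2\le\varepsilon$. The algebra $A$ is identified with $A\otimes 1\subseteq A\bar\otimes B$. *)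

theory Defs
  imports "HOL-Analysis.Analysis" "HOL-Algebra.Group"
begin

section \<open>Complex Hilbert spaces and bounded operators\<close>

text \<open>The inner product is linear in its first argument; its real part is the real inner
  product, which also provides the norm. Completeness is with respect to that norm.\<close>

class chilbert_space = real_inner + complete_space +
  fixes scaleC :: "complex \<Rightarrow> 'a \<Rightarrow> 'a"  (infixr \<open>*\<^sub>C\<close> 75)
    and cinner :: "'a \<Rightarrow> 'a \<Rightarrow> complex"
  assumes scaleC_add_right: "c *\<^sub>C (x + y) = c *\<^sub>C x + c *\<^sub>C y"
    and scaleC_add_left: "(c + d) *\<^sub>C x = c *\<^sub>C x + d *\<^sub>C x"
    and scaleC_scaleC: "c *\<^sub>C d *\<^sub>C x = (c * d) *\<^sub>C x"
    and scaleC_one: "1 *\<^sub>C x = x"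
    and scaleR_scaleC: "r *\<^sub>R x = complex_of_real r *\<^sub>C x"
    and cinner_commute: "cinner x y = cnj (cinner y x)"
    and cinner_add_left: "cinner (x + y) z = cinner x z + cinner y z"
    and cinner_scaleC_left: "cinner (c *\<^sub>C x) y = c * cinner x y"
    and inner_eq_Re_cinner: "inner x y = Re (cinner x y)"

instantiation complex :: chilbert_space
begin

definition "scaleC_complex c (x :: complex) = c * x"
definition "cinner_complex x (y :: complex) = x * cnj y"

instance
  by standard
    (auto simp: scaleC_complex_def cinner_complex_def algebra_simps inner_complex_def
      scaleR_conv_of_real)

end

interpretation complex_vector: vector_space "scaleC :: complex \<Rightarrow> 'h \<Rightarrow> 'h::chilbert_space"
  by unfold_locales (simp_all add: scaleC_add_right scaleC_add_left scaleC_scaleC scaleC_one)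

definition clinear :: "('h::chilbert_space \<Rightarrow> 'k::chilbert_space) \<Rightarrow> bool" where
  "clinear f \<longleftrightarrow> (\<forall>x y. f (x + y) = f x + f y) \<and> (\<forall>c x. f (c *\<^sub>C x) = c *\<^sub>C f x)"

definition dense_span :: "'h::chilbert_space set \<Rightarrow> bool" where
  "dense_span S \<longleftrightarrow> closure (complex_vector.span S) = UNIV"

definition bounded_ops :: "('h::chilbert_space \<Rightarrow> 'h) set" where
  "bounded_ops = {T. clinear T \<and> bounded_linear T}"

definition adj :: "('h::chilbert_space \<Rightarrow> 'h) \<Rightarrow> ('h \<Rightarrow> 'h)" where
  "adj T = (THE S. \<forall>v w. cinner (T v) w = cinner v (S w))"


section \<open>Von Neumann algebras\<close>

definition commutant :: "('h::chilbert_space \<Rightarrow> 'h) set \<Rightarrow> ('h \<Rightarrow> 'h) set" where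
  "commutant S = {T \<in> bounded_ops. \<forall>X\<in>S. T \<circ> X = X \<circ> T}"

definition von_neumann_algebra :: "('h::chilbert_space \<Rightarrow> 'h) set \<Rightarrow> bool" where
  "von_neumann_algebra M \<longleftrightarrow>
     M \<subseteq> bounded_ops \<and> (\<forall>x\<in>M. adj x \<in> M) \<and> commutant (commutant M) = M"

definition vn_generated :: "('h::chilbert_space \<Rightarrow> 'h) set \<Rightarrow> ('h \<Rightarrow> 'h) set" where
  "vn_generated S = \<Inter>{M. von_neumann_algebra M \<and> S \<subseteq> M}"

text \<open>Ultraweakly continuous linear functionals on \<open>M\<close>. Functionals on \<open>M\<close> are functions on
  all operators, whose values outside \<open>M\<close> are irrelevant.\<close>

definition ultraweak_functional ::
    "('h::chilbert_space \<Rightarrow> 'h) set \<Rightarrow> (('h \<Rightarrow> 'h) \<Rightarrow> complex) \<Rightarrow> bool" where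
  "ultraweak_functional M \<phi> \<longleftrightarrow>
     (\<exists>\<xi> \<eta> :: nat \<Rightarrow> 'h. summable (\<lambda>n. (norm (\<xi> n))\<^sup>2) \<and> summable (\<lambda>n. (norm (\<eta> n))\<^sup>2) \<and>
        (\<forall>x\<in>M. \<phi> x = (\<Sum>n. cinner (x (\<xi> n)) (\<eta> n))))"

text \<open>\<open>\<tau>\<close> is a faithful normal tracial state on \<open>M\<close>; linearity is part of normality, since
  an ultraweakly continuous functional as above is linear on \<open>M\<close>.\<close>

definition faithful_normal_trace ::
    "('h::chilbert_space \<Rightarrow> 'h) set \<Rightarrow> (('h \<Rightarrow> 'h) \<Rightarrow> complex) \<Rightarrow> bool" where
  "faithful_normal_trace M \<tau> \<longleftrightarrow>
     ultraweak_functional M \<tau> \<and> \<tau> id = 1 \<and>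
     (\<forall>x\<in>M. \<tau> (adj x \<circ> x) \<in> \<real> \<and> 0 \<le> Re (\<tau> (adj x \<circ> x))) \<and>
     (\<forall>x\<in>M. \<tau> (adj x \<circ> x) = 0 \<longrightarrow> x = (\<lambda>_. 0)) \<and>
     (\<forall>x\<in>M. \<forall>y\<in>M. \<tau> (x \<circ> y) = \<tau> (y \<circ> x))"

definition tracial_von_neumann_algebra ::
    "('h::chilbert_space \<Rightarrow> 'h) set \<Rightarrow> (('h \<Rightarrow> 'h) \<Rightarrow> complex) \<Rightarrow> bool" where
  "tracial_von_neumann_algebra M \<tau> \<longleftrightarrow> von_neumann_algebra M \<and> faithful_normal_trace M \<tau>"

definition factor :: "('h::chilbert_space \<Rightarrow> 'h) set \<Rightarrow> bool" where
  "factor M \<longleftrightarrow> von_neumann_algebra M \<and> M \<inter> commutant M = range (\<lambda>c v. c *\<^sub>C v)"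

definition finite_vna :: "('h::chilbert_space \<Rightarrow> 'h) set \<Rightarrow> bool" where
  "finite_vna M \<longleftrightarrow> (\<forall>v\<in>M. adj v \<circ> v = id \<longrightarrow> v \<circ> adj v = id)"

definition abelian_projection ::
    "('h::chilbert_space \<Rightarrow> 'h) set \<Rightarrow> ('h \<Rightarrow> 'h) \<Rightarrow> bool" where
  "abelian_projection M p \<longleftrightarrow> p \<in> M \<and> p \<circ> p = p \<and> adj p = p \<and>
     (\<forall>x\<in>M. \<forall>y\<in>M. (p \<circ> x \<circ> p) \<circ> (p \<circ> y \<circ> p) = (p \<circ> y \<circ> p) \<circ> (p \<circ> x \<circ> p))"

definition II1_factor :: "('h::chilbert_space \<Rightarrow> 'h) set \<Rightarrow> bool" where
  "II1_factor M \<longleftrightarrow> factor M \<and> finite_vna M \<and> id \<noteq> ((\<lambda>_. 0) :: 'h \<Rightarrow> 'h) \<and>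
     (\<forall>p. abelian_projection M p \<longrightarrow> p = (\<lambda>_. 0))"


section \<open>Group actions\<close>

definition icc :: "('g, 's) monoid_scheme \<Rightarrow> bool" where
  "icc G \<longleftrightarrow> (\<forall>g\<in>carrier G. g \<noteq> \<one>\<^bsub>G\<^esub> \<longrightarrow>
     infinite {h \<otimes>\<^bsub>G\<^esub> g \<otimes>\<^bsub>G\<^esub> inv\<^bsub>G\<^esub> h | h. h \<in> carrier G})"

definition star_automorphism ::
    "('h::chilbert_space \<Rightarrow> 'h) set \<Rightarrow> (('h \<Rightarrow> 'h) \<Rightarrow> ('h \<Rightarrow> 'h)) \<Rightarrow> bool" where
  "star_automorphism M f \<longleftrightarrow> bij_betw f M M \<and>
     (\<forall>x\<in>M. \<forall>y\<in>M. f (\<lambda>v. x v + y v) = (\<lambda>v. f x v + f y v)) \<and>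
     (\<forall>c. \<forall>x\<in>M. f (\<lambda>v. c *\<^sub>C x v) = (\<lambda>v. c *\<^sub>C f x v)) \<and>
     (\<forall>x\<in>M. \<forall>y\<in>M. f (x \<circ> y) = f x \<circ> f y) \<and>
     (\<forall>x\<in>M. f (adj x) = adj (f x))"

definition vna_action ::
    "('g, 's) monoid_scheme \<Rightarrow> ('h::chilbert_space \<Rightarrow> 'h) set \<Rightarrow>
     ('g \<Rightarrow> ('h \<Rightarrow> 'h) \<Rightarrow> ('h \<Rightarrow> 'h)) \<Rightarrow> bool" where
  "vna_action G M \<sigma> \<longleftrightarrow>
     (\<forall>g\<in>carrier G. star_automorphism M (\<sigma> g)) \<and>
     (\<forall>x\<in>M. \<sigma> \<one>\<^bsub>G\<^esub> x = x) \<and>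
     (\<forall>g\<in>carrier G. \<forall>h\<in>carrier G. \<forall>x\<in>M. \<sigma> (g \<otimes>\<^bsub>G\<^esub> h) x = \<sigma> g (\<sigma> h x))"

definition trace_preserving_action ::
    "('g, 's) monoid_scheme \<Rightarrow> ('h::chilbert_space \<Rightarrow> 'h) set \<Rightarrow> (('h \<Rightarrow> 'h) \<Rightarrow> complex) \<Rightarrow>
     ('g \<Rightarrow> ('h \<Rightarrow> 'h) \<Rightarrow> ('h \<Rightarrow> 'h)) \<Rightarrow> bool" where
  "trace_preserving_action G M \<tau> \<sigma> \<longleftrightarrow>
     vna_action G M \<sigma> \<and> (\<forall>g\<in>carrier G. \<forall>x\<in>M. \<tau> (\<sigma> g x) = \<tau> x)"

definition normal_action ::
    "('g, 's) monoid_scheme \<Rightarrow> ('h::chilbert_space \<Rightarrow> 'h) set \<Rightarrow>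
     ('g \<Rightarrow> ('h \<Rightarrow> 'h) \<Rightarrow> ('h \<Rightarrow> 'h)) \<Rightarrow> bool" where
  "normal_action G M \<sigma> \<longleftrightarrow> vna_action G M \<sigma> \<and>
     (\<forall>g\<in>carrier G. \<forall>\<phi>. ultraweak_functional M \<phi> \<longrightarrow> ultraweak_functional M (\<phi> \<circ> \<sigma> g))"

text \<open>\<open>L2_space M \<tau> j\<close>: the target type of \<open>j\<close> is (a realisation of) \<open>L\<^sup>2(M, \<tau>)\<close>, the
  completion of \<open>M\<close> for \<open>\<parallel>x\<parallel>\<^sub>2 = \<tau> (x\<^sup>* x)\<^sup>1\<^sup>/\<^sup>2\<close>, and \<open>j\<close> is the canonical map
  \<open>M \<rightarrow> L\<^sup>2(M, \<tau>)\<close>. Any two realisations are canonically isometric.\<close>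

definition L2_space ::
    "('h::chilbert_space \<Rightarrow> 'h) set \<Rightarrow> (('h \<Rightarrow> 'h) \<Rightarrow> complex) \<Rightarrow>
     (('h \<Rightarrow> 'h) \<Rightarrow> 'l::chilbert_space) \<Rightarrow> bool" where
  "L2_space M \<tau> j \<longleftrightarrow>
     (\<forall>x\<in>M. \<forall>y\<in>M. j (\<lambda>v. x v + y v) = j x + j y) \<and>
     (\<forall>c. \<forall>x\<in>M. j (\<lambda>v. c *\<^sub>C x v) = c *\<^sub>C j x) \<and>
     (\<forall>x\<in>M. \<forall>y\<in>M. cinner (j x) (j y) = \<tau> (adj y \<circ> x)) \<and>
     closure (j ` M) = UNIV"

definition compact_action ::
    "('g, 's) monoid_scheme \<Rightarrow> ('h::chilbert_space \<Rightarrow> 'h) set \<Rightarrow>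
     (('h \<Rightarrow> 'h) \<Rightarrow> 'l::chilbert_space) \<Rightarrow> ('g \<Rightarrow> ('h \<Rightarrow> 'h) \<Rightarrow> ('h \<Rightarrow> 'h)) \<Rightarrow> bool" where
  "compact_action G M j \<sigma> \<longleftrightarrow>
     (\<exists>F\<subseteq>M. dense_span (j ` F) \<and>
        (\<forall>f\<in>F. \<forall>\<epsilon>>0. \<exists>n. \<exists>\<xi> :: nat \<Rightarrow> 'l. \<exists>\<kappa> :: nat \<Rightarrow> 'g \<Rightarrow> complex.
           bdd_above {cmod (\<kappa> i g) | i g. i < n \<and> g \<in> carrier G} \<and>
           (\<forall>g\<in>carrier G. norm (j (\<sigma> g f) - (\<Sum>i<n. \<kappa> i g *\<^sub>C \<xi> i)) \<le> \<epsilon>)))"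


section \<open>Tensor products\<close>

text \<open>\<open>hilbert_tensor t\<close>: the target type of \<open>t\<close> is the Hilbert space tensor product of the two
  argument types, with elementary tensors \<open>t h k\<close>. This determines it up to a unitary.\<close>

definition hilbert_tensor ::
    "('h::chilbert_space \<Rightarrow> 'k::chilbert_space \<Rightarrow> 'hk::chilbert_space) \<Rightarrow> bool" where
  "hilbert_tensor t \<longleftrightarrow>
     (\<forall>k. clinear (\<lambda>h. t h k)) \<and> (\<forall>h. clinear (t h)) \<and>
     (\<forall>h h' k k'. cinner (t h k) (t h' k') = cinner h h' * cinner k k') \<and>
     dense_span {t h k | h k. True}"

definition tensor_op ::
    "('h::chilbert_space \<Rightarrow> 'k::chilbert_space \<Rightarrow> 'hk::chilbert_space) \<Rightarrow>
     ('h \<Rightarrow> 'h) \<Rightarrow> ('k \<Rightarrow> 'k) \<Rightarrow> ('hk \<Rightarrow> 'hk)" where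
  "tensor_op t x y = (THE T. T \<in> bounded_ops \<and> (\<forall>h k. T (t h k) = t (x h) (y k)))"

definition tensor_vna ::
    "('h::chilbert_space \<Rightarrow> 'k::chilbert_space \<Rightarrow> 'hk::chilbert_space) \<Rightarrow>
     ('h \<Rightarrow> 'h) set \<Rightarrow> ('k \<Rightarrow> 'k) set \<Rightarrow> ('hk \<Rightarrow> 'hk) set" where
  "tensor_vna t A B = vn_generated {tensor_op t a b | a b. a \<in> A \<and> b \<in> B}"

text \<open>The copy \<open>A \<otimes> 1\<close> of \<open>A\<close>.\<close>

definition left_copy ::
    "('h::chilbert_space \<Rightarrow> 'k::chilbert_space \<Rightarrow> 'hk::chilbert_space) \<Rightarrow>
     ('h \<Rightarrow> 'h) set \<Rightarrow> ('hk \<Rightarrow> 'hk) set" where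
  "left_copy t A = (\<lambda>a. tensor_op t a id) ` A"

text \<open>\<open>\<theta>\<close> is the diagonal action of \<open>\<sigma>\<close> and \<open>\<rho>\<close>. Normality, which is automatic for
  \<open>*\<close>-automorphisms of von Neumann algebras, shows that the values on elementary tensors
  determine \<open>\<theta>\<close> on all of the tensor product.\<close>

definition diagonal_action ::
    "('g, 's) monoid_scheme \<Rightarrow>
     ('h::chilbert_space \<Rightarrow> 'k::chilbert_space \<Rightarrow> 'hk::chilbert_space) \<Rightarrow>
     ('h \<Rightarrow> 'h) set \<Rightarrow> ('k \<Rightarrow> 'k) set \<Rightarrow>
     ('g \<Rightarrow> ('h \<Rightarrow> 'h) \<Rightarrow> ('h \<Rightarrow> 'h)) \<Rightarrow> ('g \<Rightarrow> ('k \<Rightarrow> 'k) \<Rightarrow> ('k \<Rightarrow> 'k)) \<Rightarrow>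
     ('g \<Rightarrow> ('hk \<Rightarrow> 'hk) \<Rightarrow> ('hk \<Rightarrow> 'hk)) \<Rightarrow> bool" where
  "diagonal_action G t A B \<sigma> \<rho> \<theta> \<longleftrightarrow>
     normal_action G (tensor_vna t A B) \<theta> \<and>
     (\<forall>g\<in>carrier G. \<forall>a\<in>A. \<forall>b\<in>B. \<theta> g (tensor_op t a b) = tensor_op t (\<sigma> g a) (\<rho> g b))"


section \<open>Crossed products\<close>

text \<open>\<open>hilbert_sum I V\<close>: the target type of \<open>V\<close> is \<open>\<ell>\<^sup>2(I) \<otimes> H\<close>, the orthogonal sum of
  copies of \<open>H\<close> indexed by \<open>I\<close>, where \<open>V i \<xi>\<close> stands for \<open>\<delta>\<^sub>i \<otimes> \<xi>\<close>.\<close>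

definition hilbert_sum :: "'i set \<Rightarrow> ('i \<Rightarrow> 'h::chilbert_space \<Rightarrow> 'k::chilbert_space) \<Rightarrow> bool" where
  "hilbert_sum I V \<longleftrightarrow>
     (\<forall>i\<in>I. clinear (V i)) \<and>
     (\<forall>i\<in>I. \<forall>j\<in>I. \<forall>\<xi> \<eta>. cinner (V i \<xi>) (V j \<eta>) = (if i = j then cinner \<xi> \<eta> else 0)) \<and>
     dense_span {V i \<xi> | i \<xi>. i \<in> I}"

text \<open>The algebra acts by \<open>\<pi>(x)(\<delta>\<^sub>g \<otimes> \<xi>) = \<delta>\<^sub>g \<otimes> \<theta>\<^bsub>g\<inverse>\<^esub>(x) \<xi>\<close>, the group by
  \<open>u\<^sub>h(\<delta>\<^sub>g \<otimes> \<xi>) = \<delta>\<^bsub>hg\<^esub> \<otimes> \<xi>\<close>, so that \<open>u\<^sub>h \<pi>(x) u\<^sub>h\<^sup>* = \<pi>(\<theta>\<^sub>h(x))\<close>.\<close>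

definition crossed_embed ::
    "('g, 's) monoid_scheme \<Rightarrow> ('g \<Rightarrow> 'h::chilbert_space \<Rightarrow> 'k::chilbert_space) \<Rightarrow>
     ('g \<Rightarrow> ('h \<Rightarrow> 'h) \<Rightarrow> ('h \<Rightarrow> 'h)) \<Rightarrow> ('h \<Rightarrow> 'h) \<Rightarrow> ('k \<Rightarrow> 'k)" where
  "crossed_embed G V \<theta> x =
     (THE T. T \<in> bounded_ops \<and> (\<forall>g\<in>carrier G. \<forall>\<xi>. T (V g \<xi>) = V g (\<theta> (inv\<^bsub>G\<^esub> g) x \<xi>)))"

definition crossed_unitary ::
    "('g, 's) monoid_scheme \<Rightarrow> ('g \<Rightarrow> 'h::chilbert_space \<Rightarrow> 'k::chilbert_space) \<Rightarrow> 'g \<Rightarrow> ('k \<Rightarrow> 'k)" where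
  "crossed_unitary G V h =
     (THE T. T \<in> bounded_ops \<and> (\<forall>g\<in>carrier G. \<forall>\<xi>. T (V g \<xi>) = V (h \<otimes>\<^bsub>G\<^esub> g) \<xi>))"

text \<open>\<open>M \<rtimes> G\<close>, where \<open>M\<close> is invariant under \<open>\<theta>\<close>. The action \<open>\<theta>\<close> may be given on a larger
  algebra, in which case this is the crossed product by the restricted action.\<close>

definition crossed_product ::
    "('g, 's) monoid_scheme \<Rightarrow> ('g \<Rightarrow> 'h::chilbert_space \<Rightarrow> 'k::chilbert_space) \<Rightarrow>
     ('g \<Rightarrow> ('h \<Rightarrow> 'h) \<Rightarrow> ('h \<Rightarrow> 'h)) \<Rightarrow> ('h \<Rightarrow> 'h) set \<Rightarrow> ('k \<Rightarrow> 'k) set" where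
  "crossed_product G V \<theta> M =
     vn_generated (crossed_embed G V \<theta> ` M \<union> crossed_unitary G V ` carrier G)"

end

theory Submission
  imports Defs
begin

text \<open>Write \<open>P\<close> for \<open>(A \<otimes> B) \<rtimes> G\<close>. After amplification by \<open>\<ell>\<^sup>2(\<nat>)\<close> its trace is the vector
  state of a separating vector \<open>\<Omega>\<close>, and the expectation \<open>E\<close> onto \<open>N\<close> is given by the projection
  \<open>e\<close> onto the closure of \<open>N \<Omega>\<close>. For \<open>b \<in> B\<close> the element \<open>E(b)\<close> commutes with \<open>A\<close>, and by
  compactness its orbit under conjugation by \<open>G\<close> is precompact in the 2-norm. Conjugation permutes
  the Fourier coefficients along conjugacy classes, which are infinite, so only the coefficient at
  \<open>1\<close> survives: \<open>E(b) \<in> A \<otimes> B\<close>. Since \<open>A\<close> is a factor, \<open>E(b) \<in> 1 \<otimes> B\<close>.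

  Hence \<open>E\<close> maps \<open>B\<close> into \<open>C = N \<inter> B\<close>. As \<open>E\<close> is \<open>N\<close>-bilinear and \<open>N\<close> contains \<open>A\<close> and \<open>G\<close>,
  the space \<open>N \<Omega>\<close>, which lies in \<open>e (P \<Omega>)\<close>, is contained in the closure of \<open>Q \<Omega>\<close> for
  \<open>Q = (A \<otimes> C) \<rtimes> G\<close>, and an element of \<open>P\<close> with this property lies in \<open>Q\<close>.\<close>

section \<open>Hilbert spaces\<close>

text \<open>The given algebras act on arbitrary Hilbert spaces, where a normal trace need not be a
  vector state; countably many copies of the space leave room for a vector. All closures are then
  closures of sets of vectors: an element of the bicommutant of a star algebra \<open>S\<close> maps
  \<open>v\<close> into the closure of the orbit of \<open>v\<close>, and an element of
  \<open>P\<close> belongs to a subalgebra as soon as its value at \<open>\<Omega>\<close> is a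
  limit of values of that subalgebra. No functional calculus is used. Writing a positive operator as
  a sum of squares takes its place in four arguments: the bound on the expectation, the trace
  vector, the boundedness of \<open>a \<otimes> 1\<close>, and the norm estimate for normal
  automorphisms. Compactness supplies approximating vectors, not elements of \<open>B\<close>, so
  the Fourier coefficients of the expectation are defined on vectors, by \<open>coef_e\<close>. By
  Bessel's inequality finitely many vectors have large coefficients at finitely many group elements
  only, whereas a nonzero coefficient at \<open>h \<noteq> 1\<close> would keep its norm along an
  infinite conjugacy class, since the action preserves the trace.\<close>

lemma scaleC_zero_left [simp]: "0 *\<^sub>C (x::'h::chilbert_space) = 0"
  using complex_vector.scale_zero_left by blast

lemma scaleC_zero_right [simp]: "c *\<^sub>C (0::'h::chilbert_space) = 0"
  using complex_vector.scale_zero_right by blast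

lemma scaleC_minus_one: "(-1) *\<^sub>C x = - (x::'h::chilbert_space)"
  by (metis complex_vector.scale_minus_left scaleC_one)

lemma scaleC_diff_right: "c *\<^sub>C (x - y) = c *\<^sub>C x - c *\<^sub>C (y::'h::chilbert_space)"
  by (rule complex_vector.scale_right_diff_distrib)

declare scaleC_one [simp]

lemma cinner_add_right: "cinner x (y + z) = cinner x y + cinner x (z::'h::chilbert_space)"
  by (metis cinner_add_left cinner_commute complex_cnj_add)

lemma cinner_scaleC_right: "cinner x (c *\<^sub>C y) = cnj c * cinner x (y::'h::chilbert_space)"
  by (metis cinner_scaleC_left cinner_commute complex_cnj_mult)

lemma cinner_zero_left [simp]: "cinner 0 (x::'h::chilbert_space) = 0"
  by (metis cinner_scaleC_left mult_zero_left scaleC_zero_left)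

lemma cinner_zero_right [simp]: "cinner (x::'h::chilbert_space) 0 = 0"
  by (metis cinner_commute cinner_zero_left complex_cnj_zero)

lemma cinner_minus_left: "cinner (- x) (y::'h::chilbert_space) = - cinner x y"
  by (metis cinner_scaleC_left mult_minus1 scaleC_minus_one)

lemma cinner_minus_right: "cinner x (- y::'h::chilbert_space) = - cinner x y"
  by (metis cinner_commute cinner_minus_left complex_cnj_minus)

lemma cinner_diff_left: "cinner (x - y) (z::'h::chilbert_space) = cinner x z - cinner y z"
  using cinner_add_left[of x "-y" z] by (simp add: cinner_minus_left)

lemma cinner_diff_right: "cinner x (y - z::'h::chilbert_space) = cinner x y - cinner x z"
  using cinner_add_right[of x y "-z"] by (simp add: cinner_minus_right)

lemma cinner_sum_left: "cinner (\<Sum>i\<in>I. f i) (y::'h::chilbert_space) = (\<Sum>i\<in>I. cinner (f i) y)"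
  by (induction I rule: infinite_finite_induct) (auto simp: cinner_add_left)

lemma cinner_sum_right: "cinner (y::'h::chilbert_space) (\<Sum>i\<in>I. f i) = (\<Sum>i\<in>I. cinner y (f i))"
  by (induction I rule: infinite_finite_induct) (auto simp: cinner_add_right)

lemmas cinner_simps = cinner_add_left cinner_add_right cinner_diff_left cinner_diff_right
  cinner_scaleC_left cinner_scaleC_right cinner_minus_left cinner_minus_right

lemma cinner_self: "cinner x x = complex_of_real ((norm (x::'h::chilbert_space))\<^sup>2)"
proof (rule complex_eqI)
  show "Re (cinner x x) = Re (complex_of_real ((norm x)\<^sup>2))"
    by (simp add: inner_eq_Re_cinner[symmetric] dot_square_norm)
  have "cinner x x = cnj (cinner x x)" by (rule cinner_commute)
  then show "Im (cinner x x) = Im (complex_of_real ((norm x)\<^sup>2))"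
    by (simp add: complex_eq_iff)
qed

lemma cinner_self_Re: "Re (cinner x x) = (norm (x::'h::chilbert_space))\<^sup>2"
  by (simp add: cinner_self)

lemma cinner_eq_zero [simp]: "cinner x x = 0 \<longleftrightarrow> (x::'h::chilbert_space) = 0"
  by (simp add: cinner_self)

lemma norm_scaleC [simp]: "norm (c *\<^sub>C x) = cmod c * norm (x::'h::chilbert_space)"
proof -
  have "complex_of_real ((norm (c *\<^sub>C x))\<^sup>2) = c * cnj c * complex_of_real ((norm x)\<^sup>2)"
    by (simp only: cinner_self[symmetric] cinner_scaleC_left cinner_scaleC_right mult_ac)
  also have "\<dots> = complex_of_real ((cmod c * norm x)\<^sup>2)"
    by (simp add: complex_norm_square[symmetric] power_mult_distrib)
  finally have "(norm (c *\<^sub>C x))\<^sup>2 = (cmod c * norm x)\<^sup>2" using of_real_eq_iff by blast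
  then show ?thesis by (simp add: power2_eq_iff_nonneg)
qed

lemma norm_cinner_le: "cmod (cinner x y) \<le> norm x * norm (y::'h::chilbert_space)"
proof -
  obtain u where u: "cmod u = 1" "u * cinner x y = complex_of_real (cmod (cinner x y))"
  proof (cases "cinner x y = 0")
    case False
    show ?thesis
      by (rule that[of "cnj (sgn (cinner x y))"])
        (use False in \<open>auto simp: norm_sgn sgn_eq norm_divide complex_norm_square[symmetric] power2_eq_square field_simps\<close>)
  qed (use that[of 1] in auto)
  have "cmod (cinner x y) = Re (cinner (u *\<^sub>C x) y)"
    using u by (simp add: cinner_scaleC_left)
  also have "\<dots> \<le> norm (u *\<^sub>C x) * norm y"
    using norm_cauchy_schwarz[of "u *\<^sub>C x" y] by (simp add: inner_eq_Re_cinner)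
  finally show ?thesis using u by simp
qed

lemma norm_le_by_cinner:
  assumes "0 \<le> C" "\<And>y. cmod (cinner x y) \<le> C * norm (y::'h::chilbert_space)"
  shows "norm x \<le> C"
proof (cases "x = 0")
  case False
  have "norm x * norm x \<le> C * norm x"
    using assms(2)[of x] by (simp add: cinner_self power2_eq_square norm_mult)
  then show ?thesis using False by simp
qed (use assms in auto)

lemma norm_eqI_cinner:
  fixes x :: "'h::chilbert_space" and y :: "'k::chilbert_space"
  assumes "cinner x x = cinner y y"
  shows "norm x = norm y"
proof -
  have "(norm x)\<^sup>2 = (norm y)\<^sup>2" using assms unfolding cinner_self of_real_eq_iff .
  then show ?thesis by (simp add: power2_eq_iff_nonneg)
qed

lemma bounded_bilinear_cinner: "bounded_bilinear (cinner :: 'h::chilbert_space \<Rightarrow> 'h \<Rightarrow> complex)"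
proof
  fix a a' b b' :: 'h and r :: real
  show "cinner (a + a') b = cinner a b + cinner a' b" by (rule cinner_add_left)
  show "cinner a (b + b') = cinner a b + cinner a b'" by (rule cinner_add_right)
  show "cinner (r *\<^sub>R a) b = r *\<^sub>R cinner a b"
    by (subst scaleR_scaleC) (simp add: cinner_scaleC_left scaleR_conv_of_real)
  show "cinner a (r *\<^sub>R b) = r *\<^sub>R cinner a b"
    by (subst scaleR_scaleC) (simp add: cinner_scaleC_right scaleR_conv_of_real)
  show "\<exists>K. \<forall>(a::'h) b. cmod (cinner a b) \<le> norm a * norm b * K"
    by (rule exI[of _ 1]) (simp add: norm_cinner_le)
qed

lemmas tendsto_cinner [tendsto_intros] = bounded_bilinear.tendsto[OF bounded_bilinear_cinner]
lemmas continuous_on_cinner [continuous_intros] =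
  bounded_bilinear.continuous_on[OF bounded_bilinear_cinner]

lemma bounded_linear_scaleC: "bounded_linear (\<lambda>x::'h::chilbert_space. c *\<^sub>C x)"
proof (rule bounded_linear_intro[where K = "cmod c"])
  show "c *\<^sub>C (r *\<^sub>R x) = r *\<^sub>R c *\<^sub>C (x::'h)" for r x
    by (simp add: scaleR_scaleC scaleC_scaleC mult.commute)
qed (auto simp: scaleC_add_right)

lemma cinner_eqI:
  assumes "\<And>z. cinner x z = cinner y (z::'h::chilbert_space)"
  shows "x = y"
proof -
  have "cinner (x - y) (x - y) = 0" by (simp only: cinner_diff_left assms) simp
  then show ?thesis by simp
qed

lemma cinner_zero_closure:
  fixes v :: "'h::chilbert_space"
  assumes "\<And>s. s \<in> S \<Longrightarrow> cinner v s = 0" "w \<in> closure S"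
  shows "cinner v w = 0"
proof -
  have "closed {w. cinner v w = 0}"
    by (intro closed_Collect_eq continuous_intros)
  then have "closure S \<subseteq> {w. cinner v w = 0}"
    using assms(1) by (intro closure_minimal) auto
  then show ?thesis using assms(2) by auto
qed

text \<open>The test vectors satisfying the estimate form a closed set, so \<open>u\<close> itself
  may be tested. This serves where inner products can be estimated only against a generating family
  \<open>S\<close>.\<close>

lemma norm_le_by_cinner_closure:
  fixes u :: "'h::chilbert_space"
  assumes u: "u \<in> closure S" and C: "0 \<le> C" and b: "\<And>s. s \<in> S \<Longrightarrow> cmod (cinner s u) \<le> C * norm s"
  shows "norm u \<le> C"
proof -
  have "closed {s. cmod (cinner s u) \<le> C * norm s}"
    by (intro closed_Collect_le continuous_intros)
  then have "closure S \<subseteq> {s. cmod (cinner s u) \<le> C * norm s}" using b by (intro closure_minimal) auto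
  then have "cmod (cinner u u) \<le> C * norm u" using u by blast
  then show ?thesis using C by (cases "u = 0") (auto simp: cinner_self norm_mult power2_eq_square)
qed

subsection \<open>Linear maps\<close>

lemma clinearI:
  assumes "\<And>x y. f (x + y) = f x + f y" "\<And>c x. f (c *\<^sub>C x) = c *\<^sub>C f x"
  shows "clinear f"
  using assms by (auto simp: clinear_def)

lemma clinear_add: "clinear f \<Longrightarrow> f (x + y) = f x + f y"
  and clinear_scaleC: "clinear f \<Longrightarrow> f (c *\<^sub>C x) = c *\<^sub>C f x"
  by (auto simp: clinear_def)

lemma clinear_zero: "clinear f \<Longrightarrow> f 0 = 0"
  by (metis clinear_scaleC scaleC_zero_left)

lemma clinear_minus: "clinear f \<Longrightarrow> f (- x) = - f x"
  by (metis clinear_scaleC scaleC_minus_one)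

lemma clinear_diff: "clinear f \<Longrightarrow> f (x - y) = f x - f y"
  using clinear_add[of f x "-y"] by (simp add: clinear_minus)

lemma clinear_sum: "clinear f \<Longrightarrow> f (\<Sum>i\<in>I. g i) = (\<Sum>i\<in>I. f (g i))"
  by (induction I rule: infinite_finite_induct) (auto simp: clinear_add clinear_zero)

lemmas clinear_simps = clinear_add clinear_diff clinear_scaleC clinear_zero clinear_sum

definition bounded_clinear :: "('h::chilbert_space \<Rightarrow> 'k::chilbert_space) \<Rightarrow> bool" where
  "bounded_clinear f \<longleftrightarrow> clinear f \<and> bounded_linear f"

lemma bounded_ops_iff: "T \<in> bounded_ops \<longleftrightarrow> bounded_clinear T"
  by (simp add: bounded_ops_def bounded_clinear_def)

lemma bounded_clinear_clinear: "bounded_clinear f \<Longrightarrow> clinear f"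
  and bounded_clinear_bounded_linear: "bounded_clinear f \<Longrightarrow> bounded_linear f"
  by (auto simp: bounded_clinear_def)

lemma bounded_clinearI:
  assumes "clinear f" "\<And>x. norm (f x) \<le> K * norm x"
  shows "bounded_clinear f"
proof -
  have "bounded_linear f"
    by (rule bounded_linear_intro[where K = K])
      (use assms in \<open>auto simp: clinear_add scaleR_scaleC clinear_scaleC mult.commute\<close>)
  then show ?thesis using assms by (auto simp: bounded_clinear_def)
qed

lemma bounded_clinear_bound:
  assumes "bounded_clinear f"
  obtains K where "0 < K" "\<And>x. norm (f x) \<le> K * norm x"
  using bounded_linear.pos_bounded[OF bounded_clinear_bounded_linear[OF assms]]
  by (auto simp: mult.commute)

lemma bounded_clinear_comp:
  "bounded_clinear f \<Longrightarrow> bounded_clinear g \<Longrightarrow> bounded_clinear (f \<circ> g)"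
  by (auto simp: bounded_clinear_def clinear_def comp_def intro: bounded_linear_compose)

lemma bounded_clinear_id [simp]: "bounded_clinear id" "bounded_clinear (\<lambda>x. x)"
  by (auto simp: bounded_clinear_def clinear_def id_def)

lemma bounded_clinear_zero [simp]: "bounded_clinear (\<lambda>x. 0)"
  by (auto simp: bounded_clinear_def clinear_def)

lemma bounded_clinear_plus:
  "bounded_clinear f \<Longrightarrow> bounded_clinear g \<Longrightarrow> bounded_clinear (\<lambda>x. f x + g x)"
  by (auto simp: bounded_clinear_def clinear_def scaleC_add_right bounded_linear_add)

lemma bounded_clinear_minus:
  "bounded_clinear f \<Longrightarrow> bounded_clinear g \<Longrightarrow> bounded_clinear (\<lambda>x. f x - g x)"
  by (auto simp: bounded_clinear_def clinear_def scaleC_diff_right bounded_linear_sub)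

lemma bounded_clinear_scaleC:
  "bounded_clinear f \<Longrightarrow> bounded_clinear (\<lambda>x. c *\<^sub>C f x)"
  by (auto simp: bounded_clinear_def clinear_def scaleC_add_right scaleC_scaleC mult.commute
      intro: bounded_linear_compose[OF bounded_linear_scaleC])

lemma bounded_clinear_tendsto:
  "bounded_clinear f \<Longrightarrow> (g \<longlongrightarrow> l) F \<Longrightarrow> ((\<lambda>x. f (g x)) \<longlongrightarrow> f l) F"
  by (auto simp: bounded_clinear_def intro: bounded_linear.tendsto)

lemma bounded_clinear_closure:
  assumes "bounded_clinear f" "\<And>s. s \<in> S \<Longrightarrow> f s \<in> R" "v \<in> closure S"
  shows "f v \<in> closure R"
proof -
  obtain s where s: "\<And>n. s n \<in> S" "s \<longlonglongrightarrow> v" using assms(3) closure_sequential by blast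
  show ?thesis
    unfolding closure_sequential
    using s assms(2) bounded_clinear_tendsto[OF assms(1) s(2)] by (intro exI[of _ "\<lambda>n. f (s n)"]) auto
qed

lemma bounded_clinear_eq_on_closure:
  assumes "bounded_clinear f" "bounded_clinear g" "\<And>s. s \<in> S \<Longrightarrow> f s = g s" "v \<in> closure S"
  shows "f v = g v"
proof -
  obtain s where s: "\<And>n. s n \<in> S" "s \<longlonglongrightarrow> v" using assms(4) closure_sequential by blast
  have "(\<lambda>n. f (s n)) \<longlonglongrightarrow> g v"
    using bounded_clinear_tendsto[OF assms(2) s(2)] s(1) assms(3) by simp
  then show ?thesis
    using bounded_clinear_tendsto[OF assms(1) s(2)] LIMSEQ_unique by blast
qed

lemma bounded_clinear_eq_dense_span:
  assumes "bounded_clinear f" "bounded_clinear g" "dense_span S" "\<And>s. s \<in> S \<Longrightarrow> f s = g s"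
  shows "f = g"
proof
  fix v
  have "f s = g s" if "s \<in> complex_vector.span S" for s
    using that
  proof (induction rule: complex_vector.span_induct_alt)
    case (step c x y)
    then show ?case using assms by (simp add: bounded_clinear_def clinear_def)
  qed (use assms in \<open>simp add: bounded_clinear_def clinear_zero\<close>)
  then show "f v = g v"
    using assms(3) bounded_clinear_eq_on_closure[OF assms(1,2)] unfolding dense_span_def by blast
qed

abbreviation csubspace :: "'h::chilbert_space set \<Rightarrow> bool" where
  "csubspace \<equiv> complex_vector.subspace"

lemma csubspaceI:
  "0 \<in> S \<Longrightarrow> (\<And>x y. x \<in> S \<Longrightarrow> y \<in> S \<Longrightarrow> x + y \<in> S) \<Longrightarrow> (\<And>c x. x \<in> S \<Longrightarrow> c *\<^sub>C x \<in> S) \<Longrightarrow> csubspace S"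
  by (simp add: complex_vector.subspace_def)

lemma csubspace_closure:
  fixes S :: "'h::chilbert_space set"
  assumes "csubspace S"
  shows "csubspace (closure S)"
proof (rule csubspaceI)
  show "0 \<in> closure S"
    using assms closure_subset complex_vector.subspace_0 by blast
next
  fix x y assume "x \<in> closure S" "y \<in> closure S"
  then obtain f g where "\<And>n. f n \<in> S" "f \<longlonglongrightarrow> x" "\<And>n. g n \<in> S" "g \<longlonglongrightarrow> y"
    unfolding closure_sequential by blast
  then show "x + y \<in> closure S"
    unfolding closure_sequential
    by (intro exI[of _ "\<lambda>n. f n + g n"])
      (auto intro!: tendsto_intros complex_vector.subspace_add[OF assms])
next
  fix c x assume "x \<in> closure S"
  then show "c *\<^sub>C x \<in> closure S"
    using bounded_clinear_closure[of "\<lambda>x. c *\<^sub>C x" S S x] complex_vector.subspace_scale[OF assms]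
      bounded_clinear_scaleC[of "\<lambda>x. x" c] by auto
qed

subsection \<open>Riesz representation\<close>

text \<open>Minimising \<open>\<parallel>s\<parallel>\<^sup>2 - 2 Re (f s)\<close> over \<open>S\<close> works although \<open>S\<close> need not be closed.\<close>

lemma riesz_subspace:
  fixes f :: "'h::chilbert_space \<Rightarrow> complex"
  assumes S: "csubspace S"
    and add: "\<And>x y. x \<in> S \<Longrightarrow> y \<in> S \<Longrightarrow> f (x + y) = f x + f y"
    and scale: "\<And>c x. x \<in> S \<Longrightarrow> f (c *\<^sub>C x) = c * f x"
    and bnd: "\<And>x. x \<in> S \<Longrightarrow> cmod (f x) \<le> C * norm x"
  shows "\<exists>v\<in>closure S. \<forall>x\<in>S. f x = cinner x v"
proof -
  have S0: "0 \<in> S" using S complex_vector.subspace_0 by blast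
  define Q where "Q x = (norm x)\<^sup>2 - 2 * Re (f x)" for x
  define m where "m = (INF x\<in>S. Q x)"
  have lb: "- C\<^sup>2 \<le> Q x" if "x \<in> S" for x
  proof -
    have "Re (f x) \<le> C * norm x" using bnd[OF that] complex_Re_le_cmod order_trans by blast
    moreover have "0 \<le> (norm x - C)\<^sup>2" by simp
    ultimately show ?thesis unfolding Q_def by (simp add: power2_diff mult_ac)
  qed
  then have bb: "bdd_below (Q ` S)" by (intro bdd_belowI2)
  have m_le: "m \<le> Q x" if "x \<in> S" for x
    unfolding m_def using bb that by (rule cINF_lower)
  have f0: "f 0 = 0" using scale[OF S0, of 0] by simp
  have fscaleR: "f (r *\<^sub>R x) = complex_of_real r * f x" if "x \<in> S" for r x
    using scale[OF that] by (simp add: scaleR_scaleC)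
  \<comment> \<open>The midpoint of \<open>x\<close> and \<open>y\<close> lies in \<open>S\<close>,
    so its value is at least \<open>m\<close>. The parallelogram law then turns near-minimality into
    closeness, which makes a minimising sequence Cauchy.\<close>
  have par: "(norm (x - y))\<^sup>2 \<le> 2 * (Q x - m) + 2 * (Q y - m)" if "x \<in> S" "y \<in> S" for x y
  proof -
    have z: "(1/2) *\<^sub>R (x + y) \<in> S"
      using that S by (simp add: scaleR_scaleC complex_vector.subspace_add complex_vector.subspace_scale)
    have "f ((1/2) *\<^sub>R (x + y)) = complex_of_real (1/2) * (f x + f y)"
      using that add fscaleR S by (simp add: complex_vector.subspace_add)
    then have "Re (f ((1/2) *\<^sub>R (x + y))) = (Re (f x) + Re (f y)) / 2"
      by (simp only: Re_complex_of_real times_complex.sel Im_complex_of_real plus_complex.sel)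
    moreover have "(norm ((1/2) *\<^sub>R (x + y)))\<^sup>2 = (norm (x + y))\<^sup>2 / 4" 
      by (simp add: power_mult_distrib power2_eq_square)
    ultimately have "m \<le> (norm (x + y))\<^sup>2 / 4 - (Re (f x) + Re (f y))"
      using m_le[OF z] unfolding Q_def by simp
    moreover have "(norm (x - y))\<^sup>2 = 2 * (norm x)\<^sup>2 + 2 * (norm y)\<^sup>2 - (norm (x + y))\<^sup>2"
      by (simp add: power2_norm_eq_inner algebra_simps inner_commute)
    ultimately show ?thesis unfolding Q_def by (simp add: algebra_simps)
  qed
  have "\<exists>x\<in>S. Q x < m + 1 / real (Suc n)" for n
    using cINF_less_iff[OF _ bb, of "m + 1 / real (Suc n)"] S0 unfolding m_def by auto
  then obtain s where s: "\<And>n. s n \<in> S" "\<And>n. Q (s n) < m + 1 / real (Suc n)" by metis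
  have close: "(norm (s i - s j))\<^sup>2 \<le> 4 / real (Suc n)" if "n \<le> i" "n \<le> j" for i j n
  proof -
    have "1 / real (Suc i) \<le> 1 / real (Suc n)" "1 / real (Suc j) \<le> 1 / real (Suc n)"
      using that by (auto simp: frac_le)
    moreover have "A \<le> 4 * r" if "A \<le> 2 * (p - m) + 2 * (q - m)" "p < m + a" "q < m + b" "a \<le> r" "b \<le> r"
      for A p q a b r :: real using that by (simp add: algebra_simps)
    ultimately have "(norm (s i - s j))\<^sup>2 \<le> 4 * (1 / real (Suc n))"
      using par[OF s(1) s(1), of i j] s(2)[of i] s(2)[of j] by blast
    then show ?thesis by simp
  qed
  have "Cauchy s"
  proof (rule metric_CauchyI)
    fix e :: real assume e: "0 < e"
    obtain n where n: "4 / e\<^sup>2 < real (Suc n)"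
      using reals_Archimedean2 less_trans by (metis lessI of_nat_less_iff)
    have "4 / real (Suc n) < e\<^sup>2" using n e by (simp add: field_simps)
    then have "dist (s i) (s j) < e" if "n \<le> i" "n \<le> j" for i j
      using close[OF that] e by (simp add: dist_norm power_less_imp_less_base[of _ 2])
    then show "\<exists>M. \<forall>i\<ge>M. \<forall>j\<ge>M. dist (s i) (s j) < e" by blast
  qed
  then obtain v where v: "s \<longlonglongrightarrow> v" using convergent_eq_Cauchy by blast
  have vS: "v \<in> closure S" unfolding closure_sequential using s v by blast
  have ReQ: "Re (f x) = Re (cinner x v)" if x: "x \<in> S" for x
  proof -
    \<comment> \<open>Moving the minimising sequence in the direction \<open>x\<close> cannot push
      the value below \<open>m\<close>; the limit of these comparisons is a quadratic inequality in
      \<open>r\<close>, which forces the linear term to vanish.\<close>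
    have lin: "0 \<le> r\<^sup>2 * (norm x)\<^sup>2 + 2 * r * Re (cinner x v) - 2 * r * Re (f x)" for r
    proof -
      have "m \<le> Q (s n + r *\<^sub>R x)" for n
        by (rule m_le) (use s x S in \<open>simp add: scaleR_scaleC complex_vector.subspace_add complex_vector.subspace_scale\<close>)
      moreover have "Q (s n + r *\<^sub>R x) = Q (s n) + r\<^sup>2 * (norm x)\<^sup>2 + 2 * r * Re (cinner x (s n)) - 2 * r * Re (f x)" for n
      proof -
        have "f (s n + r *\<^sub>R x) = f (s n) + complex_of_real r * f x"
          using add[of "s n" "r *\<^sub>R x"] s(1) x fscaleR S by (simp add: scaleR_scaleC complex_vector.subspace_scale)
        moreover have "(norm (s n + r *\<^sub>R x))\<^sup>2 = (norm (s n))\<^sup>2 + r\<^sup>2 * (norm x)\<^sup>2 + 2 * r * Re (cinner x (s n))"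
          unfolding inner_eq_Re_cinner[symmetric]
          by (simp only: power2_norm_eq_inner)
            (simp add: algebra_simps inner_commute power2_eq_square[of r])
        ultimately show ?thesis by (simp add: Q_def algebra_simps)
      qed
      ultimately have "0 \<le> 1 / real (Suc n) + (r\<^sup>2 * (norm x)\<^sup>2 + 2 * r * Re (cinner x (s n)) - 2 * r * Re (f x))" for n
        using s(2)[of n] by (smt (verit))
      moreover have "(\<lambda>n. 1 / real (Suc n) + (r\<^sup>2 * (norm x)\<^sup>2 + 2 * r * Re (cinner x (s n)) - 2 * r * Re (f x)))
          \<longlonglongrightarrow> 0 + (r\<^sup>2 * (norm x)\<^sup>2 + 2 * r * Re (cinner x v) - 2 * r * Re (f x))"
        by (intro tendsto_intros v LIMSEQ_Suc[OF lim_1_over_n])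
      ultimately show ?thesis
        using LIMSEQ_le_const by fastforce
    qed
    define d where "d = Re (cinner x v) - Re (f x)"
    have lin': "0 \<le> r\<^sup>2 * (norm x)\<^sup>2 + 2 * r * d" for r
      using lin[of r] by (simp add: d_def algebra_simps)
    have "d = 0"
    proof (rule ccontr)
      assume d: "d \<noteq> 0"
      \<comment> \<open>The summand 1 keeps the divisor positive when \<open>x = 0\<close>; at
        \<open>r = - d / N\<close> the linear term outweighs the quadratic one.\<close>
      define N where "N = (norm x)\<^sup>2 + 1"
      have N: "0 < N" "(norm x)\<^sup>2 \<le> N" by (auto simp: N_def add_nonneg_pos)
      have "0 \<le> (d / N)\<^sup>2 * (norm x)\<^sup>2 + 2 * (- d / N) * d" using lin'[of "- d / N"] by simp
      also have "\<dots> \<le> (d / N)\<^sup>2 * N + 2 * (- d / N) * d"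
        using N by (intro add_right_mono mult_left_mono) auto
      also have "\<dots> = - (d\<^sup>2 / N)" using N by (simp add: power2_eq_square field_simps)
      also have "\<dots> < 0" using d N by simp
      finally show False by simp
    qed
    then show ?thesis by (simp add: d_def)
  qed
  have "f x = cinner x v" if x: "x \<in> S" for x
  proof (rule complex_eqI)
    show "Re (f x) = Re (cinner x v)" by (rule ReQ[OF x])
    have "Re (f (\<i> *\<^sub>C x)) = Re (cinner (\<i> *\<^sub>C x) v)"
      by (rule ReQ) (use x S in \<open>simp add: complex_vector.subspace_scale\<close>)
    then show "Im (f x) = Im (cinner x v)" by (simp add: scale[OF x] cinner_scaleC_left)
  qed
  then show ?thesis using vS by blast
qed

text \<open>The Riesz vector of \<open>\<lambda>s. cinner s v\<close> on \<open>S\<close> is the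
  projection of \<open>v\<close>; linearity and \<open>e s = s\<close> come from its
  uniqueness.\<close>

lemma projection_exists:
  fixes S :: "'h::chilbert_space set"
  assumes S: "csubspace S"
  obtains e where "bounded_clinear e" "\<And>v. e v \<in> closure S" "\<And>v s. s \<in> closure S \<Longrightarrow> cinner (v - e v) s = 0"
    "\<And>s. s \<in> closure S \<Longrightarrow> e s = s" "\<And>v. norm (e v) \<le> norm v" "\<And>v w. cinner (e v) w = cinner v (e w)"
proof -
  have "\<exists>e. e \<in> closure S \<and> (\<forall>s\<in>S. cinner s v = cinner s e)" for v
    using riesz_subspace[OF S, of "\<lambda>s. cinner s v" "norm v"]
    by (auto simp: cinner_simps norm_cinner_le mult.commute[of "norm v"])
  then obtain e where e: "\<And>v. e v \<in> closure S" "\<And>v s. s \<in> S \<Longrightarrow> cinner s v = cinner s (e v)" by metis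
  have ortho: "cinner (v - e v) s = 0" if "s \<in> closure S" for v s
  proof (rule cinner_zero_closure[OF _ that])
    fix s assume "s \<in> S"
    then have "cinner s (v - e v) = 0" using e(2)[OF \<open>s \<in> S\<close>, of v] by (simp add: cinner_diff_right)
    then show "cinner (v - e v) s = 0" by (metis cinner_commute complex_cnj_zero)
  qed
  have csc: "csubspace (closure S)" by (rule csubspace_closure[OF S])
  have uniq: "e v = w" if "w \<in> closure S" "\<And>s. s \<in> closure S \<Longrightarrow> cinner (v - w) s = 0" for v w
  proof -
    have "e v - w \<in> closure S" using e(1) that(1) csc complex_vector.subspace_diff by blast
    then have "cinner (v - w) (e v - w) = 0" "cinner (v - e v) (e v - w) = 0" using that(2) ortho by auto
    then have "cinner (e v - w) (e v - w) = 0" by (simp add: cinner_diff_left)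
    then show ?thesis by simp
  qed
  have lin: "clinear e"
  proof (rule clinearI)
    fix x y c
    show "e (x + y) = e x + e y"
    proof (rule uniq)
      show "e x + e y \<in> closure S" using e(1) csc complex_vector.subspace_add by blast
      show "cinner (x + y - (e x + e y)) s = 0" if "s \<in> closure S" for s
        using ortho[OF that, of x] ortho[OF that, of y] by (simp add: cinner_simps)
    qed
    show "e (c *\<^sub>C x) = c *\<^sub>C e x"
    proof (rule uniq)
      show "c *\<^sub>C e x \<in> closure S" using e(1) csc complex_vector.subspace_scale by blast
      show "cinner (c *\<^sub>C x - c *\<^sub>C e x) s = 0" if "s \<in> closure S" for s
        using ortho[OF that, of x] by (simp add: cinner_simps)
    qed
  qed
  have nrm: "norm (e v) \<le> norm v" for v
  proof -
    have "cinner (e v) (e v) = cinner v (e v)" using ortho[OF e(1), of v v] by (simp add: cinner_simps)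
    then have "norm (e v) * norm (e v) \<le> norm v * norm (e v)"
      using norm_cinner_le[of v "e v"] by (metis cinner_self norm_of_real power2_eq_square abs_of_nonneg zero_le_power2)
    then show ?thesis by (cases "e v = 0") auto
  qed
  have sa: "cinner (e v) w = cinner v (e w)" for v w
  proof -
    have "cinner (e v) (w - e w) = 0" using ortho[OF e(1), of w v]
      by (metis cinner_commute complex_cnj_zero)
    then show ?thesis using ortho[OF e(1), of v w] by (simp add: cinner_simps)
  qed
  show ?thesis
  proof (rule that[of e])
    show "bounded_clinear e" using lin nrm by (intro bounded_clinearI[where K = 1]) auto
    show "e s = s" if "s \<in> closure S" for s by (rule uniq[OF that]) simp
  qed (use e ortho nrm sa in auto)
qed

subsection \<open>Adjoints\<close>

text \<open>The formula of \<open>adj\<close> for maps between different types: slices and Fourier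
  coefficients are built from adjoints of \<open>V g\<close> and \<open>t h\<close>.\<close>

definition cadj :: "('h::chilbert_space \<Rightarrow> 'k::chilbert_space) \<Rightarrow> ('k \<Rightarrow> 'h)" where
  "cadj T = (THE S. \<forall>v w. cinner (T v) w = cinner v (S w))"

lemma adj_eq_cadj: "adj T = cadj T"
  by (simp add: adj_def cadj_def)

lemma cadj_unique:
  assumes "\<And>v w. cinner (T v) w = cinner v (S w)"
  shows "cadj T = S"
  unfolding cadj_def
proof (rule the_equality)
  show "S' = S" if "\<forall>v w. cinner (T v) w = cinner v (S' w)" for S'
  proof
    fix w
    show "S' w = S w"
    proof (rule cinner_eqI)
      fix z
      have "cinner z (S' w) = cinner z (S w)" using assms[of z w] that by simp
      then show "cinner (S' w) z = cinner (S w) z" by (subst (1 2) cinner_commute) simp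
    qed
  qed
qed (use assms in blast)

lemma cadj_exists:
  assumes "bounded_clinear (T :: 'h::chilbert_space \<Rightarrow> 'k::chilbert_space)"
  shows "bounded_clinear (cadj T) \<and> (\<forall>v w. cinner (T v) w = cinner v (cadj T w))"
proof -
  obtain K where K: "0 < K" "\<And>x. norm (T x) \<le> K * norm x"
    using bounded_clinear_bound[OF assms] by blast
  have lin: "clinear T" using assms by (rule bounded_clinear_clinear)
  have "\<exists>s. \<forall>v. cinner (T v) w = cinner v s" for w
  proof -
    have "\<exists>s\<in>closure UNIV. \<forall>v\<in>UNIV. cinner (T v) w = cinner v s"
    proof (rule riesz_subspace[where C = "K * norm w"])
      show "cmod (cinner (T x) w) \<le> K * norm w * norm x" for x
        using norm_cinner_le[of "T x" w] mult_right_mono[OF K(2)[of x], of "norm w"] by (simp add: mult_ac)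
    qed (use lin in \<open>auto simp: clinear_simps cinner_simps\<close>)
    then show ?thesis by blast
  qed
  then obtain S where S: "\<And>v w. cinner (T v) w = cinner v (S w)" by metis
  have S': "cinner (S w) v = cinner w (T v)" for v w using S cinner_commute by metis
  have "bounded_clinear S"
  proof (rule bounded_clinearI[where K = K])
    show "clinear S"
      by (rule clinearI; rule cinner_eqI) (simp_all add: cinner_simps S')
    fix w
    show "norm (S w) \<le> K * norm w"
    proof (rule norm_le_by_cinner)
      show "cmod (cinner (S w) y) \<le> K * norm w * norm y" for y
        using norm_cinner_le[of w "T y"] mult_left_mono[OF K(2)[of y], of "norm w"] by (simp add: S' mult_ac)
    qed (use K in auto)
  qed
  then show ?thesis using cadj_unique[of T S] S by simp
qed

lemma bounded_clinear_cadj: "bounded_clinear T \<Longrightarrow> bounded_clinear (cadj T)"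
  using cadj_exists by blast

lemma cadj_right: "bounded_clinear T \<Longrightarrow> cinner v (cadj T w) = cinner (T v) w"
  using cadj_exists[of T] by simp

lemma cadj_left: "bounded_clinear T \<Longrightarrow> cinner (cadj T w) v = cinner w (T v)"
  by (metis cadj_right cinner_commute)

lemma cadj_comp:
  "bounded_clinear S \<Longrightarrow> bounded_clinear T \<Longrightarrow> cadj (S \<circ> T) = cadj T \<circ> cadj S"
  by (rule cadj_unique) (simp add: cadj_right)

lemma norm_cadj_le:
  assumes "bounded_clinear T" "0 \<le> K" "\<And>x. norm (T x) \<le> K * norm x"
  shows "norm (cadj T w) \<le> K * norm w"
proof (rule norm_le_by_cinner)
  show "cmod (cinner (cadj T w) y) \<le> K * norm w * norm y" for y
    using norm_cinner_le[of w "T y"] mult_left_mono[OF assms(3)[of y], of "norm w"]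
    by (simp add: cadj_left[OF assms(1)] mult_ac)
qed (use assms in auto)

lemma adj_right: "T \<in> bounded_ops \<Longrightarrow> cinner v (adj T w) = cinner (T v) w"
  and adj_left: "T \<in> bounded_ops \<Longrightarrow> cinner (adj T w) v = cinner w (T v)"
  and adj_bounded: "T \<in> bounded_ops \<Longrightarrow> adj T \<in> bounded_ops"
  and adj_comp: "S \<in> bounded_ops \<Longrightarrow> T \<in> bounded_ops \<Longrightarrow> adj (S \<circ> T) = adj T \<circ> adj S"
  by (simp_all add: bounded_ops_iff adj_eq_cadj cadj_right cadj_left bounded_clinear_cadj cadj_comp)

lemma adj_unique: "(\<And>v w. cinner (T v) w = cinner v (S w)) \<Longrightarrow> adj T = S"
  by (simp add: adj_eq_cadj cadj_unique)

lemma adj_id [simp]: "adj id = id"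
  by (rule adj_unique) simp

lemma adj_plus:
  "S \<in> bounded_ops \<Longrightarrow> T \<in> bounded_ops \<Longrightarrow> adj (\<lambda>v. S v + T v) = (\<lambda>v. adj S v + adj T v)"
  by (rule adj_unique) (simp add: adj_right cinner_simps)

lemma adj_scaleC: "T \<in> bounded_ops \<Longrightarrow> adj (\<lambda>v. c *\<^sub>C T v) = (\<lambda>v. cnj c *\<^sub>C adj T v)"
  by (rule adj_unique) (simp add: adj_right cinner_simps)

lemma bounded_ops_simps [intro]:
  "id \<in> bounded_ops"
  "S \<in> bounded_ops \<Longrightarrow> T \<in> bounded_ops \<Longrightarrow> S \<circ> T \<in> bounded_ops"
  "S \<in> bounded_ops \<Longrightarrow> T \<in> bounded_ops \<Longrightarrow> (\<lambda>v. S v + T v) \<in> bounded_ops"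
  "S \<in> bounded_ops \<Longrightarrow> T \<in> bounded_ops \<Longrightarrow> (\<lambda>v. S v - T v) \<in> bounded_ops"
  "T \<in> bounded_ops \<Longrightarrow> (\<lambda>v. c *\<^sub>C T v) \<in> bounded_ops"
  by (simp_all add: bounded_ops_iff bounded_clinear_comp bounded_clinear_plus bounded_clinear_minus
      bounded_clinear_scaleC)

lemma bounded_ops_clinear: "T \<in> bounded_ops \<Longrightarrow> clinear T"
  by (simp add: bounded_ops_def)

lemmas ops_simps = clinear_simps[OF bounded_ops_clinear]

subsection \<open>Extension of bounded linear relations\<close>

text \<open>A partial map is given by its graph \<open>R\<close>, so that its well-definedness need
  not be shown beforehand: the bound, applied to a difference, implies it. The extension arises as
  the adjoint of a map supplied by Riesz representation, without limits of sequences.\<close>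

lemma extend_bounded_relation:
  fixes R :: "('h::chilbert_space \<times> 'k::chilbert_space) set"
  assumes zero: "(0, 0) \<in> R"
    and add: "\<And>v w v' w'. (v, w) \<in> R \<Longrightarrow> (v', w') \<in> R \<Longrightarrow> (v + v', w + w') \<in> R"
    and scale: "\<And>c v w. (v, w) \<in> R \<Longrightarrow> (c *\<^sub>C v, c *\<^sub>C w) \<in> R"
    and bnd: "\<And>v w. (v, w) \<in> R \<Longrightarrow> norm w \<le> C * norm v" and C: "0 \<le> C"
  obtains T where "bounded_clinear T" "\<And>v w. (v, w) \<in> R \<Longrightarrow> T v = w"
    "\<And>v. (\<And>s. s \<in> Domain R \<Longrightarrow> cinner v s = 0) \<Longrightarrow> T v = 0"
    "\<And>v. norm (T v) \<le> C * norm v"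
proof -
  have single: "w = w'" if "(v, w) \<in> R" "(v, w') \<in> R" for v w w'
  proof -
    have "(v + (-1) *\<^sub>C v, w + (-1) *\<^sub>C w') \<in> R" using that add scale by blast
    then have "(0, w - w') \<in> R" by (simp add: scaleC_minus_one)
    then show ?thesis using bnd by fastforce
  qed
  define f where "f v = (THE w. (v, w) \<in> R)" for v
  have f: "f v = w" if "(v, w) \<in> R" for v w
    unfolding f_def using that single by blast
  have D: "csubspace (Domain R)"
    by (rule csubspaceI) (use zero add scale in blast)+
  \<comment> \<open>\<open>S\<close> will be the adjoint of the extension. Choosing its values in
    the closed domain is what makes the extension vanish on the orthogonal complement.\<close>
  have "\<exists>s. s \<in> closure (Domain R) \<and> (\<forall>v\<in>Domain R. cinner (f v) u = cinner v s)" for u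
  proof -
    have "\<exists>s\<in>closure (Domain R). \<forall>v\<in>Domain R. cinner (f v) u = cinner v s"
    proof (rule riesz_subspace[OF D, where C = "C * norm u"])
      fix x y assume "x \<in> Domain R" "y \<in> Domain R"
      then obtain x' y' where "(x, x') \<in> R" "(y, y') \<in> R" by blast
      moreover from this have "f (x + y) = x' + y'" using add f by blast
      ultimately show "cinner (f (x + y)) u = cinner (f x) u + cinner (f y) u"
        by (simp add: f cinner_simps)
    next
      fix c x assume "x \<in> Domain R"
      then obtain x' where "(x, x') \<in> R" by blast
      moreover from this have "f (c *\<^sub>C x) = c *\<^sub>C x'" using scale f by blast
      ultimately show "cinner (f (c *\<^sub>C x)) u = c * cinner (f x) u"
        by (simp add: f cinner_simps)
    next
      fix x assume "x \<in> Domain R"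
      then obtain x' where "(x, x') \<in> R" by blast
      then have "norm (f x) \<le> C * norm x" by (simp add: f bnd)
      then show "cmod (cinner (f x) u) \<le> C * norm u * norm x"
        using norm_cinner_le[of "f x" u] mult_right_mono[of "norm (f x)" "C * norm x" "norm u"]
        by (simp add: mult_ac)
    qed
    then show ?thesis by blast
  qed
  then obtain S where S: "\<And>u. S u \<in> closure (Domain R)" "\<And>u v. v \<in> Domain R \<Longrightarrow> cinner (f v) u = cinner v (S u)"
    by metis
  have S_norm: "norm (S u) \<le> C * norm u" for u
  proof (rule norm_le_by_cinner_closure[OF S(1)])
    fix s assume s: "s \<in> Domain R"
    then obtain w where w: "(s, w) \<in> R" by blast
    have "cmod (cinner s (S u)) = cmod (cinner w u)" using S(2)[OF s, of u] f[OF w] by simp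
    also have "\<dots> \<le> norm w * norm u" by (rule norm_cinner_le)
    also have "\<dots> \<le> C * norm s * norm u" using bnd[OF w] by (simp add: mult_right_mono)
    finally show "cmod (cinner s (S u)) \<le> C * norm u * norm s" by (simp add: mult_ac)
  qed (use C in simp)
  have cS: "csubspace (closure (Domain R))" by (rule csubspace_closure[OF D])
  have S_uniq: "S u = s" if "s \<in> closure (Domain R)" and s: "\<And>v. v \<in> Domain R \<Longrightarrow> cinner (f v) u = cinner v s" for u s
  proof -
    have "S u - s \<in> closure (Domain R)" using S(1) that(1) cS complex_vector.subspace_diff by blast
    moreover have "cinner (S u - s) v = 0" if "v \<in> Domain R" for v
      using S(2)[OF that, of u] s[OF that]
      by (metis cinner_commute cinner_diff_left right_minus_eq)
    ultimately have "cinner (S u - s) (S u - s) = 0" using cinner_zero_closure by blast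
    then show ?thesis by simp
  qed
  have S_bcl: "bounded_clinear S"
  proof (rule bounded_clinearI[where K = C])
    show "clinear S"
    proof (rule clinearI; rule S_uniq)
      show "S x + S y \<in> closure (Domain R)" "c *\<^sub>C S x \<in> closure (Domain R)" for x y c
        using S(1) cS complex_vector.subspace_add complex_vector.subspace_scale by blast+
    qed (simp_all add: S(2) cinner_simps)
  qed (rule S_norm)
  show ?thesis
  proof (rule that[of "cadj S"])
    show "bounded_clinear (cadj S)" by (rule bounded_clinear_cadj[OF S_bcl])
    show "cadj S v = w" if "(v, w) \<in> R" for v w
    proof (rule cinner_eqI)
      fix z
      have "v \<in> Domain R" using that by blast
      then show "cinner (cadj S v) z = cinner w z"
        using S(2)[of v z] f[OF that] by (simp add: cadj_left[OF S_bcl])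
    qed
    show "cadj S v = 0" if "\<And>s. s \<in> Domain R \<Longrightarrow> cinner v s = 0" for v
      by (rule cinner_eqI) (use cinner_zero_closure[OF that S(1)] in \<open>simp add: cadj_left[OF S_bcl]\<close>)
    show "norm (cadj S v) \<le> C * norm v" for v
      by (rule norm_cadj_le[OF S_bcl C S_norm])
  qed
qed

section \<open>Von Neumann algebras\<close>

lemma commutantI: "T \<in> bounded_ops \<Longrightarrow> (\<And>X v. X \<in> S \<Longrightarrow> T (X v) = X (T v)) \<Longrightarrow> T \<in> commutant S"
  by (auto simp: commutant_def fun_eq_iff)

lemma commutantD: "T \<in> commutant S \<Longrightarrow> X \<in> S \<Longrightarrow> T (X v) = X (T v)"
  by (auto simp: commutant_def fun_eq_iff)

lemma commutant_bounded: "commutant S \<subseteq> bounded_ops"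
  by (auto simp: commutant_def)

lemma commutant_antimono: "S \<subseteq> T \<Longrightarrow> commutant T \<subseteq> commutant S"
  by (auto simp: commutant_def)

lemma bicommutant_extensive: "S \<subseteq> bounded_ops \<Longrightarrow> S \<subseteq> commutant (commutant S)"
  by (fastforce simp: commutant_def)

lemma bicommutant_mono: "S \<subseteq> T \<Longrightarrow> commutant (commutant S) \<subseteq> commutant (commutant T)"
  by (intro commutant_antimono)

lemma tricommutant: "S \<subseteq> bounded_ops \<Longrightarrow> commutant (commutant (commutant S)) = commutant S"
  by (intro equalityI commutant_antimono bicommutant_extensive commutant_bounded)

lemma commutant_id: "id \<in> commutant S"
  by (rule commutantI) auto

lemma commutant_comp: "x \<in> commutant S \<Longrightarrow> y \<in> commutant S \<Longrightarrow> x \<circ> y \<in> commutant S"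
  using commutant_bounded by (intro commutantI) (auto simp: commutantD)

lemma commutant_plus:
  assumes "S \<subseteq> bounded_ops" "x \<in> commutant S" "y \<in> commutant S"
  shows "(\<lambda>v. x v + y v) \<in> commutant S"
proof (rule commutantI)
  show "(\<lambda>v. x v + y v) \<in> bounded_ops" using assms commutant_bounded by blast
  show "x (X v) + y (X v) = X (x v + y v)" if "X \<in> S" for X v
    using assms that by (auto simp: commutantD ops_simps subset_eq)
qed

lemma commutant_scaleC:
  assumes "S \<subseteq> bounded_ops" "x \<in> commutant S"
  shows "(\<lambda>v. c *\<^sub>C x v) \<in> commutant S"
proof (rule commutantI)
  show "(\<lambda>v. c *\<^sub>C x v) \<in> bounded_ops" using assms commutant_bounded by blast
  show "c *\<^sub>C x (X v) = X (c *\<^sub>C x v)" if "X \<in> S" for X v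
    using assms that by (auto simp: commutantD ops_simps subset_eq)
qed

lemma commutant_adj:
  assumes "S \<subseteq> bounded_ops" "\<And>x. x \<in> S \<Longrightarrow> adj x \<in> S" "T \<in> commutant S"
  shows "adj T \<in> commutant S"
proof (rule commutantI)
  have T: "T \<in> bounded_ops" using assms(3) commutant_bounded by blast
  then show "adj T \<in> bounded_ops" by (rule adj_bounded)
  fix X v assume X: "X \<in> S"
  then have Xb: "X \<in> bounded_ops" using assms(1) by blast
  show "adj T (X v) = X (adj T v)"
  proof (rule cinner_eqI)
    fix z
    have "cinner (adj T (X v)) z = cinner v (adj X (T z))" by (simp add: adj_left[OF T] adj_right[OF Xb])
    also have "\<dots> = cinner v (T (adj X z))" using commutantD[OF assms(3) assms(2)[OF X]] by simp
    also have "\<dots> = cinner (X (adj T v)) z" using adj_left[OF T] adj_right[OF Xb] by metis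
    finally show "cinner (adj T (X v)) z = cinner (X (adj T v)) z" .
  qed
qed

section \<open>Star algebras of operators, generated algebras, and orbits of vectors\<close>

definition star_algebra :: "('h::chilbert_space \<Rightarrow> 'h) set \<Rightarrow> bool" where
  "star_algebra S \<longleftrightarrow> S \<subseteq> bounded_ops \<and> id \<in> S \<and>
     (\<forall>x\<in>S. \<forall>y\<in>S. x \<circ> y \<in> S \<and> (\<lambda>v. x v + y v) \<in> S) \<and>
     (\<forall>c. \<forall>x\<in>S. (\<lambda>v. c *\<^sub>C x v) \<in> S) \<and> (\<forall>x\<in>S. adj x \<in> S)"

lemma star_algebraD:
  assumes "star_algebra S"
  shows "S \<subseteq> bounded_ops" "id \<in> S" "x \<in> S \<Longrightarrow> x \<in> bounded_ops"
    "x \<in> S \<Longrightarrow> y \<in> S \<Longrightarrow> x \<circ> y \<in> S"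
    "x \<in> S \<Longrightarrow> y \<in> S \<Longrightarrow> (\<lambda>v. x v + y v) \<in> S"
    "x \<in> S \<Longrightarrow> (\<lambda>v. c *\<^sub>C x v) \<in> S" "x \<in> S \<Longrightarrow> adj x \<in> S"
  using assms by (auto simp: star_algebra_def)

lemma star_algebra_minus:
  assumes "star_algebra S" "x \<in> S" "y \<in> S"
  shows "(\<lambda>v. x v - y v) \<in> S"
  using star_algebraD(5)[OF assms(1,2) star_algebraD(6)[OF assms(1,3), of "-1"]]
  by (simp add: scaleC_minus_one)

lemma star_algebra_zero: "star_algebra S \<Longrightarrow> (\<lambda>v. 0) \<in> S"
  using star_algebraD(6)[of S id 0] star_algebraD(2)[of S] by simp

lemma star_algebra_commutant:
  assumes "S \<subseteq> bounded_ops" "\<And>x. x \<in> S \<Longrightarrow> adj x \<in> S"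
  shows "star_algebra (commutant S)"
  unfolding star_algebra_def
  by (intro conjI ballI allI commutant_bounded commutant_id commutant_comp commutant_plus
      commutant_scaleC commutant_adj assms)

text \<open>The algebra parametrises the graph of \<open>f x \<mapsto> g x\<close>; the bound makes
  this a map even if \<open>f\<close> is not injective. Usually \<open>f x\<close> is the value of
  \<open>x\<close> at a fixed vector.\<close>

lemma extend_from_algebra:
  fixes f :: "('h::chilbert_space \<Rightarrow> 'h) \<Rightarrow> 'k::chilbert_space" and g :: "('h \<Rightarrow> 'h) \<Rightarrow> 'l::chilbert_space"
  assumes S: "star_algebra S"
    and add: "\<And>x y. x \<in> S \<Longrightarrow> y \<in> S \<Longrightarrow> f (\<lambda>v. x v + y v) = f x + f y"
      "\<And>x y. x \<in> S \<Longrightarrow> y \<in> S \<Longrightarrow> g (\<lambda>v. x v + y v) = g x + g y"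
    and scale: "\<And>c x. x \<in> S \<Longrightarrow> f (\<lambda>v. c *\<^sub>C x v) = c *\<^sub>C f x"
      "\<And>c x. x \<in> S \<Longrightarrow> g (\<lambda>v. c *\<^sub>C x v) = c *\<^sub>C g x"
    and bnd: "\<And>x. x \<in> S \<Longrightarrow> norm (g x) \<le> C * norm (f x)" and C: "0 \<le> C"
  obtains T where "bounded_clinear T" "\<And>x. x \<in> S \<Longrightarrow> T (f x) = g x"
    "\<And>v. (\<And>x. x \<in> S \<Longrightarrow> cinner v (f x) = 0) \<Longrightarrow> T v = 0" "\<And>v. norm (T v) \<le> C * norm v"
proof -
  define R where "R = (\<lambda>x. (f x, g x)) ` S"
  have R_I: "(f x, g x) \<in> R" if "x \<in> S" for x using that by (simp add: R_def)
  obtain T where T: "bounded_clinear T" "\<And>v w. (v, w) \<in> R \<Longrightarrow> T v = w"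
    "\<And>v. (\<And>s. s \<in> Domain R \<Longrightarrow> cinner v s = 0) \<Longrightarrow> T v = 0" "\<And>v. norm (T v) \<le> C * norm v"
  proof (rule extend_bounded_relation[of R C])
    show "(0, 0) \<in> R"
      using R_I[OF star_algebraD(6)[OF S star_algebraD(2)[OF S], of 0]]
        scale[OF star_algebraD(2)[OF S], of 0] by simp
    show "(v + v', w + w') \<in> R" if vw: "(v, w) \<in> R" "(v', w') \<in> R" for v w v' w'
    proof -
      obtain x y where xy: "x \<in> S" "y \<in> S" "v = f x" "w = g x" "v' = f y" "w' = g y"
        using vw unfolding R_def by blast
      then show ?thesis using R_I[OF star_algebraD(5)[OF S xy(1,2)]] by (simp add: add)
    qed
    show "(c *\<^sub>C v, c *\<^sub>C w) \<in> R" if vw: "(v, w) \<in> R" for c v w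
    proof -
      obtain x where x: "x \<in> S" "v = f x" "w = g x" using vw unfolding R_def by blast
      then show ?thesis using R_I[OF star_algebraD(6)[OF S x(1), of c]] by (simp add: scale)
    qed
    show "norm w \<le> C * norm v" if "(v, w) \<in> R" for v w using that bnd unfolding R_def by auto
  qed (use C that in auto)
  show ?thesis
  proof (rule that[OF T(1)])
    show "T (f x) = g x" if "x \<in> S" for x by (rule T(2)[OF R_I[OF that]])
    show "T v = 0" if "\<And>x. x \<in> S \<Longrightarrow> cinner v (f x) = 0" for v
      by (rule T(3)) (use that in \<open>auto simp: R_def\<close>)
  qed (rule T(4))
qed

lemma vna_star_algebra:
  assumes "von_neumann_algebra M"
  shows "star_algebra M"
proof -
  have M: "M \<subseteq> bounded_ops" "\<And>x. x \<in> M \<Longrightarrow> adj x \<in> M" "commutant (commutant M) = M"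
    using assms by (auto simp: von_neumann_algebra_def)
  show ?thesis
    using star_algebra_commutant[OF commutant_bounded commutant_adj[OF M(1,2)]] M(3) by simp
qed

lemma vna_bicommutant_eq: "von_neumann_algebra M \<Longrightarrow> commutant (commutant M) = M"
  by (simp add: von_neumann_algebra_def)

lemma vna_bicommutant:
  assumes "S \<subseteq> bounded_ops" "\<And>x. x \<in> S \<Longrightarrow> adj x \<in> S"
  shows "von_neumann_algebra (commutant (commutant S))"
  unfolding von_neumann_algebra_def
  using commutant_bounded commutant_adj[OF commutant_bounded commutant_adj[OF assms]]
    tricommutant[OF commutant_bounded] by blast

lemma vna_bounded_ops: "von_neumann_algebra (bounded_ops :: ('h::chilbert_space \<Rightarrow> 'h) set)"
  unfolding von_neumann_algebra_def
  using adj_bounded commutant_bounded bicommutant_extensive by blast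

lemma vn_generated_subset: "S \<subseteq> vn_generated S"
  by (auto simp: vn_generated_def)

lemma vn_generated_least: "von_neumann_algebra M \<Longrightarrow> S \<subseteq> M \<Longrightarrow> vn_generated S \<subseteq> M"
  by (auto simp: vn_generated_def)

lemma vna_vn_generated:
  assumes "S \<subseteq> bounded_ops"
  shows "von_neumann_algebra (vn_generated S)"
proof -
  have b: "vn_generated S \<subseteq> bounded_ops" by (rule vn_generated_least[OF vna_bounded_ops assms])
  moreover have "commutant (commutant (vn_generated S)) \<subseteq> M"
    if "von_neumann_algebra M" "S \<subseteq> M" for M
    using bicommutant_mono[OF vn_generated_least[OF that]] vna_bicommutant_eq[OF that(1)] by simp
  then have "commutant (commutant (vn_generated S)) \<subseteq> vn_generated S"
    by (auto simp: vn_generated_def)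
  moreover have "adj x \<in> vn_generated S" if "x \<in> vn_generated S" for x
    using that by (auto simp: vn_generated_def von_neumann_algebra_def)
  ultimately show ?thesis
    using bicommutant_extensive[OF b] by (auto simp: von_neumann_algebra_def)
qed

lemma vn_generated_mono: "S \<subseteq> T \<Longrightarrow> vn_generated S \<subseteq> vn_generated T"
  by (auto simp: vn_generated_def)

text \<open>Operators are plain functions and not elements of a \<open>chilbert_space\<close> type,
  so \<open>complex_vector.span\<close> does not apply to them. The inductive form provides the
  induction by which identities pass from generators to the spanned algebra.\<close>

inductive_set lspan :: "('h::chilbert_space \<Rightarrow> 'h) set \<Rightarrow> ('h \<Rightarrow> 'h) set" for S where
  base: "x \<in> S \<Longrightarrow> x \<in> lspan S"
| plus: "x \<in> lspan S \<Longrightarrow> y \<in> lspan S \<Longrightarrow> (\<lambda>v. x v + y v) \<in> lspan S"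
| scaleC: "x \<in> lspan S \<Longrightarrow> (\<lambda>v. c *\<^sub>C x v) \<in> lspan S"

lemma star_algebra_lspan:
  assumes "S \<subseteq> bounded_ops" "id \<in> S" "\<And>x y. x \<in> S \<Longrightarrow> y \<in> S \<Longrightarrow> x \<circ> y \<in> S"
    "\<And>x. x \<in> S \<Longrightarrow> adj x \<in> S"
  shows "star_algebra (lspan S)"
proof -
  have b: "x \<in> bounded_ops" if "x \<in> lspan S" for x
    using that by induction (use assms in auto)
  have "x \<circ> y \<in> lspan S" if "x \<in> lspan S" "y \<in> S" for x y
    using that
  proof induction
    case (plus x x')
    then show ?case using lspan.plus[of "x \<circ> y" S "x' \<circ> y"] by (simp add: comp_def)
  next
    case (scaleC x c)
    then show ?case using lspan.scaleC[of "x \<circ> y" S c] by (simp add: comp_def)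
  qed (use assms lspan.base in blast)
  moreover have "x \<circ> y \<in> lspan S" if "y \<in> lspan S" "x \<in> lspan S" "\<And>z. z \<in> S \<Longrightarrow> x \<circ> z \<in> lspan S" for x y
    using that
  proof induction
    case (plus y y')
    then show ?case using lspan.plus[of "x \<circ> y" S "x \<circ> y'"] b[of x] by (simp add: comp_def ops_simps)
  next
    case (scaleC y c)
    then show ?case using lspan.scaleC[of "x \<circ> y" S c] b[of x] by (simp add: comp_def ops_simps)
  qed
  ultimately have "x \<circ> y \<in> lspan S" if "x \<in> lspan S" "y \<in> lspan S" for x y
    using that by blast
  moreover have "adj x \<in> lspan S" if "x \<in> lspan S" for x
    using that
    by induction (use b in \<open>auto simp: adj_plus adj_scaleC intro: lspan.intros assms(4)\<close>)
  ultimately show ?thesis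
    using b assms lspan.base unfolding star_algebra_def by (auto intro: lspan.plus lspan.scaleC)
qed

lemma csubspace_orbit:
  assumes "star_algebra S"
  shows "csubspace ((\<lambda>s. s v) ` S)"
proof (rule csubspaceI)
  show "0 \<in> (\<lambda>s. s v) ` S" using star_algebra_zero[OF assms] by force
  show "x + y \<in> (\<lambda>s. s v) ` S" if "x \<in> (\<lambda>s. s v) ` S" "y \<in> (\<lambda>s. s v) ` S" for x y
    using that star_algebraD(5)[OF assms] by force
  show "c *\<^sub>C x \<in> (\<lambda>s. s v) ` S" if "x \<in> (\<lambda>s. s v) ` S" for x c
    using that star_algebraD(6)[OF assms] by force
qed

lemma orbit_base: "star_algebra S \<Longrightarrow> v \<in> (\<lambda>s. s v) ` S"
  using image_eqI[of v "\<lambda>s. s v" id S] star_algebraD(2) by force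

lemma orbit_mult:
  assumes "star_algebra S" "x \<in> S" "w \<in> (\<lambda>s. s v) ` S"
  shows "x w \<in> (\<lambda>s. s v) ` S"
proof -
  obtain s where "s \<in> S" "w = s v" using assms(3) by blast
  then show ?thesis using star_algebraD(4)[OF assms(1,2), of s] by (intro image_eqI[of _ _ "x \<circ> s"]) auto
qed

text \<open>Invariance under \<open>n\<close> gives \<open>n e = e n e\<close>, invariance under
  \<open>adj n\<close> gives \<open>e n = e n e\<close>.\<close>

lemma projection_commutes:
  assumes e: "bounded_clinear e" "\<And>v. e v \<in> closure S" "\<And>s. s \<in> closure S \<Longrightarrow> e s = s"
    "\<And>v w. cinner (e v) w = cinner v (e w)"
    and n: "n \<in> bounded_ops" "\<And>s. s \<in> S \<Longrightarrow> n s \<in> S" "\<And>s. s \<in> S \<Longrightarrow> adj n s \<in> S"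
  shows "e (n v) = n (e v)"
proof (rule cinner_eqI)
  fix z
  have inv: "n s \<in> closure S" "adj n s \<in> closure S" if "s \<in> closure S" for s
    using that n adj_bounded[OF n(1)] bounded_clinear_closure[of _ S S] by (auto simp: bounded_ops_iff)
  have "cinner (e (n v)) z = cinner v (adj n (e z))" by (simp add: e(4) adj_right[OF n(1)])
  also have "adj n (e z) = e (adj n (e z))" using e(2,3) inv by simp
  also have "cinner v (e (adj n (e z))) = cinner (e (n (e v))) z"
    by (simp add: e(4)[symmetric] adj_right[OF n(1)])
  also have "e (n (e v)) = n (e v)" using e(2,3) inv by simp
  finally show "cinner (e (n v)) z = cinner (n (e v)) z" .
qed

text \<open>A predicate on \<open>e\<close>, so that one fixed projection can later be a locale
  parameter.\<close>

definition orbit_projection :: "('h::chilbert_space \<Rightarrow> 'h) set \<Rightarrow> 'h \<Rightarrow> ('h \<Rightarrow> 'h) \<Rightarrow> bool" where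
  "orbit_projection S \<xi> e \<longleftrightarrow> e \<in> commutant S \<and> (\<forall>v. e v \<in> closure ((\<lambda>s. s \<xi>) ` S)) \<and>
    (\<forall>v\<in>closure ((\<lambda>s. s \<xi>) ` S). e v = v) \<and> (\<forall>v. norm (e v) \<le> norm v) \<and>
    (\<forall>v w. cinner (e v) w = cinner v (e w))"

lemma orbit_projectionD:
  assumes "orbit_projection S \<xi> e"
  shows "e \<in> commutant S" "e v \<in> closure ((\<lambda>s. s \<xi>) ` S)"
    "v \<in> closure ((\<lambda>s. s \<xi>) ` S) \<Longrightarrow> e v = v" "norm (e v) \<le> norm v"
    "cinner (e v) w = cinner v (e w)"
  using assms by (auto simp: orbit_projection_def)

lemma orbit_projection_exists:
  assumes S: "star_algebra S"
  obtains e where "orbit_projection S \<xi> e"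
proof -
  obtain e where e: "bounded_clinear e" "\<And>v. e v \<in> closure ((\<lambda>s. s \<xi>) ` S)"
    "\<And>s. s \<in> closure ((\<lambda>s. s \<xi>) ` S) \<Longrightarrow> e s = s" "\<And>v. norm (e v) \<le> norm v"
    "\<And>v w. cinner (e v) w = cinner v (e w)"
    by (rule projection_exists[OF csubspace_orbit[OF S, of \<xi>]]) (rule that)
  have "e \<in> commutant S"
  proof (rule commutantI)
    fix n v assume n: "n \<in> S"
    have "m w \<in> (\<lambda>s. s \<xi>) ` S" if "m \<in> S" "w \<in> (\<lambda>s. s \<xi>) ` S" for m w
      using orbit_mult[OF S that] .
    then show "e (n v) = n (e v)"
      using n star_algebraD(3,7)[OF S] by (intro projection_commutes[OF e(1,2,3,5)]) auto
  qed (use e in \<open>simp add: bounded_ops_iff\<close>)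
  then have "orbit_projection S \<xi> e" using e(2-5) unfolding orbit_projection_def by blast
  then show ?thesis by (rule that)
qed

text \<open>Von Neumann's density argument for a single vector: the projection onto the closed orbit
  lies in the commutant of \<open>S\<close>, hence commutes with \<open>x\<close>, and it fixes
  \<open>v\<close>. Several vectors are handled by amplification.\<close>

lemma bicommutant_orbit:
  assumes S: "star_algebra S" and x: "x \<in> commutant (commutant S)"
  shows "x v \<in> closure ((\<lambda>s. s v) ` S)"
proof -
  obtain e where "orbit_projection S v e" by (rule orbit_projection_exists[OF S])
  note e = orbit_projectionD[OF this]
  have "v \<in> (\<lambda>s. s v) ` S" by (rule orbit_base[OF S])
  then have "e v = v" by (intro e(3) closure_subset[THEN subsetD])
  then have "x v = e (x v)" using commutantD[OF x e(1), of v] by simp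
  then show ?thesis using e(2)[of "x v"] by simp
qed

definition separating :: "('h::chilbert_space \<Rightarrow> 'h) set \<Rightarrow> 'h \<Rightarrow> bool" where
  "separating M \<Omega> \<longleftrightarrow> (\<forall>x\<in>M. x \<Omega> = 0 \<longrightarrow> x = (\<lambda>_. 0))"

definition tracial_vector :: "('h::chilbert_space \<Rightarrow> 'h) set \<Rightarrow> 'h \<Rightarrow> bool" where
  "tracial_vector M \<Omega> \<longleftrightarrow> (\<forall>x\<in>M. \<forall>y\<in>M. cinner (x (y \<Omega>)) \<Omega> = cinner (y (x \<Omega>)) \<Omega>)"

text \<open>With \<open>e\<close> the projection onto the closed orbit of \<open>\<Omega>\<close>
  under the commutant, \<open>1 - e\<close> lies in the bicommutant \<open>N\<close> and annihilates
  the separating vector.\<close>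

lemma separating_commutant_cyclic:
  assumes N: "von_neumann_algebra N" and sep: "separating N \<Omega>"
  shows "closure ((\<lambda>X. X \<Omega>) ` commutant N) = UNIV"
proof -
  have S: "star_algebra (commutant N)"
    using N by (intro star_algebra_commutant) (auto simp: von_neumann_algebra_def)
  obtain e where "orbit_projection (commutant N) \<Omega> e" by (rule orbit_projection_exists[OF S])
  note e = orbit_projectionD[OF this]
  have "\<Omega> \<in> (\<lambda>X. X \<Omega>) ` commutant N" by (rule orbit_base[OF S])
  then have "e \<Omega> = \<Omega>" by (intro e(3) closure_subset[THEN subsetD])
  moreover have "(\<lambda>v. id v - e v) \<in> N"
    using star_algebra_minus[OF vna_star_algebra[OF N]] star_algebraD(2)[OF vna_star_algebra[OF N]]
      e(1) vna_bicommutant_eq[OF N] by blast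
  ultimately have "(\<lambda>v. id v - e v) = (\<lambda>_. 0)" using sep unfolding separating_def by force
  then have "e v = v" for v by (metis eq_iff_diff_eq_0 id_apply)
  then have "v \<in> closure ((\<lambda>X. X \<Omega>) ` commutant N)" for v using e(2)[of v] by simp
  then show ?thesis by (rule UNIV_eq_I[symmetric])
qed

subsection \<open>Positive operators as sums of squares\<close>

definition contractive_positive :: "('h::chilbert_space \<Rightarrow> 'h) \<Rightarrow> bool" where
  "contractive_positive D \<longleftrightarrow> D \<in> bounded_ops \<and> (\<forall>v w. cinner (D v) w = cinner v (D w)) \<and>
     (\<forall>v. 0 \<le> Re (cinner (D v) v) \<and> Re (cinner (D v) v) \<le> (norm v)\<^sup>2)"

text \<open>The operator \<open>1 - a\<^sup>* a / K\<^sup>2\<close>. It is positive when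
  \<open>K\<close> bounds \<open>a\<close>, which turns norm estimates into statements about sums of
  squares.\<close>

definition defect :: "real \<Rightarrow> ('h::chilbert_space \<Rightarrow> 'h) \<Rightarrow> ('h \<Rightarrow> 'h)" where
  "defect K a = (\<lambda>v. id v - complex_of_real (1 / K\<^sup>2) *\<^sub>C (adj a \<circ> a) v)"

lemma cinner_defect:
  "a \<in> bounded_ops \<Longrightarrow> cinner (defect K a v) w = cinner v w - complex_of_real (1 / K\<^sup>2) * cinner (a v) (a w)"
  using adj_left[of a] by (simp add: defect_def cinner_simps)

lemma Re_cinner_defect:
  "a \<in> bounded_ops \<Longrightarrow> Re (cinner (defect K a v) v) = (norm v)\<^sup>2 - (norm (a v))\<^sup>2 / K\<^sup>2"
  by (simp add: cinner_defect cinner_self Re_divide_of_real flip: of_real_power of_real_mult of_real_divide)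

lemma contractive_positive_defect:
  assumes a: "a \<in> bounded_ops" and K: "0 < K" "\<And>v. norm (a v) \<le> K * norm v"
  shows "contractive_positive (defect K a)"
  unfolding contractive_positive_def
proof (intro conjI allI)
  show "defect K a \<in> bounded_ops"
    unfolding defect_def by (intro bounded_ops_simps a adj_bounded)
  have "cinner v (defect K a w) = cinner v w - complex_of_real (1 / K\<^sup>2) * cinner (a v) (a w)" for v w
    using cinner_defect[OF a, of K w v] cinner_commute[of v "defect K a w"]
      cinner_commute[of v w] cinner_commute[of "a v" "a w"] by simp
  then show "cinner (defect K a v) w = cinner v (defect K a w)" for v w by (simp add: cinner_defect[OF a])
  fix v
  have "(norm (a v))\<^sup>2 \<le> K\<^sup>2 * (norm v)\<^sup>2"
    using power_mono[OF K(2)[of v], of 2] by (simp add: power_mult_distrib)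
  then show "0 \<le> Re (cinner (defect K a v) v)" using K(1) unfolding Re_cinner_defect[OF a] by (simp add: field_simps)
  show "Re (cinner (defect K a v) v) \<le> (norm v)\<^sup>2" unfolding Re_cinner_defect[OF a] by simp
qed

text \<open>From \<open>D = D\<^sup>2 + (D - D\<^sup>2)\<close>, where \<open>0 \<le> D - D\<^sup>2 \<le> 1\<close> again, every operator \<open>0 \<le> D \<le> 1\<close>
  is a strongly convergent sum of squares of polynomials in \<open>D\<close>. This replaces square roots.\<close>

primrec square_terms :: "('h::chilbert_space \<Rightarrow> 'h) \<Rightarrow> nat \<Rightarrow> ('h \<Rightarrow> 'h)" where
  "square_terms D 0 = D"
| "square_terms D (Suc k) = (\<lambda>v. square_terms D k v - square_terms D k (square_terms D k v))"

lemma contractive_positive_step: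
  assumes "contractive_positive D"
  shows "contractive_positive (\<lambda>v. D v - D (D v))"
proof -
  have D: "D \<in> bounded_ops" "\<And>v w. cinner (D v) w = cinner v (D w)"
    "\<And>v. 0 \<le> Re (cinner (D v) v)" "\<And>v. Re (cinner (D v) v) \<le> (norm v)\<^sup>2"
    using assms by (auto simp: contractive_positive_def)
  have DD: "D (v - w) = D v - D w" for v w using D(1) by (simp add: ops_simps)
  have eq: "cinner (D v - D (D v)) v = cinner (D v) v - cinner (D v) (D v)" for v
    using D(2)[of "D v" v] by (simp add: cinner_simps)
  \<comment> \<open>The identity \<open>D - D\<^sup>2 = (1 - D) D (1 - D) + D (1 - D) D\<close>
    exhibits the difference as a sum of two positive operators.\<close>
  have split: "cinner (D v) v - cinner (D v) (D v) =
      cinner (D (v - D v)) (v - D v) + (cinner (D v) (D v) - cinner (D (D v)) (D v))" for v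
    using D(2)[of "D v" v] by (simp add: cinner_simps DD)
  have "0 \<le> Re (cinner (D v - D (D v)) v)" for v
    using D(3)[of "v - D v"] D(4)[of "D v"] unfolding eq split by (simp add: cinner_self_Re)
  moreover have "Re (cinner (D v - D (D v)) v) \<le> (norm v)\<^sup>2" for v
    using D(4)[of v] zero_le_power2[of "norm (D v)"] unfolding eq minus_complex.sel cinner_self_Re by linarith
  moreover have "(\<lambda>v. D v - D (D v)) \<in> bounded_ops"
    using bounded_ops_simps(4)[OF D(1) bounded_ops_simps(2)[OF D(1) D(1)]] by (simp add: comp_def)
  ultimately show ?thesis
    by (simp add: contractive_positive_def cinner_simps D(2))
qed

lemma contractive_positive_square_terms:
  "contractive_positive D \<Longrightarrow> contractive_positive (square_terms D k)"
  by (induction k) (auto intro: contractive_positive_step)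

lemma square_terms_symmetric:
  assumes "contractive_positive D"
  shows "cinner (square_terms D k v) w = cinner v (square_terms D k w)"
  using contractive_positive_square_terms[OF assms, of k] by (auto simp: contractive_positive_def)

lemma square_terms_partial_sum:
  assumes "contractive_positive D"
  shows "(\<Sum>k<n. cinner (square_terms D k v) (square_terms D k w)) =
    cinner (D v) w - cinner (square_terms D n v) w"
proof (induction n)
  case (Suc n)
  then show ?case
    using square_terms_symmetric[OF assms, of n "square_terms D n v" w] by (simp add: cinner_simps)
qed simp

text \<open>The sum of squares telescopes, so its partial sums are bounded and its terms tend to 0.
  As each term is also the remainder of the expansion, the expansion converges.\<close>

lemma square_terms_tendsto_0:
  assumes "contractive_positive D"
  shows "(\<lambda>n. square_terms D n v) \<longlonglongrightarrow> 0"
proof -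
  have "(\<Sum>k<n. (norm (square_terms D k v))\<^sup>2) \<le> Re (cinner (D v) v)" for n
  proof -
    have "(\<Sum>k<n. (norm (square_terms D k v))\<^sup>2) = Re (cinner (D v) v) - Re (cinner (square_terms D n v) v)"
      using arg_cong[OF square_terms_partial_sum[OF assms, of v v n], of Re] by (simp add: cinner_self_Re)
    then show ?thesis
      using contractive_positive_square_terms[OF assms, of n] by (auto simp: contractive_positive_def)
  qed
  then have "summable (\<lambda>k. (norm (square_terms D k v))\<^sup>2)"
    by (intro summableI_nonneg_bounded) auto
  then have "(\<lambda>k. sqrt ((norm (square_terms D k v))\<^sup>2)) \<longlonglongrightarrow> sqrt 0"
    by (intro tendsto_real_sqrt summable_LIMSEQ_zero)
  then show ?thesis by (simp add: tendsto_norm_zero_iff)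
qed

lemma square_terms_sums:
  assumes "contractive_positive D"
  shows "(\<lambda>k. cinner (square_terms D k v) (square_terms D k w)) sums cinner (D v) w"
proof -
  have "(\<lambda>n. cinner (D v) w - cinner (square_terms D n v) w) \<longlonglongrightarrow> cinner (D v) w - cinner 0 w"
    by (intro tendsto_intros square_terms_tendsto_0[OF assms])
  then show ?thesis by (simp add: sums_def square_terms_partial_sum[OF assms])
qed

lemma square_terms_sums_norm:
  assumes "contractive_positive D"
  shows "(\<lambda>k. (norm (square_terms D k v))\<^sup>2) sums Re (cinner (D v) v)"
  using sums_Re[OF square_terms_sums[OF assms, of v v]] by (simp add: cinner_self_Re)

lemma square_terms_commute:
  assumes "\<And>v. D (x v) = x (D v)" "clinear x"
  shows "square_terms D k (x v) = x (square_terms D k v)"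
  using assms by (induction k arbitrary: v) (auto simp: clinear_simps)

subsection \<open>Conditional expectations\<close>

text \<open>\<open>X\<close> commutes with \<open>N\<close> only and cannot be moved past
  \<open>p\<close>. The positive operator \<open>h\<close>, a multiple of
  \<open>e X\<^sup>* X e\<close>, is therefore written as a sum of squares of symmetric operators
  \<open>square_terms h k\<close> in the commutant of \<open>N\<close>, each of which satisfies the
  exchange rule \<open>key\<close>. The rule gives the estimate for every term, and summation gives
  it for \<open>X\<close>.\<close>

lemma conditional_expectation_bound:
  assumes N: "von_neumann_algebra N" and P: "star_algebra P" and NP: "N \<subseteq> P"
    and tr: "tracial_vector P \<Omega>" and p: "p \<in> P" and X: "X \<in> commutant N"
    and ep: "orbit_projection N \<Omega> e"
    and K: "0 < K" "\<And>v. norm (p v) \<le> K * norm v"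
  shows "norm (X (e (p \<Omega>))) \<le> K * norm (X \<Omega>)"
proof -
  note e = orbit_projectionD[OF ep]
  let ?L = "closure ((\<lambda>n. n \<Omega>) ` N)"
  have sN: "star_algebra N" by (rule vna_star_algebra[OF N])
  have sN': "star_algebra (commutant N)"
    using star_algebra_commutant star_algebraD[OF sN] by blast
  have Nb: "n \<in> bounded_ops" "n \<in> P" if "n \<in> N" for n using that star_algebraD(3)[OF sN] NP by auto
  have pb: "p \<in> bounded_ops" using p star_algebraD(3)[OF P] by blast
  have Xb: "X \<in> bounded_ops" "adj X \<in> commutant N" using X star_algebraD(3,7)[OF sN'] by auto
  have eb: "e \<in> bounded_ops" using e(1) star_algebraD(3)[OF sN'] by blast
  have \<Omega>L: "\<Omega> \<in> ?L" by (intro orbit_base[OF sN] closure_subset[THEN subsetD])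
  have NL: "n v \<in> ?L" if "n \<in> N" "v \<in> ?L" for n v
  proof (rule bounded_clinear_closure[OF _ _ that(2)])
    show "bounded_clinear n" using Nb that by (simp add: bounded_ops_iff)
    show "n s \<in> (\<lambda>n. n \<Omega>) ` N" if "s \<in> (\<lambda>n. n \<Omega>) ` N" for s
      using orbit_mult[OF sN \<open>n \<in> N\<close> that] .
  qed
  obtain KX where KX: "0 < KX" "\<And>v. norm (X v) \<le> KX * norm v"
    using bounded_clinear_bound Xb(1) by (auto simp: bounded_ops_iff)
  define c where "c = 1 / KX\<^sup>2"
  have c: "0 < c" using KX by (simp add: c_def)
  \<comment> \<open>The two projections make every \<open>square_terms h k\<close> take values in
    the closed orbit \<open>?L\<close>; the factor \<open>c\<close> scales \<open>h\<close> below
    the identity.\<close>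
  define h where "h v = complex_of_real c *\<^sub>C e (adj X (X (e v)))" for v
  have h_form: "cinner (h v) w = complex_of_real c * cinner (X (e v)) (X (e w))" for v w
    by (simp add: h_def cinner_simps e(5) adj_left[OF Xb(1)])
  have h: "contractive_positive h"
    unfolding contractive_positive_def
  proof (intro conjI allI)
    have "(\<lambda>v. complex_of_real c *\<^sub>C (e \<circ> (adj X \<circ> (X \<circ> e))) v) \<in> bounded_ops"
      using eb Xb adj_bounded by blast
    then show "h \<in> bounded_ops" by (simp add: h_def[abs_def])
    show "cinner (h v) w = cinner v (h w)" for v w
      by (subst (2) cinner_commute) (simp add: h_form cinner_commute[symmetric])
    fix v
    have eq: "Re (cinner (h v) v) = c * (norm (X (e v)))\<^sup>2"
      unfolding h_form by (simp add: cinner_self)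
    show "0 \<le> Re (cinner (h v) v)" unfolding eq using c by simp
    have "norm (X (e v)) \<le> KX * norm v"
      using KX(2)[of "e v"] mult_left_mono[OF e(4)[of v], of KX] KX(1) by linarith
    then have "(norm (X (e v)))\<^sup>2 \<le> (KX * norm v)\<^sup>2" by (rule power_mono) simp
    then show "Re (cinner (h v) v) \<le> (norm v)\<^sup>2"
      unfolding eq c_def using KX(1) by (simp add: field_simps)
  qed
  have hk: "contractive_positive (square_terms h k)" for k
    by (rule contractive_positive_square_terms[OF h])
  have h_comm: "square_terms h k (n v) = n (square_terms h k v)" if "n \<in> N" for k n v
  proof (rule square_terms_commute)
    show "h (n v) = n (h v)" for v
      using Nb(1)[OF that] commutantD[OF _ that] e(1) X Xb(2) by (simp add: h_def ops_simps)
    show "clinear n" by (rule bounded_ops_clinear[OF Nb(1)[OF that]])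
  qed
  have ee: "e (e v) = e v" for v using e(2,3) by blast
  have eh: "e (square_terms h k v) = square_terms h k v" for k v
    by (induction k arbitrary: v) (simp_all add: h_def ops_simps[OF eb] ee)
  have hL: "square_terms h k v \<in> ?L" for k v using e(2)[of "square_terms h k v"] eh by simp
  have hsym: "cinner (square_terms h k v) w = cinner v (square_terms h k w)" for k v w
    by (rule square_terms_symmetric[OF h])
  have trace: "cinner (x (y \<Omega>)) \<Omega> = cinner (y (x \<Omega>)) \<Omega>" if "x \<in> P" "y \<in> P" for x y
    using tr that by (auto simp: tracial_vector_def)
  \<comment> \<open>The map \<open>m \<Omega> \<mapsto> adj m \<Omega>\<close> is isometric by the
    trace property and fixes the vector \<open>square_terms h k \<Omega>\<close>, because this
    operator is symmetric and commutes with \<open>N\<close>. Hence the adjoints of a sequence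
    approximating that vector approximate it as well.\<close>
  have adj_dist: "norm (adj m \<Omega> - square_terms h k \<Omega>) = norm (m \<Omega> - square_terms h k \<Omega>)"
    if m: "m \<in> N" for m k
  proof -
    have m': "adj m \<in> N" using m star_algebraD(7)[OF sN] by blast
    have 1: "cinner (adj m \<Omega>) (adj m \<Omega>) = cinner (m \<Omega>) (m \<Omega>)"
      using trace[OF Nb(2)[OF m] Nb(2)[OF m']]
      by (simp add: adj_right[OF Nb(1)[OF m]]) (metis adj_left adj_right Nb(1) m cinner_commute)
    have "cinner (adj m \<Omega>) (square_terms h k \<Omega>) = cinner (adj m (square_terms h k \<Omega>)) \<Omega>"
      by (simp add: hsym[symmetric] h_comm[OF m'])
    also have "\<dots> = cinner (square_terms h k \<Omega>) (m \<Omega>)" by (rule adj_left[OF Nb(1)[OF m]])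
    finally have 2: "cinner (adj m \<Omega>) (square_terms h k \<Omega>) = cinner (square_terms h k \<Omega>) (m \<Omega>)" .
    then have 3: "cinner (square_terms h k \<Omega>) (adj m \<Omega>) = cinner (m \<Omega>) (square_terms h k \<Omega>)"
      by (metis cinner_commute)
    show ?thesis by (rule norm_eqI_cinner) (simp add: cinner_simps 1 2 3)
  qed
  \<comment> \<open>Approximate \<open>\<eta>\<close> by \<open>m i \<Omega>\<close>. Under the
    trace, the factor \<open>m i\<close> next to \<open>n\<close> becomes the factor
    \<open>adj (m i)\<close> to the right of \<open>p\<close>, and the adjoints converge to the same
    \<open>\<eta>\<close>.\<close>
  have key: "square_terms h k (e (p \<Omega>)) = e (p (square_terms h k \<Omega>))" for k
  proof -
    define \<eta> where "\<eta> = square_terms h k \<Omega>"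
    obtain f where f: "(\<forall>i. f i \<in> (\<lambda>n. n \<Omega>) ` N) \<and> f \<longlonglongrightarrow> \<eta>"
      using hL[of k \<Omega>] unfolding closure_sequential \<eta>_def by (rule exE)
    then have "\<forall>i. \<exists>m. m \<in> N \<and> f i = m \<Omega>" by blast
    then obtain m where "\<forall>i. m i \<in> N \<and> f i = m i \<Omega>" by (drule_tac choice) (rule exE)
    then have m: "\<And>i. m i \<in> N" "f = (\<lambda>i. m i \<Omega>)" by auto
    have lim: "(\<lambda>i. m i \<Omega>) \<longlonglongrightarrow> \<eta>" using f m(2) by simp
    have lim': "(\<lambda>i. adj (m i) \<Omega>) \<longlonglongrightarrow> \<eta>"
    proof -
      have "(\<lambda>i. norm (m i \<Omega> - \<eta>)) \<longlonglongrightarrow> 0" using lim LIM_zero tendsto_norm_zero by blast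
      then have "(\<lambda>i. norm (adj (m i) \<Omega> - \<eta>)) \<longlonglongrightarrow> 0"
        using adj_dist[OF m(1), of _ k] by (simp add: \<eta>_def)
      then show ?thesis using LIM_zero_cancel tendsto_norm_zero_iff by blast
    qed
    have *: "cinner (square_terms h k (e (p \<Omega>)) - e (p \<eta>)) (n \<Omega>) = 0" if n: "n \<in> N" for n
    proof -
      have n': "adj n \<in> N" using n star_algebraD(7)[OF sN] by blast
      have "cinner (square_terms h k (e (p \<Omega>))) (n \<Omega>) = cinner (p \<Omega>) (e (n \<eta>))"
        by (simp add: hsym h_comm[OF n] e(5) \<eta>_def)
      also have "e (n \<eta>) = n \<eta>"
        using hL[of k \<Omega>] NL[OF n] e(3) by (simp add: \<eta>_def)
      finally have 1: "cinner (square_terms h k (e (p \<Omega>))) (n \<Omega>) = cinner (p \<Omega>) (n \<eta>)" .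
      have "cinner (p \<Omega>) (n (m i \<Omega>)) = cinner (p (adj (m i) \<Omega>)) (n \<Omega>)" for i
      proof -
        have mi: "adj (m i) \<in> N" using m(1) star_algebraD(7)[OF sN] by blast
        have "cinner (p \<Omega>) (n (m i \<Omega>)) = cinner (adj (m i) ((adj n \<circ> p) \<Omega>)) \<Omega>"
          by (simp add: adj_left[OF Nb(1)[OF m(1)]] adj_left[OF Nb(1)[OF n]])
        also have "\<dots> = cinner ((adj n \<circ> p) (adj (m i) \<Omega>)) \<Omega>"
          by (rule trace[OF Nb(2)[OF mi] star_algebraD(4)[OF P Nb(2)[OF n'] p]])
        also have "\<dots> = cinner (p (adj (m i) \<Omega>)) (n \<Omega>)" by (simp add: adj_left[OF Nb(1)[OF n]])
        finally show ?thesis .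
      qed
      moreover have "(\<lambda>i. cinner (p \<Omega>) (n (m i \<Omega>))) \<longlonglongrightarrow> cinner (p \<Omega>) (n \<eta>)"
        using Nb(1)[OF n] by (intro tendsto_intros bounded_clinear_tendsto[OF _ lim]) (simp add: bounded_ops_iff)
      moreover have "(\<lambda>i. cinner (p (adj (m i) \<Omega>)) (n \<Omega>)) \<longlonglongrightarrow> cinner (p \<eta>) (n \<Omega>)"
        using pb by (intro tendsto_intros bounded_clinear_tendsto[OF _ lim']) (simp add: bounded_ops_iff)
      ultimately have "cinner (p \<Omega>) (n \<eta>) = cinner (p \<eta>) (n \<Omega>)"
        using LIMSEQ_unique by fastforce
      also have "n \<Omega> = e (n \<Omega>)" using NL[OF n \<Omega>L] e(3) by simp
      finally show ?thesis using 1 by (simp add: cinner_simps e(5))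
    qed
    have "square_terms h k (e (p \<Omega>)) - e (p \<eta>) \<in> ?L"
      using hL e(2) csubspace_closure[OF csubspace_orbit[OF sN]] complex_vector.subspace_diff by blast
    then have "cinner (square_terms h k (e (p \<Omega>)) - e (p \<eta>)) (square_terms h k (e (p \<Omega>)) - e (p \<eta>)) = 0"
      using cinner_zero_closure[of "(\<lambda>n. n \<Omega>) ` N"] * by blast
    then show ?thesis by (simp add: \<eta>_def)
  qed
  have term_le: "(norm (square_terms h k (e (p \<Omega>))))\<^sup>2 \<le> K\<^sup>2 * (norm (square_terms h k \<Omega>))\<^sup>2" for k
  proof -
    have "norm (square_terms h k (e (p \<Omega>))) \<le> K * norm (square_terms h k \<Omega>)"
      unfolding key using e(4)[of "p (square_terms h k \<Omega>)"] K(2)[of "square_terms h k \<Omega>"] by linarith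
    then have "(norm (square_terms h k (e (p \<Omega>))))\<^sup>2 \<le> (K * norm (square_terms h k \<Omega>))\<^sup>2"
      by (rule power_mono) simp
    then show ?thesis by (simp add: power_mult_distrib)
  qed
  \<comment> \<open>The squares of the terms sum to the quadratic form of \<open>h\<close>, which is
    \<open>c\<close> times the squared norm of \<open>X\<close> at the two vectors to be
    compared.\<close>
  have "Re (cinner (h (e (p \<Omega>))) (e (p \<Omega>))) \<le> K\<^sup>2 * Re (cinner (h \<Omega>) \<Omega>)"
    by (rule sums_le[OF term_le square_terms_sums_norm[OF h] sums_mult[OF square_terms_sums_norm[OF h]]])
  then have "c * (norm (X (e (p \<Omega>))))\<^sup>2 \<le> K\<^sup>2 * (c * (norm (X \<Omega>))\<^sup>2)"
    unfolding h_form by (simp add: ee e(3)[OF \<Omega>L] cinner_self)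
  then have "(norm (X (e (p \<Omega>))))\<^sup>2 \<le> (K * norm (X \<Omega>))\<^sup>2"
    using c by (simp add: power_mult_distrib mult.left_commute)
  then show ?thesis using K(1) by (simp add: power2_le_iff_abs_le)
qed

text \<open>The expectation of \<open>p\<close> is the operator \<open>X \<Omega> \<mapsto> X (e (p \<Omega>))\<close> for \<open>X\<close> in the commutant
  of \<open>N\<close>, with \<open>e\<close> the projection onto the closure of \<open>N \<Omega>\<close>.\<close>

theorem conditional_expectation:
  assumes N: "von_neumann_algebra N" and P: "star_algebra P" and NP: "N \<subseteq> P"
    and tr: "tracial_vector P \<Omega>" and sep: "separating N \<Omega>" and p: "p \<in> P"
  shows "\<exists>y\<in>N. \<forall>n\<in>N. cinner (p \<Omega> - y \<Omega>) (n \<Omega>) = 0"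
proof -
  have sN: "star_algebra N" by (rule vna_star_algebra[OF N])
  have sN': "star_algebra (commutant N)"
    using star_algebra_commutant star_algebraD[OF sN] by blast
  obtain e where ep: "orbit_projection N \<Omega> e" by (rule orbit_projection_exists[OF sN])
  note e = orbit_projectionD[OF ep]
  have pb: "bounded_clinear p" using p star_algebraD(3)[OF P] by (simp add: bounded_ops_iff)
  obtain K where K: "0 < K" "\<And>v. norm (p v) \<le> K * norm v" using bounded_clinear_bound[OF pb] by blast
  define \<xi> where "\<xi> = e (p \<Omega>)"
  obtain y where y: "bounded_clinear y" and yX: "\<And>X. X \<in> commutant N \<Longrightarrow> y (X \<Omega>) = X \<xi>"
  proof (rule extend_from_algebra[OF sN', of "\<lambda>X. X \<Omega>" "\<lambda>X. X \<xi>" K])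
    show "norm (X \<xi>) \<le> K * norm (X \<Omega>)" if "X \<in> commutant N" for X
      unfolding \<xi>_def by (rule conditional_expectation_bound[OF N P NP tr p that ep K])
  qed (use K that in auto)
  have "y \<in> commutant (commutant N)"
  proof (rule commutantI)
    fix X v assume X: "X \<in> commutant N"
    have Xb: "bounded_clinear X" using X star_algebraD(3)[OF sN'] by (simp add: bounded_ops_iff)
    have "(y \<circ> X) v = (X \<circ> y) v"
    proof (rule bounded_clinear_eq_on_closure[where f = "y \<circ> X" and g = "X \<circ> y" and v = v])
      show "v \<in> closure ((\<lambda>X. X \<Omega>) ` commutant N)"
        using separating_commutant_cyclic[OF N sep] by simp
      show "(y \<circ> X) s = (X \<circ> y) s" if "s \<in> (\<lambda>X. X \<Omega>) ` commutant N" for s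
        using that yX yX[OF star_algebraD(4)[OF sN' X]] by auto
    qed (use Xb y in \<open>auto intro: bounded_clinear_comp\<close>)
    then show "y (X v) = X (y v)" by simp
  qed (use y in \<open>simp add: bounded_ops_iff\<close>)
  then have yN: "y \<in> N" by (simp add: vna_bicommutant_eq[OF N])
  have "y \<Omega> = \<xi>" using yX[OF star_algebraD(2)[OF sN']] by simp
  moreover have "cinner (p \<Omega> - \<xi>) (n \<Omega>) = 0" if "n \<in> N" for n
  proof -
    have "e (n \<Omega>) = n \<Omega>" using that by (intro e(3) closure_subset[THEN subsetD] imageI)
    then show ?thesis unfolding \<xi>_def by (simp add: cinner_simps e(5))
  qed
  ultimately show ?thesis using yN by blast
qed

section \<open>Amplification\<close>

text \<open>\<open>'h ell2\<close> is \<open>\<ell>\<^sup>2(\<nat>) \<otimes> H\<close>. Ultraweakly continuous functionals are the vector functionals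
  of the amplified operators on this space.\<close>

typedef (overloaded) ('h::chilbert_space) ell2 = "{f :: nat \<Rightarrow> 'h. summable (\<lambda>n. (norm (f n))\<^sup>2)}"
  morphisms coord Abs_ell2
  by (rule exI[of _ "\<lambda>_. 0"]) simp

lemma summable_coord: "summable (\<lambda>n. (norm (coord v n))\<^sup>2)"
  using coord[of v] by simp

lemma coord_Abs: "summable (\<lambda>n. (norm (f n))\<^sup>2) \<Longrightarrow> coord (Abs_ell2 f) = f"
  by (simp add: Abs_ell2_inverse)

lemma ell2_eqI: "(\<And>n. coord v n = coord w n) \<Longrightarrow> v = w"
  by (simp add: coord_inject[symmetric] fun_eq_iff)

lemma summable_bounded_bilinear:
  fixes f :: "nat \<Rightarrow> 'a::real_normed_vector" and g :: "nat \<Rightarrow> 'b::real_normed_vector"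
    and h :: "nat \<Rightarrow> 'c::banach"
  assumes "summable (\<lambda>n. (norm (f n))\<^sup>2)" "summable (\<lambda>n. (norm (g n))\<^sup>2)"
    and "\<And>n. norm (h n) \<le> norm (f n) * norm (g n)"
  shows "summable h"
proof (rule summable_comparison_test)
  show "summable (\<lambda>n. (norm (f n))\<^sup>2 + (norm (g n))\<^sup>2)" by (intro summable_add assms)
  have "norm (h n) \<le> (norm (f n))\<^sup>2 + (norm (g n))\<^sup>2" for n
  proof -
    have "0 \<le> (norm (f n) - norm (g n))\<^sup>2" "0 \<le> norm (f n) * norm (g n)" by simp_all
    then have "norm (f n) * norm (g n) \<le> (norm (f n))\<^sup>2 + (norm (g n))\<^sup>2"
      unfolding power2_diff by linarith
    then show ?thesis using assms(3)[of n] by linarith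
  qed
  then show "\<exists>N. \<forall>n\<ge>N. norm (h n) \<le> (norm (f n))\<^sup>2 + (norm (g n))\<^sup>2" by blast
qed

lemma summable_inner: "summable (\<lambda>n. inner (coord v n) (coord w n))"
  by (rule summable_bounded_bilinear[OF summable_coord[of v] summable_coord[of w]])
    (simp add: Cauchy_Schwarz_ineq2)

lemma summable_cinner: "summable (\<lambda>n. cinner (coord v n) (coord w n))"
  by (rule summable_bounded_bilinear[OF summable_coord[of v] summable_coord[of w]]) (rule norm_cinner_le)

lemma summable_add_square:
  fixes f g :: "nat \<Rightarrow> 'a::real_normed_vector"
  assumes "summable (\<lambda>n. (norm (f n))\<^sup>2)" "summable (\<lambda>n. (norm (g n))\<^sup>2)"
  shows "summable (\<lambda>n. (norm (f n + g n))\<^sup>2)"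
proof (rule summable_comparison_test)
  show "summable (\<lambda>n. 2 * (norm (f n))\<^sup>2 + 2 * (norm (g n))\<^sup>2)"
    by (intro summable_add summable_mult assms)
  have "norm ((norm (f n + g n))\<^sup>2) \<le> 2 * (norm (f n))\<^sup>2 + 2 * (norm (g n))\<^sup>2" for n
  proof -
    have "(norm (f n + g n))\<^sup>2 \<le> (norm (f n) + norm (g n))\<^sup>2"
      by (intro power_mono norm_triangle_ineq norm_ge_zero)
    moreover have "0 \<le> (norm (f n) - norm (g n))\<^sup>2" by simp
    ultimately show ?thesis by (simp add: power2_diff power2_sum)
  qed
  then show "\<exists>N. \<forall>n\<ge>N. norm ((norm (f n + g n))\<^sup>2) \<le> 2 * (norm (f n))\<^sup>2 + 2 * (norm (g n))\<^sup>2" by blast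
qed

instantiation ell2 :: (chilbert_space) real_vector
begin

definition zero_ell2 :: "'a ell2" where "zero_ell2 = Abs_ell2 (\<lambda>_. 0)"
definition plus_ell2 :: "'a ell2 \<Rightarrow> 'a ell2 \<Rightarrow> 'a ell2" where
  "plus_ell2 v w = Abs_ell2 (\<lambda>n. coord v n + coord w n)"
definition uminus_ell2 :: "'a ell2 \<Rightarrow> 'a ell2" where
  "uminus_ell2 v = Abs_ell2 (\<lambda>n. - coord v n)"
definition minus_ell2 :: "'a ell2 \<Rightarrow> 'a ell2 \<Rightarrow> 'a ell2" where
  "minus_ell2 v w = v + - w"
definition scaleR_ell2 :: "real \<Rightarrow> 'a ell2 \<Rightarrow> 'a ell2" where
  "scaleR_ell2 r v = Abs_ell2 (\<lambda>n. r *\<^sub>R coord v n)"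

lemma coord_zero [simp]: "coord 0 n = 0"
  by (simp add: zero_ell2_def coord_Abs)

lemma coord_add [simp]: "coord (v + w) n = coord v n + coord w n"
  by (simp add: plus_ell2_def coord_Abs summable_add_square summable_coord)

lemma coord_uminus [simp]: "coord (- v) n = - coord v n"
  by (simp add: uminus_ell2_def coord_Abs summable_coord)

lemma coord_diff [simp]: "coord (v - w) n = coord v n - coord w n"
  by (simp add: minus_ell2_def)

lemma coord_scaleR [simp]: "coord (r *\<^sub>R v) n = r *\<^sub>R coord v n"
  by (simp add: scaleR_ell2_def coord_Abs summable_coord power_mult_distrib summable_mult)

instance
proof
  fix u v w :: "'a ell2" and r s :: real
  show "u + v + w = u + (v + w)" "u + v = v + u" "0 + u = u" "- u + u = 0" "u - v = u + - v"
    "r *\<^sub>R (u + v) = r *\<^sub>R u + r *\<^sub>R v" "(r + s) *\<^sub>R u = r *\<^sub>R u + s *\<^sub>R u" "r *\<^sub>R s *\<^sub>R u = (r * s) *\<^sub>R u" "1 *\<^sub>R u = u"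
    by (rule ell2_eqI; simp add: algebra_simps)+
qed

end

instantiation ell2 :: (chilbert_space) real_inner
begin

definition inner_ell2 :: "'a ell2 \<Rightarrow> 'a ell2 \<Rightarrow> real" where
  "inner_ell2 v w = (\<Sum>n. inner (coord v n) (coord w n))"
definition norm_ell2 :: "'a ell2 \<Rightarrow> real" where "norm_ell2 v = sqrt (inner v v)"
definition dist_ell2 :: "'a ell2 \<Rightarrow> 'a ell2 \<Rightarrow> real" where "dist_ell2 v w = norm (v - w)"
definition sgn_ell2 :: "'a ell2 \<Rightarrow> 'a ell2" where "sgn_ell2 v = v /\<^sub>R norm v"
definition uniformity_ell2 :: "('a ell2 \<times> 'a ell2) filter" where
  "uniformity_ell2 = (INF e\<in>{0 <..}. principal {(v, w). dist v w < e})"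
definition open_ell2 :: "'a ell2 set \<Rightarrow> bool" where
  "open_ell2 U = (\<forall>v\<in>U. eventually (\<lambda>(v', w). v' = v \<longrightarrow> w \<in> U) uniformity)"

instance
proof
  fix u v w :: "'a ell2" and r :: real
  show "dist u v = norm (u - v)" "norm u = sqrt (inner u u)" "sgn u = u /\<^sub>R norm u"
    by (simp_all add: dist_ell2_def norm_ell2_def sgn_ell2_def)
  show "(uniformity :: ('a ell2 \<times> 'a ell2) filter) = (INF e\<in>{0 <..}. principal {(v, w). dist v w < e})"
    by (rule uniformity_ell2_def)
  show "open U = (\<forall>v\<in>U. \<forall>\<^sub>F (v', w) in uniformity. v' = v \<longrightarrow> w \<in> U)" for U :: "'a ell2 set"
    by (rule open_ell2_def)
  show "inner u v = inner v u" by (simp add: inner_ell2_def inner_commute)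
  show "inner (u + v) w = inner u w + inner v w"
    by (simp add: inner_ell2_def inner_add_left suminf_add[symmetric] summable_inner)
  show "inner (r *\<^sub>R u) v = r * inner u v"
    by (simp add: inner_ell2_def suminf_mult summable_inner)
  show "0 \<le> inner u u"
    unfolding inner_ell2_def by (intro suminf_nonneg summable_inner) simp
  show "inner u u = 0 \<longleftrightarrow> u = 0"
  proof
    assume "inner u u = 0"
    then have "\<forall>n. inner (coord u n) (coord u n) = 0"
      unfolding inner_ell2_def using suminf_eq_zero_iff[OF summable_inner[of u u]] by simp
    then show "u = 0" by (intro ell2_eqI) simp
  qed (simp add: inner_ell2_def)
qed

end

lemma norm_ell2_square: "(norm (v :: 'h::chilbert_space ell2))\<^sup>2 = (\<Sum>n. (norm (coord v n))\<^sup>2)"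
  by (simp add: power2_norm_eq_inner inner_ell2_def)

lemma norm_ell2_sums: "(\<lambda>n. (norm (coord v n))\<^sup>2) sums (norm v)\<^sup>2"
  unfolding norm_ell2_square by (rule summable_sums[OF summable_coord])

lemma norm_coord_le: "norm (coord v n) \<le> norm v"
proof -
  have "(\<Sum>k\<in>{n}. (norm (coord v k))\<^sup>2) \<le> (norm v)\<^sup>2"
    unfolding norm_ell2_square by (rule sum_le_suminf[OF summable_coord]) simp_all
  then have "(norm (coord v n))\<^sup>2 \<le> (norm v)\<^sup>2" by simp
  then show ?thesis by (rule power2_le_imp_le) simp
qed

instance ell2 :: (chilbert_space) complete_space
proof
  fix X :: "nat \<Rightarrow> 'a ell2"
  assume X: "Cauchy X"
  have "Cauchy (\<lambda>i. coord (X i) n)" for n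
  proof (rule metric_CauchyI)
    fix e :: real assume "0 < e"
    then obtain M where M: "\<forall>i\<ge>M. \<forall>j\<ge>M. dist (X i) (X j) < e" using metric_CauchyD[OF X] by blast
    have "dist (coord (X i) n) (coord (X j) n) < e" if "i \<ge> M" "j \<ge> M" for i j
      using norm_coord_le[of "X i - X j" n] M that by (auto simp: dist_norm intro: le_less_trans)
    then show "\<exists>M. \<forall>i\<ge>M. \<forall>j\<ge>M. dist (coord (X i) n) (coord (X j) n) < e" by blast
  qed
  then have "\<forall>n. \<exists>l. (\<lambda>i. coord (X i) n) \<longlonglongrightarrow> l" using convergent_eq_Cauchy by blast
  then obtain L where L: "\<forall>n. (\<lambda>i. coord (X i) n) \<longlonglongrightarrow> L n" by (drule_tac choice) (rule exE)
  \<comment> \<open>The estimate is uniform in the length \<open>N\<close> of the partial sums, so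
    the limit in \<open>j\<close> is taken in a finite sum before \<open>N\<close> grows.\<close>
  have part: "\<exists>M. \<forall>i\<ge>M. \<forall>N. (\<Sum>n<N. (norm (coord (X i) n - L n))\<^sup>2) \<le> e\<^sup>2" if e: "0 < e" for e
  proof -
    obtain M where M: "\<forall>i\<ge>M. \<forall>j\<ge>M. dist (X i) (X j) < e" using metric_CauchyD[OF X e] by blast
    have "(\<Sum>n<N. (norm (coord (X i) n - L n))\<^sup>2) \<le> e\<^sup>2" if i: "i \<ge> M" for i N
    proof (rule LIMSEQ_le_const2)
      show "(\<lambda>j. \<Sum>n<N. (norm (coord (X i) n - coord (X j) n))\<^sup>2) \<longlonglongrightarrow>
          (\<Sum>n<N. (norm (coord (X i) n - L n))\<^sup>2)"
        by (intro tendsto_intros L[rule_format])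
      have "(\<Sum>n<N. (norm (coord (X i) n - coord (X j) n))\<^sup>2) \<le> e\<^sup>2" if j: "j \<ge> M" for j
      proof -
        have "(\<Sum>n<N. (norm (coord (X i - X j) n))\<^sup>2) \<le> (norm (X i - X j))\<^sup>2"
          unfolding norm_ell2_square by (rule sum_le_suminf[OF summable_coord]) simp_all
        also have "\<dots> \<le> e\<^sup>2" using M i j by (intro power_mono) (auto simp: dist_norm intro: less_imp_le)
        finally show ?thesis by simp
      qed
      then show "\<exists>M. \<forall>j\<ge>M. (\<Sum>n<N. (norm (coord (X i) n - coord (X j) n))\<^sup>2) \<le> e\<^sup>2" by blast
    qed
    then show ?thesis by blast
  qed
  have sq: "summable (\<lambda>n. (norm (coord (X i) n - L n))\<^sup>2)"
    if "\<forall>N. (\<Sum>n<N. (norm (coord (X i) n - L n))\<^sup>2) \<le> c" for i c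
    using that by (intro summableI_nonneg_bounded[where x = c]) auto
  obtain i where i: "\<forall>N. (\<Sum>n<N. (norm (coord (X i) n - L n))\<^sup>2) \<le> 1\<^sup>2"
    using part[OF zero_less_one] by blast
  have "summable (\<lambda>n. (norm (coord (X i) n + - (coord (X i) n - L n)))\<^sup>2)"
    by (rule summable_add_square[OF summable_coord]) (use sq[OF i] in \<open>simp add: norm_minus_commute\<close>)
  then have L2: "coord (Abs_ell2 L) = L" by (intro coord_Abs) simp
  have "X \<longlonglongrightarrow> Abs_ell2 L"
  proof (rule metric_LIMSEQ_I)
    fix e :: real assume e: "0 < e"
    then obtain M where M: "\<forall>i\<ge>M. \<forall>N. (\<Sum>n<N. (norm (coord (X i) n - L n))\<^sup>2) \<le> (e/2)\<^sup>2"
      using part[of "e/2"] by auto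
    have "dist (X i) (Abs_ell2 L) < e" if "i \<ge> M" for i
    proof -
      have "(norm (X i - Abs_ell2 L))\<^sup>2 \<le> (e/2)\<^sup>2"
        unfolding norm_ell2_square by (rule suminf_le_const[OF summable_coord]) (use M that in \<open>simp add: L2\<close>)
      then have "norm (X i - Abs_ell2 L) \<le> e/2" using e by (simp add: power2_le_iff_abs_le)
      then show ?thesis using e by (simp add: dist_norm)
    qed
    then show "\<exists>M. \<forall>i\<ge>M. dist (X i) (Abs_ell2 L) < e" by blast
  qed
  then show "convergent X" unfolding convergent_def by blast
qed

instantiation ell2 :: (chilbert_space) chilbert_space
begin

definition scaleC_ell2 :: "complex \<Rightarrow> 'a ell2 \<Rightarrow> 'a ell2" where
  "scaleC_ell2 c v = Abs_ell2 (\<lambda>n. c *\<^sub>C coord v n)"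
definition cinner_ell2 :: "'a ell2 \<Rightarrow> 'a ell2 \<Rightarrow> complex" where
  "cinner_ell2 v w = (\<Sum>n. cinner (coord v n) (coord w n))"

lemma coord_scaleC [simp]: "coord (c *\<^sub>C v) n = c *\<^sub>C coord v n"
  by (simp add: scaleC_ell2_def coord_Abs summable_coord power_mult_distrib summable_mult)

instance
proof
  fix u v w :: "'a ell2" and c d :: complex and r :: real
  show "c *\<^sub>C (u + v) = c *\<^sub>C u + c *\<^sub>C v" "(c + d) *\<^sub>C u = c *\<^sub>C u + d *\<^sub>C u"
    "c *\<^sub>C d *\<^sub>C u = (c * d) *\<^sub>C u" "1 *\<^sub>C u = u" "r *\<^sub>R u = complex_of_real r *\<^sub>C u"
    by (rule ell2_eqI; simp add: scaleC_add_right scaleC_add_left scaleC_scaleC scaleR_scaleC)+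
  show "cinner (u + v) w = cinner u w + cinner v w"
    by (simp add: cinner_ell2_def cinner_add_left suminf_add[symmetric] summable_cinner)
  show "cinner (c *\<^sub>C u) v = c * cinner u v"
    by (simp add: cinner_ell2_def cinner_scaleC_left suminf_mult summable_cinner)
  have "(\<lambda>n. cnj (cinner (coord v n) (coord u n))) sums cnj (cinner v u)"
    unfolding cinner_ell2_def sums_cnj by (rule summable_sums[OF summable_cinner])
  then show "cinner u v = cnj (cinner v u)"
    unfolding cinner_ell2_def by (simp add: cinner_commute[symmetric] sums_iff)
  show "inner u v = Re (cinner u v)"
    unfolding cinner_ell2_def inner_ell2_def
    by (simp add: Re_suminf[OF summable_cinner] inner_eq_Re_cinner)
qed

end

lemma cinner_ell2_sums: "(\<lambda>n. cinner (coord v n) (coord w n)) sums cinner v w"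
  unfolding cinner_ell2_def by (rule summable_sums[OF summable_cinner])

lemma bounded_clinear_coord: "bounded_clinear (\<lambda>v. coord v n)"
  by (rule bounded_clinearI[where K = 1]) (auto simp: clinear_def norm_coord_le)

section \<open>Coordinate embeddings and amplified operators\<close>

definition ell2_single :: "nat \<Rightarrow> 'h::chilbert_space \<Rightarrow> 'h ell2" where
  "ell2_single i v = Abs_ell2 (\<lambda>n. if n = i then v else 0)"

lemma coord_single: "coord (ell2_single i v) n = (if n = i then v else 0)"
proof -
  have "summable (\<lambda>n. (norm (if n = i then v else 0))\<^sup>2)"
    by (rule summable_finite[of "{i}"]) auto
  then show ?thesis by (simp add: ell2_single_def coord_Abs)
qed

lemma cinner_single_left: "cinner (ell2_single i v) w = cinner v (coord w i)"
proof -
  have "cinner (ell2_single i v) w = (\<Sum>n\<in>{i}. cinner (coord (ell2_single i v) n) (coord w n))"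
    unfolding cinner_ell2_def by (rule suminf_finite) (auto simp: coord_single)
  then show ?thesis by (simp add: coord_single)
qed

lemma cinner_single_right: "cinner w (ell2_single i v) = cinner (coord w i) v"
  by (subst (1 2) cinner_commute) (simp add: cinner_single_left)

lemma bounded_clinear_single: "bounded_clinear (ell2_single i)"
proof (rule bounded_clinearI[where K = 1])
  show "clinear (ell2_single i)"
    by (rule clinearI; rule ell2_eqI; simp add: coord_single)
  show "norm (ell2_single i v) \<le> 1 * norm v" for v :: 'a
    using norm_eqI_cinner[of "ell2_single i v" v] by (simp add: cinner_single_left coord_single)
qed

text \<open>The adjoints are compared coordinate by coordinate, which avoids approximating a vector
  by its finite sections.\<close>

lemma bounded_clinear_eq_single:
  fixes f g :: "'h::chilbert_space ell2 \<Rightarrow> 'k::chilbert_space"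
  assumes f: "bounded_clinear f" and g: "bounded_clinear g"
    and "\<And>i v. f (ell2_single i v) = g (ell2_single i v)"
  shows "f = g"
proof
  fix v
  have "cinner (coord (cadj f w) n) u = cinner (coord (cadj g w) n) u" for w n u
    using cadj_left[OF f, of w "ell2_single n u"] cadj_left[OF g, of w "ell2_single n u"] assms(3)
    by (simp add: cinner_single_right)
  then have eq: "cadj f w = cadj g w" for w by (rule ell2_eqI[OF cinner_eqI])
  show "f v = g v"
    by (rule cinner_eqI) (simp add: cadj_right[OF f, symmetric] cadj_right[OF g, symmetric] eq)
qed

text \<open>The operator \<open>1 \<otimes> f\<close>. It is allowed to change the type, since it is
  also applied to \<open>V g\<close> and \<open>t h\<close>; the definition is meaningful for
  bounded \<open>f\<close>.\<close>

definition amp :: "('h::chilbert_space \<Rightarrow> 'k::chilbert_space) \<Rightarrow> 'h ell2 \<Rightarrow> 'k ell2" where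
  "amp f v = Abs_ell2 (\<lambda>n. f (coord v n))"

lemma summable_amp:
  assumes "\<And>v. norm (f v) \<le> K * norm v"
  shows "summable (\<lambda>n. (norm (f (coord v n)))\<^sup>2)"
proof (rule summable_comparison_test)
  show "summable (\<lambda>n. K\<^sup>2 * (norm (coord v n))\<^sup>2)" by (intro summable_mult summable_coord)
  have "(norm (f (coord v n)))\<^sup>2 \<le> (K * norm (coord v n))\<^sup>2" for n
    by (rule power_mono[OF assms]) simp
  then show "\<exists>N. \<forall>n\<ge>N. norm ((norm (f (coord v n)))\<^sup>2) \<le> K\<^sup>2 * (norm (coord v n))\<^sup>2"
    by (auto simp: power_mult_distrib)
qed

lemma coord_amp:
  assumes "bounded_clinear f"
  shows "coord (amp f v) n = f (coord v n)"
proof -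
  obtain K where "\<And>x. norm (f x) \<le> K * norm x" using bounded_clinear_bound[OF assms] by blast
  then show ?thesis unfolding amp_def by (subst coord_Abs[OF summable_amp]) simp_all
qed

lemma norm_amp_le:
  assumes "bounded_clinear f" "0 \<le> K" "\<And>v. norm (f v) \<le> K * norm v"
  shows "norm (amp f v) \<le> K * norm v"
proof -
  have "(norm (f (coord v n)))\<^sup>2 \<le> K\<^sup>2 * (norm (coord v n))\<^sup>2" for n
    using power_mono[OF assms(3)[of "coord v n"], of 2] by (simp add: power_mult_distrib)
  then have "(norm (amp f v))\<^sup>2 \<le> K\<^sup>2 * (norm v)\<^sup>2"
    using sums_le[OF _ norm_ell2_sums[of "amp f v"] sums_mult[OF norm_ell2_sums[of v]]]
    by (simp add: coord_amp[OF assms(1)])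
  then have "(norm (amp f v))\<^sup>2 \<le> (K * norm v)\<^sup>2" by (simp add: power_mult_distrib)
  then show ?thesis using assms(2) by (simp add: power2_le_iff_abs_le)
qed

lemma bounded_clinear_amp:
  assumes "bounded_clinear f"
  shows "bounded_clinear (amp f)"
proof -
  obtain K where K: "0 < K" "\<And>x. norm (f x) \<le> K * norm x"
    using bounded_clinear_bound[OF assms] by blast
  show ?thesis
  proof (rule bounded_clinearI)
    show "clinear (amp f)"
      by (rule clinearI; rule ell2_eqI;
          simp add: coord_amp[OF assms] clinear_simps[OF bounded_clinear_clinear[OF assms]])
    show "norm (amp f x) \<le> K * norm x" for x
      by (rule norm_amp_le[OF assms less_imp_le[OF K(1)] K(2)])
  qed
qed

lemma amp_single: "bounded_clinear f \<Longrightarrow> amp f (ell2_single i v) = ell2_single i (f v)"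
  by (rule ell2_eqI) (simp add: coord_amp coord_single clinear_zero bounded_clinear_clinear)

lemma amp_comp: "bounded_clinear f \<Longrightarrow> bounded_clinear g \<Longrightarrow> amp (f \<circ> g) v = amp f (amp g v)"
  by (rule ell2_eqI) (simp add: coord_amp bounded_clinear_comp)

lemma amp_id [simp]: "amp id v = v" "amp (\<lambda>x. x) v = v"
  by (rule ell2_eqI; simp add: coord_amp)+

lemma amp_plus:
  "bounded_clinear f \<Longrightarrow> bounded_clinear g \<Longrightarrow> amp (\<lambda>v. f v + g v) w = amp f w + amp g w"
  by (rule ell2_eqI) (simp add: coord_amp bounded_clinear_plus)

lemma amp_minus:
  "bounded_clinear f \<Longrightarrow> bounded_clinear g \<Longrightarrow> amp (\<lambda>v. f v - g v) w = amp f w - amp g w"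
  by (rule ell2_eqI) (simp add: coord_amp bounded_clinear_minus)

lemma amp_scaleC: "bounded_clinear f \<Longrightarrow> amp (\<lambda>v. c *\<^sub>C f v) w = c *\<^sub>C amp f w"
  by (rule ell2_eqI) (simp add: coord_amp bounded_clinear_scaleC)

lemma amp_zero [simp]: "amp (\<lambda>_. 0) w = 0"
  by (rule ell2_eqI) (simp add: coord_amp)

lemma cinner_amp_sums:
  "bounded_clinear f \<Longrightarrow> (\<lambda>n. cinner (f (coord v n)) (coord w n)) sums cinner (amp f v) w"
  using cinner_ell2_sums[of "amp f v" w] by (simp add: coord_amp)

lemma cadj_amp:
  assumes "bounded_clinear f"
  shows "cadj (amp f) = amp (cadj f)"
proof (rule cadj_unique)
  fix v w
  show "cinner (amp f v) w = cinner v (amp (cadj f) w)"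
    unfolding cinner_ell2_def
    by (simp add: coord_amp[OF assms] coord_amp[OF bounded_clinear_cadj[OF assms]] cadj_right[OF assms])
qed

lemma amp_bounded_ops: "x \<in> bounded_ops \<Longrightarrow> amp x \<in> bounded_ops"
  by (simp add: bounded_ops_iff bounded_clinear_amp)

lemma adj_amp: "x \<in> bounded_ops \<Longrightarrow> adj (amp x) = amp (adj x)"
  by (simp add: bounded_ops_iff adj_eq_cadj cadj_amp)

lemma amp_op_comp: "x \<in> bounded_ops \<Longrightarrow> y \<in> bounded_ops \<Longrightarrow> amp (x \<circ> y) v = amp x (amp y v)"
  and amp_op_plus: "x \<in> bounded_ops \<Longrightarrow> y \<in> bounded_ops \<Longrightarrow> amp (\<lambda>v. x v + y v) w = amp x w + amp y w"
  and amp_op_minus: "x \<in> bounded_ops \<Longrightarrow> y \<in> bounded_ops \<Longrightarrow> amp (\<lambda>v. x v - y v) w = amp x w - amp y w"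
  and amp_op_scaleC: "x \<in> bounded_ops \<Longrightarrow> amp (\<lambda>v. c *\<^sub>C x v) w = c *\<^sub>C amp x w"
  and coord_amp_op: "x \<in> bounded_ops \<Longrightarrow> coord (amp x v) n = x (coord v n)"
  by (simp_all add: bounded_ops_iff amp_comp amp_plus amp_minus amp_scaleC coord_amp)

lemma star_algebra_amp:
  assumes "star_algebra S"
  shows "star_algebra (amp ` S)"
proof -
  note S = star_algebraD[OF assms]
  have "amp x \<circ> amp y = amp (x \<circ> y)" "(\<lambda>v. amp x v + amp y v) = amp (\<lambda>v. x v + y v)"
    if "x \<in> S" "y \<in> S" for x y
    using that S by (auto simp: fun_eq_iff amp_op_comp amp_op_plus)
  moreover have "(\<lambda>v. c *\<^sub>C amp x v) = amp (\<lambda>v. c *\<^sub>C x v)" if "x \<in> S" for x c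
    using that S by (auto simp: fun_eq_iff amp_op_scaleC)
  moreover have "id = amp (id :: 'a \<Rightarrow> 'a)" by (simp add: fun_eq_iff)
  ultimately show ?thesis
    unfolding star_algebra_def using S by (auto simp: amp_bounded_ops adj_amp intro!: imageI)
qed

text \<open>An operator commuting with all amplified elements of \<open>S\<close> is a matrix whose
  entries lie in the commutant of \<open>S\<close>, and \<open>x\<close> commutes with each
  entry.\<close>

lemma amp_bicommutant:
  assumes S: "S \<subseteq> bounded_ops" and x: "x \<in> commutant (commutant S)"
  shows "amp x \<in> commutant (commutant (amp ` S))"
proof (rule commutantI)
  have xb: "x \<in> bounded_ops" using x commutant_bounded by blast
  then show "amp x \<in> bounded_ops" by (rule amp_bounded_ops)
  fix T v assume T: "T \<in> commutant (amp ` S)"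
  have Tb: "T \<in> bounded_ops" using T commutant_bounded by blast
  have entry: "(\<lambda>v. coord (T (ell2_single j v)) i) \<in> commutant S" for i j
  proof (rule commutantI)
    have "bounded_clinear ((\<lambda>v. coord v i) \<circ> (T \<circ> ell2_single j))"
      using Tb by (intro bounded_clinear_comp bounded_clinear_coord bounded_clinear_single) (simp add: bounded_ops_iff)
    then show "(\<lambda>v. coord (T (ell2_single j v)) i) \<in> bounded_ops" by (simp add: bounded_ops_iff comp_def)
    fix s v assume s: "s \<in> S"
    then have sb: "s \<in> bounded_ops" using S by blast
    have "T (ell2_single j (s v)) = amp s (T (ell2_single j v))"
      using commutantD[OF T imageI[OF s], of "ell2_single j v"] sb
      by (simp add: amp_single bounded_ops_iff)
    then show "coord (T (ell2_single j (s v))) i = s (coord (T (ell2_single j v)) i)"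
      by (simp add: coord_amp_op[OF sb])
  qed
  have "amp x \<circ> T = T \<circ> amp x"
  proof (rule bounded_clinear_eq_single)
    show "bounded_clinear (amp x \<circ> T)" "bounded_clinear (T \<circ> amp x)"
      using Tb amp_bounded_ops[OF xb] by (auto simp: bounded_ops_iff intro: bounded_clinear_comp)
    show "(amp x \<circ> T) (ell2_single j v) = (T \<circ> amp x) (ell2_single j v)" for j v
      using commutantD[OF x entry, of j v] xb
      by (intro ell2_eqI) (simp add: coord_amp_op[OF xb] amp_single bounded_ops_iff)
  qed
  then show "amp x (T v) = T (amp x v)" by (simp add: fun_eq_iff)
qed

text \<open>The matrix units commute with every amplified operator. An element \<open>T\<close> of
  the bicommutant therefore commutes with them, so it is diagonal with one repeated entry
  \<open>t\<close>, and \<open>t\<close> lies in the bicommutant of \<open>N\<close>.\<close>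

lemma vna_amp:
  assumes N: "von_neumann_algebra N"
  shows "von_neumann_algebra (amp ` N)"
proof -
  note sN = star_algebraD[OF vna_star_algebra[OF N]]
  have sub: "amp ` N \<subseteq> bounded_ops" using sN(3) by (auto intro: amp_bounded_ops)
  have "T \<in> amp ` N" if T: "T \<in> commutant (commutant (amp ` N))" for T
  proof -
    have Tb: "bounded_clinear T" using T commutant_bounded bounded_ops_iff by blast
    define t where "t v = coord (T (ell2_single 0 v)) 0" for v
    have tb: "bounded_clinear t"
      using bounded_clinear_comp[OF bounded_clinear_coord[of 0] bounded_clinear_comp[OF Tb bounded_clinear_single[of 0]]]
      by (simp add: t_def[abs_def] comp_def)
    have unit: "(\<lambda>v. ell2_single i (coord v j)) \<in> commutant (amp ` N)" for i j
    proof (rule commutantI)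
      show "(\<lambda>v. ell2_single i (coord v j)) \<in> bounded_ops"
        using bounded_clinear_comp[OF bounded_clinear_single[of i] bounded_clinear_coord[of j]]
        by (simp add: bounded_ops_iff comp_def)
      show "ell2_single i (coord (X v) j) = X (ell2_single i (coord v j))" if "X \<in> amp ` N" for X v
        using that sN by (auto simp: coord_amp_op amp_single bounded_ops_iff[symmetric])
    qed
    have Tunit: "T (ell2_single i (coord v j)) = ell2_single i (coord (T v) j)" for i j v
      using commutantD[OF T unit] by simp
    have Tj: "T (ell2_single j v) = ell2_single j (t v)" for j v
      using Tunit[of j "ell2_single 0 v" 0] by (simp add: coord_single t_def)
    have "T = amp t"
      by (rule bounded_clinear_eq_single[OF Tb bounded_clinear_amp[OF tb]]) (simp add: amp_single[OF tb] Tj)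
    moreover have "t \<in> commutant (commutant N)"
    proof (rule commutantI)
      fix X v assume X: "X \<in> commutant N"
      then have Xb: "X \<in> bounded_ops" using commutant_bounded by blast
      have "amp X \<in> commutant (amp ` N)"
      proof (rule commutantI)
        fix Y v assume "Y \<in> amp ` N"
        then obtain y where y: "y \<in> N" "Y = amp y" by blast
        show "amp X (Y v) = Y (amp X v)"
          by (rule ell2_eqI)
            (simp add: y(2) coord_amp_op[OF Xb] coord_amp_op[OF sN(3)[OF y(1)]] commutantD[OF X y(1)])
      qed (rule amp_bounded_ops[OF Xb])
      then have "T (amp X (ell2_single 0 v)) = amp X (T (ell2_single 0 v))" by (rule commutantD[OF T])
      then have "coord (T (ell2_single 0 (X v))) 0 = coord (amp X (T (ell2_single 0 v))) 0"
        using Xb by (simp add: amp_single bounded_ops_iff)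
      then show "t (X v) = X (t v)" by (simp add: t_def coord_amp_op[OF Xb])
    qed (use tb in \<open>simp add: bounded_ops_iff\<close>)
    ultimately show ?thesis using vna_bicommutant_eq[OF N] by simp
  qed
  moreover have "adj x \<in> amp ` N" if "x \<in> amp ` N" for x
    using that sN by (auto simp: adj_amp)
  ultimately show ?thesis
    unfolding von_neumann_algebra_def using sub bicommutant_extensive[OF sub] by blast
qed

section \<open>Passing from a star algebra to its bicommutant under normal functionals\<close>

lemma bicommutant_weak:
  assumes S: "star_algebra S" and x: "x \<in> commutant (commutant S)"
    and "\<And>s. s \<in> S \<Longrightarrow> cinner (s v) w = 0"
  shows "cinner (x v) w = 0"
proof -
  have "cinner w (x v) = 0"
  proof (rule cinner_zero_closure[OF _ bicommutant_orbit[OF S x]])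
    show "cinner w s = 0" if "s \<in> (\<lambda>s. s v) ` S" for s
      using that assms(3) cinner_commute[of w] by auto
  qed
  then show ?thesis using cinner_commute[of "x v" w] by simp
qed

text \<open>The difference of the two functionals is a single vector functional after a second
  amplification: the pairs occupy coordinates 0 and 1, with a sign on the second. This reduces
  identities between normal functionals to the spanning algebra.\<close>

lemma bicommutant_ultraweak:
  assumes S: "star_algebra S" and x: "x \<in> commutant (commutant S)"
    and eq: "\<And>s. s \<in> S \<Longrightarrow> cinner (amp s v1) w1 = cinner (amp s v2) w2"
  shows "cinner (amp x v1) w1 = cinner (amp x v2) w2"
proof -
  let ?v = "ell2_single 0 v1 + ell2_single 1 v2" and ?w = "ell2_single 0 w1 - ell2_single 1 w2"
  have pair: "cinner (amp (amp s) ?v) ?w = cinner (amp s v1) w1 - cinner (amp s v2) w2"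
    if "s \<in> bounded_ops" for s
    using amp_bounded_ops[OF that] amp_bounded_ops[OF amp_bounded_ops[OF that]]
    by (simp add: ops_simps amp_single bounded_ops_iff cinner_simps cinner_single_right coord_single)
  have xb: "x \<in> bounded_ops" using x commutant_bounded by blast
  have "cinner (amp (amp x) ?v) ?w = 0"
  proof (rule bicommutant_weak[where S = "amp ` amp ` S" and x = "amp (amp x)" and v = ?v and w = ?w])
    show "star_algebra (amp ` (amp ` S))" by (intro star_algebra_amp S)
    show "amp (amp x) \<in> commutant (commutant (amp ` amp ` S))"
      using star_algebraD(1)[OF S] star_algebraD(1)[OF star_algebra_amp[OF S]] x
      by (intro amp_bicommutant)
    show "cinner (s ?v) ?w = 0" if "s \<in> amp ` amp ` S" for s
      using that eq pair star_algebraD(3)[OF S] by auto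
  qed
  then show ?thesis using pair[OF xb] by simp
qed

lemma bicommutant_ultraweak_orbit:
  assumes S: "star_algebra S" and x: "x \<in> commutant (commutant S)"
  shows "amp x v \<in> closure ((\<lambda>s. amp s v) ` S)"
  using bicommutant_orbit[OF star_algebra_amp[OF S] amp_bicommutant[OF star_algebraD(1)[OF S] x], of v]
  by (simp add: image_image)

lemma ultraweak_functional_iff:
  assumes "M \<subseteq> bounded_ops"
  shows "ultraweak_functional M \<phi> \<longleftrightarrow> (\<exists>v w. \<forall>x\<in>M. \<phi> x = cinner (amp x v) w)"
proof
  assume "ultraweak_functional M \<phi>"
  then obtain \<xi> \<eta> where *: "summable (\<lambda>n. (norm (\<xi> n))\<^sup>2)" "summable (\<lambda>n. (norm (\<eta> n))\<^sup>2)"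
    "\<forall>x\<in>M. \<phi> x = (\<Sum>n. cinner (x (\<xi> n)) (\<eta> n))" unfolding ultraweak_functional_def by blast
  have "\<phi> x = cinner (amp x (Abs_ell2 \<xi>)) (Abs_ell2 \<eta>)" if "x \<in> M" for x
    using that assms * by (auto simp: cinner_ell2_def coord_amp_op coord_Abs)
  then show "\<exists>v w. \<forall>x\<in>M. \<phi> x = cinner (amp x v) w" by blast
next
  assume "\<exists>v w. \<forall>x\<in>M. \<phi> x = cinner (amp x v) w"
  then obtain v w where *: "\<forall>x\<in>M. \<phi> x = cinner (amp x v) w" by blast
  have "\<phi> x = (\<Sum>n. cinner (x (coord v n)) (coord w n))" if "x \<in> M" for x
    using that assms * by (auto simp: cinner_ell2_def coord_amp_op)
  then show "ultraweak_functional M \<phi>"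
    unfolding ultraweak_functional_def using summable_coord by blast
qed

subsection \<open>Double sequences\<close>

text \<open>The identification of \<open>\<ell>\<^sup>2(\<nat>) \<otimes> \<ell>\<^sup>2(\<nat>)
  \<otimes> H\<close> with \<open>\<ell>\<^sup>2(\<nat>) \<otimes> H\<close> along the pairing
  function; it returns doubly amplified vectors to the single amplification.\<close>

definition flatten :: "'h::chilbert_space ell2 ell2 \<Rightarrow> 'h ell2" where
  "flatten v = Abs_ell2 (\<lambda>m. coord (coord v (fst (prod_decode m))) (snd (prod_decode m)))"

lemma flatten_sums:
  "(\<lambda>m. (norm (coord (coord v (fst (prod_decode m))) (snd (prod_decode m))))\<^sup>2) sums (norm v)\<^sup>2"
proof -
  define f where "f = (\<lambda>(k, n). (norm (coord (coord v k) n))\<^sup>2)"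
  have inner: "((\<lambda>n. f (k, n)) has_sum (norm (coord v k))\<^sup>2) UNIV" for k
    unfolding f_def prod.case by (intro sums_nonneg_imp_has_sum norm_ell2_sums) simp
  have outer: "((\<lambda>k. (norm (coord v k))\<^sup>2) has_sum (norm v)\<^sup>2) UNIV"
    by (intro sums_nonneg_imp_has_sum norm_ell2_sums) simp
  have "(f has_sum (norm v)\<^sup>2) (Sigma UNIV (\<lambda>_. UNIV))"
  proof (rule has_sum_SigmaI[OF inner outer])
    show "f summable_on Sigma UNIV (\<lambda>_. UNIV)"
      by (rule summable_on_SigmaI[OF inner has_sum_imp_summable[OF outer]]) (simp add: f_def)
  qed
  then have "(f has_sum (norm v)\<^sup>2) UNIV" by simp
  then have "((\<lambda>m. f (prod_decode m)) has_sum (norm v)\<^sup>2) UNIV"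
    by (subst has_sum_reindex_bij_betw[OF bij_prod_decode])
  then show ?thesis by (auto dest!: has_sum_imp_sums simp: f_def case_prod_beta)
qed

lemma coord_flatten: "coord (flatten v) m = coord (coord v (fst (prod_decode m))) (snd (prod_decode m))"
  unfolding flatten_def by (subst coord_Abs[OF sums_summable[OF flatten_sums]]) simp

lemma norm_flatten: "norm (flatten v) = norm v"
proof -
  have "(norm (flatten v))\<^sup>2 = (norm v)\<^sup>2"
    using sums_unique2[OF norm_ell2_sums[of "flatten v"]] flatten_sums[of v] by (simp add: coord_flatten)
  then show ?thesis by (simp add: power2_eq_iff_nonneg)
qed

lemma bounded_clinear_flatten: "bounded_clinear flatten"
  by (rule bounded_clinearI[where K = 1]) (auto intro!: clinearI ell2_eqI simp: coord_flatten norm_flatten)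

text \<open>Polarisation gives the real parts; multiplying \<open>v\<close> by the imaginary unit
  gives the imaginary parts.\<close>

lemma isometry_cinner:
  assumes f: "clinear f" and n: "\<And>v. norm (f v) = norm v"
  shows "cinner (f v) (f w) = cinner v w"
proof -
  have Re_eq: "Re (cinner (f v) (f w)) = Re (cinner v w)" for v w
  proof -
    have "4 * inner (f v) (f w) = (norm (f (v + w)))\<^sup>2 - (norm (f (v - w)))\<^sup>2"
      unfolding clinear_simps[OF f] power2_norm_eq_inner by (simp add: algebra_simps inner_commute)
    also have "\<dots> = 4 * inner v w"
      unfolding n power2_norm_eq_inner by (simp add: algebra_simps inner_commute)
    finally show ?thesis by (simp add: inner_eq_Re_cinner)
  qed
  show ?thesis
  proof (rule complex_eqI[OF Re_eq])
    show "Im (cinner (f v) (f w)) = Im (cinner v w)"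
      using Re_eq[of "\<i> *\<^sub>C v" w] by (simp add: clinear_simps[OF f] cinner_simps)
  qed
qed

lemma cinner_flatten: "cinner (flatten v) (flatten w) = cinner v w"
  by (intro isometry_cinner norm_flatten bounded_clinear_clinear bounded_clinear_flatten)

lemma amp_flatten: "bounded_clinear x \<Longrightarrow> amp x (flatten v) = flatten (amp (amp x) v)"
  by (rule ell2_eqI) (simp add: coord_amp coord_flatten bounded_clinear_amp)

section \<open>Normal traces as vector states\<close>

lemma bounded_clinear_cinner: "bounded_clinear (\<lambda>v::'h::chilbert_space. cinner v w)"
  by (rule bounded_clinearI[where K = "norm w"])
    (auto intro!: clinearI simp: cinner_simps scaleC_complex_def norm_cinner_le mult.commute[of "norm w"])

text \<open>Normality only gives two different vectors,
  \<open>\<tau> x = cinner (amp x \<xi>) \<eta>\<close>. The form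
  \<open>\<tau> (adj y \<circ> x)\<close> is dominated by the orbit of
  \<open>\<zeta> = \<xi> + \<eta>\<close>, hence is represented there by a positive operator
  \<open>D\<close> commuting with the amplified algebra. Writing \<open>D\<close> as a sum of
  squares and applying the terms to \<open>\<zeta>\<close> gives the coordinates of the required
  vector.\<close>

theorem trace_vector_exists:
  fixes A :: "('h::chilbert_space \<Rightarrow> 'h) set"
  assumes A: "tracial_von_neumann_algebra A \<tau>"
  obtains \<Omega> where "\<And>x. x \<in> A \<Longrightarrow> \<tau> x = cinner (amp x \<Omega>) \<Omega>"
proof -
  have vA: "von_neumann_algebra A" and tr: "faithful_normal_trace A \<tau>"
    using A by (auto simp: tracial_von_neumann_algebra_def)
  note sA = star_algebraD[OF vna_star_algebra[OF vA]]
  obtain \<xi> \<eta> where \<tau>: "\<And>x. x \<in> A \<Longrightarrow> \<tau> x = cinner (amp x \<xi>) \<eta>"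
    using tr ultraweak_functional_iff[OF sA(1)] unfolding faithful_normal_trace_def by blast
  have \<tau>_id: "\<tau> id = 1"
    and pos: "\<And>x. x \<in> A \<Longrightarrow> Im (\<tau> (adj x \<circ> x)) = 0 \<and> 0 \<le> Re (\<tau> (adj x \<circ> x))"
    and faithful: "\<And>x. x \<in> A \<Longrightarrow> \<tau> (adj x \<circ> x) = 0 \<Longrightarrow> x = (\<lambda>_. 0)"
    using tr complex_is_Real_iff by (auto simp: faithful_normal_trace_def)
  have form: "\<tau> (adj y \<circ> x) = cinner (amp x \<xi>) (amp y \<eta>)" if "x \<in> A" "y \<in> A" for x y
  proof -
    have b: "x \<in> bounded_ops" "y \<in> bounded_ops" using that sA(3) by auto
    have "\<tau> (adj y \<circ> x) = cinner (amp (adj y \<circ> x) \<xi>) \<eta>" by (rule \<tau>[OF sA(4)[OF sA(7)[OF that(2)] that(1)]])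
    also have "\<dots> = cinner (adj (amp y) (amp x \<xi>)) \<eta>"
      using amp_op_comp[OF adj_bounded[OF b(2)] b(1)] adj_amp[OF b(2)] by simp
    finally show ?thesis by (simp add: adj_left[OF amp_bounded_ops[OF b(2)]])
  qed
  have expand: "\<tau> (adj z \<circ> z) = \<tau> (adj x \<circ> x) + cnj c * \<tau> (adj y \<circ> x) + c * \<tau> (adj x \<circ> y)
      + c * cnj c * \<tau> (adj y \<circ> y)"
    and z_in: "z \<in> A"
    if xy: "x \<in> A" "y \<in> A" and z: "z = (\<lambda>v. x v + c *\<^sub>C y v)" for x y c z
  proof -
    have b: "x \<in> bounded_ops" "y \<in> bounded_ops" using xy sA(3) by auto
    show zA: "z \<in> A" unfolding z by (intro sA(5,6) xy)
    have amp_z: "amp z w = amp x w + c *\<^sub>C amp y w" for w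
      unfolding z using amp_op_plus[OF b(1) bounded_ops_simps(5)[OF b(2)]] amp_op_scaleC[OF b(2)] by simp
    show "\<tau> (adj z \<circ> z) = \<tau> (adj x \<circ> x) + cnj c * \<tau> (adj y \<circ> x) + c * \<tau> (adj x \<circ> y)
      + c * cnj c * \<tau> (adj y \<circ> y)"
      by (simp add: form xy zA amp_z cinner_simps algebra_simps)
  qed
  \<comment> \<open>Positivity on \<open>x + c y\<close> makes the cross terms real for every
    \<open>c\<close>; \<open>c = 1\<close> and \<open>c = \<i>\<close> determine both parts.\<close>
  have herm: "\<tau> (adj x \<circ> y) = cnj (\<tau> (adj y \<circ> x))" if "x \<in> A" "y \<in> A" for x y
  proof (rule complex_eqI)
    have "Im (cnj c * \<tau> (adj y \<circ> x) + c * \<tau> (adj x \<circ> y)) = 0" for c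
      using pos[OF z_in[OF that refl, of c]] pos[OF that(1)] pos[OF that(2)]
      unfolding expand[OF that refl] by simp
    from this[of 1] this[of \<i>]
    show "Im (\<tau> (adj x \<circ> y)) = Im (cnj (\<tau> (adj y \<circ> x)))" "Re (\<tau> (adj x \<circ> y)) = Re (cnj (\<tau> (adj y \<circ> x)))"
      by simp_all
  qed
  define n2 where "n2 x = Re (\<tau> (adj x \<circ> x))" for x
  have n2: "0 \<le> n2 x" "\<tau> (adj x \<circ> x) = complex_of_real (n2 x)" if "x \<in> A" for x
    using pos[OF that] by (auto simp: n2_def complex_eq_iff)
  have CS: "(cmod (\<tau> (adj y \<circ> x)))\<^sup>2 \<le> n2 x * n2 y" if xy: "x \<in> A" "y \<in> A" for x y
  proof (cases "n2 y = 0")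
    case True
    then have "y = (\<lambda>_. 0)" using faithful[OF xy(2)] n2(2)[OF xy(2)] by simp
    then have "amp y \<eta> = 0" by simp
    then show ?thesis unfolding form[OF xy] using True by simp
  next
    case False
    then have b: "0 < n2 y" using n2(1)[OF xy(2)] by simp
    \<comment> \<open>The coefficient minimising the form on \<open>x + c y\<close>, as in the usual
      proof of the Cauchy-Schwarz inequality.\<close>
    define c where "c = - (\<tau> (adj y \<circ> x) / complex_of_real (n2 y))"
    define z where "z = (\<lambda>v. x v + c *\<^sub>C y v)"
    have s: "\<tau> (adj y \<circ> x) * cnj (\<tau> (adj y \<circ> x)) = complex_of_real ((cmod (\<tau> (adj y \<circ> x)))\<^sup>2)"
      using complex_norm_square[of "\<tau> (adj y \<circ> x)"] by simp
    have "complex_of_real (n2 z) = complex_of_real (n2 x) + cnj c * \<tau> (adj y \<circ> x) + c * cnj (\<tau> (adj y \<circ> x))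
      + c * cnj c * complex_of_real (n2 y)"
      using expand[OF xy z_def] n2(2)[OF z_in[OF xy z_def]] n2(2)[OF xy(1)] n2(2)[OF xy(2)] herm[OF xy]
      by simp
    also have "\<dots> = complex_of_real (n2 x) - (\<tau> (adj y \<circ> x) * cnj (\<tau> (adj y \<circ> x))) / complex_of_real (n2 y)"
      using b unfolding c_def by (simp add: field_simps)
    also have "\<dots> = complex_of_real (n2 x - (cmod (\<tau> (adj y \<circ> x)))\<^sup>2 / n2 y)"
      unfolding s by simp
    finally have "n2 z = n2 x - (cmod (\<tau> (adj y \<circ> x)))\<^sup>2 / n2 y" using of_real_eq_iff by blast
    then have "(cmod (\<tau> (adj y \<circ> x)))\<^sup>2 / n2 y \<le> n2 x" using n2(1)[OF z_in[OF xy z_def]] by simp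
    then show ?thesis using b by (simp add: field_simps)
  qed
  define \<zeta> where "\<zeta> = \<xi> + \<eta>"
  have amp_add: "amp x (v + w) = amp x v + amp x w" if "x \<in> A" for x v w
    using amp_bounded_ops[OF sA(3)[OF that]] by (simp add: ops_simps)
  \<comment> \<open>Polarisation: four times the real inner product of \<open>amp x \<xi>\<close>
    and \<open>amp x \<eta>\<close> is the squared norm at \<open>\<xi> + \<eta>\<close> minus that
    at \<open>\<xi> - \<eta>\<close>, and the latter is dropped.\<close>
  have quarter: "n2 x \<le> (norm (amp x \<zeta>) / 2)\<^sup>2" if x: "x \<in> A" for x
  proof -
    have "n2 x = inner (amp x \<xi>) (amp x \<eta>)"
      using form[OF x x] by (simp add: n2_def inner_eq_Re_cinner)
    moreover have "(norm (amp x \<zeta>))\<^sup>2 = (norm (amp x \<xi> - amp x \<eta>))\<^sup>2 + 4 * inner (amp x \<xi>) (amp x \<eta>)"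
      unfolding \<zeta>_def amp_add[OF x] power2_norm_eq_inner by (simp add: algebra_simps inner_commute)
    moreover have "0 \<le> (norm (amp x \<xi> - amp x \<eta>))\<^sup>2" by simp
    ultimately show ?thesis by (simp add: power_divide)
  qed
  have \<tau>_bound: "cmod (\<tau> (adj y \<circ> x)) \<le> (norm (amp x \<zeta>) / 2) * (norm (amp y \<zeta>) / 2)"
    if "x \<in> A" "y \<in> A" for x y
  proof -
    have "n2 x * n2 y \<le> (norm (amp x \<zeta>) / 2)\<^sup>2 * (norm (amp y \<zeta>) / 2)\<^sup>2"
      using that by (intro mult_mono quarter n2) auto
    then have "(cmod (\<tau> (adj y \<circ> x)))\<^sup>2 \<le> ((norm (amp x \<zeta>) / 2) * (norm (amp y \<zeta>) / 2))\<^sup>2"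
      using CS[OF that] unfolding power_mult_distrib by (rule order_trans[rotated])
    then show ?thesis by (rule power2_le_imp_le) simp
  qed
  have sampA: "star_algebra (amp ` A)" by (rule star_algebra_amp[OF vna_star_algebra[OF vA]])
  define S where "S = (\<lambda>x. amp x \<zeta>) ` A"
  have S_orbit: "(\<lambda>s. s \<zeta>) ` (amp ` A) = S" by (simp add: S_def image_image)
  obtain e where "orbit_projection (amp ` A) \<zeta> e" by (rule orbit_projection_exists[OF sampA])
  note e = orbit_projectionD[OF this, unfolded S_orbit]
  have e_perp: "cinner (v - e v) s = 0" if "s \<in> closure S" for v s
    using e(5)[of v s] e(3)[OF that] by (simp add: cinner_simps)
  obtain \<Phi> where \<Phi>: "bounded_clinear \<Phi>" and \<Phi>_amp: "\<And>x. x \<in> A \<Longrightarrow> \<Phi> (amp x \<zeta>) = \<tau> x"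
    and \<Phi>_perp: "\<And>v. (\<And>x. x \<in> A \<Longrightarrow> cinner v (amp x \<zeta>) = 0) \<Longrightarrow> \<Phi> v = 0"
  proof (rule extend_from_algebra[OF vna_star_algebra[OF vA], of "\<lambda>x. amp x \<zeta>" \<tau> "norm \<zeta> / 4"])
    show "norm (\<tau> x) \<le> norm \<zeta> / 4 * norm (amp x \<zeta>)" if "x \<in> A" for x
      using \<tau>_bound[OF that sA(2)] by (simp add: mult.commute)
  qed (use that in \<open>auto simp: \<tau> sA(3,5,6) amp_op_plus amp_op_scaleC cinner_simps scaleC_complex_def\<close>)
  define \<Omega>0 where "\<Omega>0 = cadj \<Phi> 1"
  have \<Omega>0: "cinner v \<Omega>0 = \<Phi> v" for v
    using cadj_right[OF \<Phi>, of v 1] by (simp add: \<Omega>0_def cinner_complex_def)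
  \<comment> \<open>\<open>\<Phi>\<close> vanishes on the complement of the orbit, so its
    representing vector lies in the closed orbit. The norm of \<open>amp x \<Omega>0\<close> can
    then be tested against orbit vectors, where \<open>cross\<close> computes the inner
    products.\<close>
  have \<Omega>0_closure: "\<Omega>0 \<in> closure S"
  proof -
    have "cinner (\<Omega>0 - e \<Omega>0) \<Omega>0 = 0"
      unfolding \<Omega>0 by (rule \<Phi>_perp) (auto simp: S_def intro!: e_perp closure_subset[THEN subsetD])
    moreover have "cinner (\<Omega>0 - e \<Omega>0) (e \<Omega>0) = 0" by (rule e_perp[OF e(2)])
    ultimately have "cinner (\<Omega>0 - e \<Omega>0) (\<Omega>0 - e \<Omega>0) = 0" by (simp add: cinner_simps)
    then have "\<Omega>0 = e \<Omega>0" by simp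
    then show ?thesis using e(2)[of \<Omega>0] by simp
  qed
  have cross: "cinner (amp y \<zeta>) (amp x \<Omega>0) = \<tau> (adj x \<circ> y)" if "x \<in> A" "y \<in> A" for x y
  proof -
    have b: "x \<in> bounded_ops" "y \<in> bounded_ops" using that sA(3) by auto
    have "cinner (amp y \<zeta>) (amp x \<Omega>0) = cinner (adj (amp x) (amp y \<zeta>)) \<Omega>0"
      by (simp add: adj_left[OF amp_bounded_ops[OF b(1)]])
    also have "\<dots> = cinner (amp (adj x \<circ> y) \<zeta>) \<Omega>0"
      using amp_op_comp[OF adj_bounded[OF b(1)] b(2)] adj_amp[OF b(1)] by simp
    finally show ?thesis unfolding \<Omega>0 using \<Phi>_amp that sA by simp
  qed
  have inv: "amp x v \<in> closure S" if "x \<in> A" "v \<in> closure S" for x v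
  proof (rule bounded_clinear_closure[OF _ _ that(2)])
    show "bounded_clinear (amp x)" using sA(3)[OF that(1)] by (simp add: bounded_ops_iff bounded_clinear_amp)
    show "amp x s \<in> S" if "s \<in> S" for s
      using orbit_mult[OF sampA imageI[OF \<open>x \<in> A\<close>], of s \<zeta>] that unfolding S_orbit by simp
  qed
  \<comment> \<open>On orbit vectors \<open>cinner (D (amp x \<zeta>)) (amp y \<zeta>)\<close> is
    \<open>\<tau> (adj y \<circ> x)\<close>. The constant 1/4 is the product of the two halves in
    \<open>\<tau>_bound\<close>.\<close>
  obtain D where D: "bounded_clinear D" and D_amp: "\<And>x. x \<in> A \<Longrightarrow> D (amp x \<zeta>) = amp x \<Omega>0"
    and D_perp: "\<And>v. (\<And>x. x \<in> A \<Longrightarrow> cinner v (amp x \<zeta>) = 0) \<Longrightarrow> D v = 0"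
    and D_norm: "\<And>v. norm (D v) \<le> 1/4 * norm v"
  proof (rule extend_from_algebra[OF vna_star_algebra[OF vA], of "\<lambda>x. amp x \<zeta>" "\<lambda>x. amp x \<Omega>0" "1/4"])
    show "norm (amp x \<Omega>0) \<le> 1/4 * norm (amp x \<zeta>)" if x: "x \<in> A" for x
    proof (rule norm_le_by_cinner_closure[OF inv[OF x \<Omega>0_closure]])
      fix s assume "s \<in> S"
      then obtain y where y: "y \<in> A" "s = amp y \<zeta>" unfolding S_def by blast
      show "cmod (cinner s (amp x \<Omega>0)) \<le> 1/4 * norm (amp x \<zeta>) * norm s"
        using \<tau>_bound[OF y(1) x] unfolding y(2) cross[OF x y(1)] by (simp add: mult_ac)
    qed simp
  qed (use that in \<open>auto simp: sA(3) amp_op_plus amp_op_scaleC\<close>)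
  have D_e: "D v = D (e v)" for v
  proof -
    have "D (v - e v) = 0"
      by (rule D_perp) (auto simp: S_def intro!: e_perp closure_subset[THEN subsetD])
    then show ?thesis by (simp add: clinear_simps[OF bounded_clinear_clinear[OF D]])
  qed
  have D_closure: "D v \<in> closure S" for v
  proof -
    have "D s \<in> closure S" if s: "s \<in> S" for s
    proof -
      obtain x where x: "x \<in> A" "s = amp x \<zeta>" using s unfolding S_def by blast
      show ?thesis unfolding x(2) D_amp[OF x(1)] by (rule inv[OF x(1) \<Omega>0_closure])
    qed
    then have "D (e v) \<in> closure (closure S)"
      by (rule bounded_clinear_closure[OF D _ e(2)])
    then show ?thesis using D_e[of v] by simp
  qed
  have D_comm: "D (amp x v) = amp x (D v)" if x: "x \<in> A" for x v
  proof -
    have xb: "bounded_clinear (amp x)" using sA(3)[OF x] by (simp add: bounded_ops_iff bounded_clinear_amp)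
    have "(D \<circ> amp x) (e v) = (amp x \<circ> D) (e v)"
    proof (rule bounded_clinear_eq_on_closure[where f = "D \<circ> amp x" and g = "amp x \<circ> D", OF _ _ _ e(2)])
      show "bounded_clinear (D \<circ> amp x)" "bounded_clinear (amp x \<circ> D)"
        using D xb by (auto intro: bounded_clinear_comp)
      fix s assume "s \<in> S"
      then obtain y where y: "y \<in> A" "s = amp y \<zeta>" unfolding S_def by blast
      have "amp x s = amp (x \<circ> y) \<zeta>" using y sA(3) x by (simp add: amp_op_comp)
      then show "(D \<circ> amp x) s = (amp x \<circ> D) s"
        using D_amp[OF sA(4)[OF x y(1)]] D_amp[OF y(1)] y sA(3) x by (simp add: amp_op_comp)
    qed
    moreover have "e (amp x v) = amp x (e v)" using commutantD[OF e(1) imageI[OF x]] .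
    ultimately show ?thesis using D_e[of "amp x v"] D_e[of v] by simp
  qed
  \<comment> \<open>Symmetry is visible on orbit vectors; it is extended to their closure in one
    argument at a time, and then to all vectors because \<open>D\<close> factors through
    \<open>e\<close> and has its values in the closure.\<close>
  have D_sym: "cinner (D v) w = cinner v (D w)" for v w
  proof -
    have 1: "cinner u (D s) = cinner (D u) s" if u: "u \<in> closure S" and s: "s \<in> S" for u s
    proof (rule bounded_clinear_eq_on_closure[where f = "\<lambda>u. cinner u (D s)" and g = "\<lambda>u. cinner (D u) s", OF _ _ _ u])
      show "bounded_clinear (\<lambda>u. cinner u (D s))" by (rule bounded_clinear_cinner)
      show "bounded_clinear (\<lambda>u. cinner (D u) s)"
        using bounded_clinear_comp[OF bounded_clinear_cinner D] by (simp add: comp_def)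
      fix r assume "r \<in> S"
      then obtain x y where xy: "x \<in> A" "y \<in> A" "r = amp x \<zeta>" "s = amp y \<zeta>" using s unfolding S_def by blast
      have "cinner (amp x \<Omega>0) (amp y \<zeta>) = cnj (\<tau> (adj x \<circ> y))"
        by (subst cinner_commute) (simp add: cross[OF xy(1,2)])
      then show "cinner r (D s) = cinner (D r) s"
        unfolding xy D_amp[OF xy(1)] D_amp[OF xy(2)] cross[OF xy(2,1)] using herm[OF xy(1,2)] by simp
    qed
    have 2: "cinner (D u) r = cinner u (D r)" if u: "u \<in> closure S" and r: "r \<in> closure S" for u r
    proof -
      have "cinner r (D u) = cinner (D r) u"
      proof (rule bounded_clinear_eq_on_closure[where f = "\<lambda>r. cinner r (D u)" and g = "\<lambda>r. cinner (D r) u", OF _ _ _ r])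
        show "bounded_clinear (\<lambda>r. cinner r (D u))" by (rule bounded_clinear_cinner)
        show "bounded_clinear (\<lambda>r. cinner (D r) u)"
          using bounded_clinear_comp[OF bounded_clinear_cinner D] by (simp add: comp_def)
        show "cinner s (D u) = cinner (D s) u" if "s \<in> S" for s
          using 1[OF u that] cinner_commute[of s "D u"] cinner_commute[of "D s" u] by simp
      qed
      then show ?thesis using cinner_commute[of "D u" r] cinner_commute[of u "D r"] by simp
    qed
    have "cinner (D v) w = cinner (D (e v)) (e w)"
      using e_perp[OF D_closure, of w "e v"] D_e[of v] cinner_commute[of "w - e w" "D (e v)"]
      by (simp add: cinner_simps)
    also have "\<dots> = cinner (e v) (D (e w))" by (rule 2[OF e(2) e(2)])
    also have "\<dots> = cinner v (D w)"
      using e_perp[OF D_closure, of v "e w"] D_e[of w] by (simp add: cinner_simps)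
    finally show ?thesis .
  qed
  have D_pos: "0 \<le> Re (cinner (D v) v)" for v
  proof -
    have cD: "continuous_on UNIV D"
      by (rule linear_continuous_on[OF bounded_clinear_bounded_linear[OF D]])
    have "closed {v. 0 \<le> Re (cinner (D v) v)}"
      by (intro closed_Collect_le continuous_intros cD)
    moreover have "0 \<le> Re (cinner (D s) s)" if s: "s \<in> S" for s
    proof -
      obtain x where x: "x \<in> A" "s = amp x \<zeta>" using s unfolding S_def by blast
      have "Re (cinner (D s) s) = Re (cinner s (D s))" by (subst cinner_commute) simp
      then show ?thesis unfolding x D_amp[OF x(1)] cross[OF x(1) x(1)] using pos[OF x(1)] by simp
    qed
    ultimately have "closure S \<subseteq> {v. 0 \<le> Re (cinner (D v) v)}" by (intro closure_minimal) auto
    then have "0 \<le> Re (cinner (D (e v)) (e v))" using e(2)[of v] by auto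
    also have "cinner (D (e v)) (e v) = cinner (D v) v"
      using e_perp[OF D_closure, of v "e v"] D_e[of v] cinner_commute[of "v - e v" "D (e v)"]
      by (simp add: cinner_simps)
    finally show ?thesis .
  qed
  have cpD: "contractive_positive D"
    unfolding contractive_positive_def
  proof (intro conjI allI)
    show "D \<in> bounded_ops" using D by (simp add: bounded_ops_iff)
    show "Re (cinner (D v) v) \<le> (norm v)\<^sup>2" for v
    proof -
      have "Re (cinner (D v) v) \<le> norm (D v) * norm v"
        using complex_Re_le_cmod norm_cinner_le order_trans by blast
      also have "\<dots> \<le> (1/4 * norm v) * norm v" by (intro mult_right_mono D_norm) simp
      also have "\<dots> \<le> norm v * norm v" by (intro mult_right_mono) auto
      finally show ?thesis by (simp add: power2_eq_square)
    qed
  qed (use D_sym D_pos in auto)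
  \<comment> \<open>Since the terms are symmetric, commute with \<open>amp x\<close> and have
    squares summing to \<open>D\<close>, the vector state of \<open>W\<close> at
    \<open>amp (amp x)\<close> is \<open>cinner (D (amp x \<zeta>)) \<zeta>\<close>.\<close>
  define W where "W = Abs_ell2 (\<lambda>k. square_terms D k \<zeta>)"
  have W: "coord W = (\<lambda>k. square_terms D k \<zeta>)"
    unfolding W_def by (rule coord_Abs[OF sums_summable[OF square_terms_sums_norm[OF cpD]]])
  show ?thesis
  proof (rule that[of "flatten W"])
    fix x assume x: "x \<in> A"
    have xb: "bounded_clinear x" "bounded_clinear (amp x)"
      using sA(3)[OF x] by (simp_all add: bounded_ops_iff bounded_clinear_amp)
    have "cinner (amp x (flatten W)) (flatten W) = cinner (amp (amp x) W) W"
      by (simp add: amp_flatten[OF xb(1)] cinner_flatten)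
    also have "\<dots> = cinner (D (amp x \<zeta>)) \<zeta>"
    proof (rule sums_unique2[OF cinner_amp_sums[OF xb(2)]])
      have "amp x (square_terms D k \<zeta>) = square_terms D k (amp x \<zeta>)" for k
        using square_terms_commute[of D "amp x" k \<zeta>] D_comm[OF x] bounded_clinear_clinear[OF xb(2)] by simp
      then show "(\<lambda>k. cinner (amp x (coord W k)) (coord W k)) sums cinner (D (amp x \<zeta>)) \<zeta>"
        using square_terms_sums[OF cpD, of "amp x \<zeta>" \<zeta>] by (simp add: W)
    qed
    also have "\<dots> = cnj (cinner (amp id \<zeta>) (amp x \<Omega>0))"
      by (subst cinner_commute) (simp add: D_amp[OF x])
    also have "\<dots> = cnj (\<tau> (adj x \<circ> id))" by (simp only: cross[OF x sA(2)])
    also have "\<dots> = \<tau> x" using herm[OF x sA(2)] by simp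
    finally show "\<tau> x = cinner (amp x (flatten W)) (flatten W)" by simp
  qed
qed

section \<open>Normal automorphisms\<close>

lemma contractive_positive_amp:
  assumes "contractive_positive D"
  shows "contractive_positive (amp D)"
proof -
  have D: "D \<in> bounded_ops" "\<And>v w. cinner (D v) w = cinner v (D w)"
    "\<And>v. 0 \<le> Re (cinner (D v) v)" "\<And>v. Re (cinner (D v) v) \<le> (norm v)\<^sup>2"
    using assms by (auto simp: contractive_positive_def)
  have s: "(\<lambda>n. Re (cinner (D (coord v n)) (coord v n))) sums Re (cinner (amp D v) v)" for v
    by (intro sums_Re cinner_amp_sums) (use D(1) in \<open>simp add: bounded_ops_iff\<close>)
  have "adj D = D" by (rule adj_unique) (rule D(2))
  then have "adj (amp D) = amp D" by (simp add: adj_amp[OF D(1)])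
  then have "cinner (amp D v) w = cinner v (amp D w)" for v w
    using adj_right[OF amp_bounded_ops[OF D(1)], of v w] by simp
  moreover have "0 \<le> Re (cinner (amp D v) v)" for v
    using sums_le[OF _ sums_zero s[of v]] D(3) by simp
  moreover have "Re (cinner (amp D v) v) \<le> (norm v)\<^sup>2" for v
    using sums_le[OF _ s[of v] norm_ell2_sums[of v]] D(4) by simp
  ultimately show ?thesis using amp_bounded_ops[OF D(1)] by (simp add: contractive_positive_def)
qed

lemma amp_square_terms:
  assumes "D \<in> bounded_ops"
  shows "square_terms D n \<in> bounded_ops \<and> amp (square_terms D n) = square_terms (amp D) n"
proof (induction n)
  case (Suc n)
  define E where "E = square_terms D n"
  have E: "E \<in> bounded_ops" "square_terms (amp D) n = amp E" using Suc by (auto simp: E_def)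
  have EE: "E \<circ> E \<in> bounded_ops" using E by blast
  have "(\<lambda>v. E v - (E \<circ> E) v) \<in> bounded_ops" using E EE by blast
  moreover have "amp (\<lambda>v. E v - (E \<circ> E) v) = (\<lambda>w. amp E w - amp E (amp E w))"
    using amp_op_minus[OF E(1) EE] amp_op_comp[OF E(1) E(1)] by (simp add: fun_eq_iff)
  ultimately show ?case using E by (simp add: E_def[symmetric])
qed (use assms in auto)

lemma star_automorphismD:
  assumes "star_automorphism M f"
  shows "x \<in> M \<Longrightarrow> f x \<in> M"
    and "x \<in> M \<Longrightarrow> y \<in> M \<Longrightarrow> f (\<lambda>v. x v + y v) = (\<lambda>v. f x v + f y v)"
    and "x \<in> M \<Longrightarrow> f (\<lambda>v. c *\<^sub>C x v) = (\<lambda>v. c *\<^sub>C f x v)"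
    and "x \<in> M \<Longrightarrow> y \<in> M \<Longrightarrow> f (x \<circ> y) = f x \<circ> f y"
    and "x \<in> M \<Longrightarrow> f (adj x) = adj (f x)"
  using assms by (auto simp: star_automorphism_def bij_betw_def)

lemma star_automorphism_id:
  assumes "star_automorphism M f" "id \<in> M"
  shows "f id = id"
proof -
  have "id \<in> f ` M" using assms by (simp add: star_automorphism_def bij_betw_def)
  then obtain x where x: "x \<in> M" "f x = id" by (rule imageE) simp
  have "f id \<circ> f x = f (id \<circ> x)" using star_automorphismD(4)[OF assms(1,2) x(1)] by simp
  then show ?thesis using x by simp
qed

lemma star_automorphism_minus:
  assumes f: "star_automorphism M f" and M: "star_algebra M" and "x \<in> M" "y \<in> M"
  shows "f (\<lambda>v. x v - y v) = (\<lambda>v. f x v - f y v)"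
proof -
  have "f (\<lambda>v. x v + (-1) *\<^sub>C y v) = (\<lambda>v. f x v + f (\<lambda>v. (-1) *\<^sub>C y v) v)"
    by (rule star_automorphismD(2)[OF f assms(3) star_algebraD(6)[OF M assms(4)]])
  moreover have "f (\<lambda>v. (-1) *\<^sub>C y v) = (\<lambda>v. (-1) *\<^sub>C f y v)"
    by (rule star_automorphismD(3)[OF f assms(4)])
  ultimately show ?thesis by (simp add: scaleC_minus_one)
qed

text \<open>It suffices that \<open>f\<close> keeps \<open>D = 1 - m\<^sup>* m / K\<^sup>2\<close>
  positive. Applying \<open>f\<close> to the expansion of \<open>D\<close> gives squares of
  symmetric operators plus the image of the remainder, and normality makes this image tend weakly to
  0. The estimate later bounds all blocks of \<open>\<pi> x\<close> at once.\<close>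

lemma normal_automorphism_norm_le:
  assumes M: "von_neumann_algebra M" and f: "star_automorphism M f"
    and normal: "\<And>\<phi>. ultraweak_functional M \<phi> \<Longrightarrow> ultraweak_functional M (\<phi> \<circ> f)"
    and m: "m \<in> M" and K: "0 < K" "\<And>v. norm (m v) \<le> K * norm v"
  shows "norm (f m v) \<le> K * norm v"
proof -
  have sM: "star_algebra M" by (rule vna_star_algebra[OF M])
  note S = star_algebraD[OF sM]
  note fM = star_automorphismD(1)[OF f] and f_mult = star_automorphismD(4)[OF f]
    and f_adj = star_automorphismD(5)[OF f] and f_scale = star_automorphismD(3)[OF f]
  note f_minus = star_automorphism_minus[OF f sM]
  define c where "c = complex_of_real (1 / K\<^sup>2)"
  have mm: "adj m \<circ> m \<in> M" by (intro S m)
  define D where "D = defect K m"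
  have DM: "D \<in> M"
    unfolding D_def defect_def by (intro star_algebra_minus[OF sM] S(2,6) mm)
  have cp: "contractive_positive D"
    unfolding D_def by (rule contractive_positive_defect[OF S(3)[OF m] K])
  have stM: "square_terms D n \<in> M" for n
  proof (induction n)
    case (Suc n)
    then show ?case using star_algebra_minus[OF sM Suc S(4)[OF Suc Suc]] by simp
  qed (simp add: DM)
  have st_adj: "adj (square_terms D n) = square_terms D n" for n
    by (rule adj_unique) (rule square_terms_symmetric[OF cp])
  \<comment> \<open>Each step of the recursion subtracts a square, and \<open>f\<close> maps squares
    of symmetric elements to such squares.\<close>
  have decr: "Re (cinner (f (square_terms D n) v) v) \<le> Re (cinner (f D v) v)" for n
  proof (induction n)
    case (Suc n)
    define E where "E = square_terms D n"
    have E: "E \<in> M" "adj (f E) = f E" using stM st_adj f_adj[OF stM, of n] by (auto simp: E_def)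
    have "f (square_terms D (Suc n)) = f (\<lambda>v. E v - (E \<circ> E) v)" by (simp add: E_def)
    also have "\<dots> = (\<lambda>v. f E v - f E (f E v))" using f_minus[OF E(1) S(4)[OF E(1) E(1)]] f_mult[OF E(1) E(1)] by simp
    finally have eq: "f (square_terms D (Suc n)) = (\<lambda>v. f E v - f E (f E v))" .
    have "cinner (f E (f E v)) v = cinner (f E v) (f E v)"
      using adj_left[OF S(3)[OF fM[OF E(1)]], of "f E v" v] E(2) by simp
    then have "Re (cinner (f (square_terms D (Suc n)) v) v) \<le> Re (cinner (f E v) v)"
      unfolding eq by (simp add: cinner_simps cinner_self)
    then show ?case using Suc by (simp add: E_def)
  qed simp
  have "ultraweak_functional M (\<lambda>x. cinner (x v) v)"
    unfolding ultraweak_functional_iff[OF S(1)]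
    using S(3) by (intro exI[of _ "ell2_single 0 v"]) (auto simp: amp_single bounded_ops_iff[symmetric] cinner_single_right coord_single)
  then obtain \<alpha> \<beta> where \<alpha>\<beta>: "\<And>x. x \<in> M \<Longrightarrow> cinner (f x v) v = cinner (amp x \<alpha>) \<beta>"
    using normal[of "\<lambda>x. cinner (x v) v"] unfolding ultraweak_functional_iff[OF S(1)] comp_def by blast
  \<comment> \<open>The functional \<open>\<lambda>x. cinner (f x v) v\<close> is a vector
    functional of the amplification, where the remainders converge to 0 strongly.\<close>
  have "(\<lambda>n. square_terms (amp D) n \<alpha>) \<longlonglongrightarrow> 0"
    by (rule square_terms_tendsto_0[OF contractive_positive_amp[OF cp]])
  then have "(\<lambda>n. Re (cinner (amp (square_terms D n) \<alpha>) \<beta>)) \<longlonglongrightarrow> Re (cinner 0 \<beta>)"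
    using amp_square_terms[OF S(3)[OF DM]] by (intro tendsto_intros) simp
  then have "(\<lambda>n. Re (cinner (f (square_terms D n) v) v)) \<longlonglongrightarrow> 0"
    by (simp add: \<alpha>\<beta>[OF stM])
  then have "0 \<le> Re (cinner (f D v) v)"
    using decr by (intro LIMSEQ_le_const2) auto
  moreover have "f D = defect K (f m)"
    unfolding D_def defect_def c_def[symmetric]
    using f_minus[OF S(2) S(6)[OF mm, of c]] f_scale[OF mm, of c] f_mult[OF S(7)[OF m] m] f_adj[OF m]
      star_automorphism_id[OF f S(2)] by simp
  ultimately have "0 \<le> (norm v)\<^sup>2 - (norm (f m v))\<^sup>2 / K\<^sup>2"
    using Re_cinner_defect[OF S(3)[OF fM[OF m]], of K v] by simp
  then have "(norm (f m v))\<^sup>2 \<le> (K * norm v)\<^sup>2" using K(1) by (simp add: field_simps power_mult_distrib)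
  then show ?thesis by (rule power2_le_imp_le) (use K(1) in simp)
qed

section \<open>Tensor products\<close>

lemma dense_span_eqI:
  assumes "dense_span S" "\<And>s. s \<in> S \<Longrightarrow> cinner u s = cinner v (s :: 'h::chilbert_space)"
  shows "u = v"
proof -
  have "cinner (u - v) s = 0" if "s \<in> complex_vector.span S" for s
    using that
  proof (induction rule: complex_vector.span_induct_alt)
    case (step c x y)
    then show ?case using assms(2) by (simp add: cinner_add_right cinner_scaleC_right cinner_diff_left)
  qed simp
  then have "cinner (u - v) (u - v) = 0"
  proof (rule cinner_zero_closure)
    have "closure (complex_vector.span S) = UNIV" using assms(1) unfolding dense_span_def .
    then show "u - v \<in> closure (complex_vector.span S)" by (simp only: UNIV_I)
  qed
  then show ?thesis by simp
qed

lemma hilbert_tensorD: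
  assumes "hilbert_tensor t"
  shows "clinear (\<lambda>h. t h k)" "clinear (t h)"
    "cinner (t h k) (t h' k') = cinner h h' * cinner k k'"
    "dense_span {t h k | h k. True}"
  using assms by (auto simp: hilbert_tensor_def)

lemma norm_tensor:
  assumes "hilbert_tensor t"
  shows "norm (t h k) = norm h * norm k"
proof -
  have "complex_of_real ((norm (t h k))\<^sup>2) = complex_of_real ((norm h * norm k)\<^sup>2)"
    unfolding cinner_self[symmetric] hilbert_tensorD(3)[OF assms]
    by (simp add: cinner_self power_mult_distrib)
  then have "(norm (t h k))\<^sup>2 = (norm h * norm k)\<^sup>2" using of_real_eq_iff by blast
  then show ?thesis by (simp add: power2_eq_iff_nonneg)
qed

lemma bounded_clinear_tensor_left: "hilbert_tensor t \<Longrightarrow> bounded_clinear (\<lambda>h. t h k)"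
  by (rule bounded_clinearI[where K = "norm k"]) (simp_all add: hilbert_tensorD norm_tensor)

lemma bounded_clinear_tensor_right: "hilbert_tensor t \<Longrightarrow> bounded_clinear (t h)"
  by (rule bounded_clinearI[where K = "norm h"]) (simp_all add: hilbert_tensorD norm_tensor)

lemma hilbert_tensor_flip:
  assumes "hilbert_tensor t"
  shows "hilbert_tensor (\<lambda>k h. t h k)"
proof -
  have "{t h k |k h. True} = {t h k |h k. True}" by blast
  then show ?thesis using assms unfolding hilbert_tensor_def by (simp add: mult.commute)
qed

lemma tensor_eqI:
  assumes "hilbert_tensor t" "\<And>h k. cinner u (t h k) = cinner v (t h k)"
  shows "u = v"
  by (rule dense_span_eqI[OF hilbert_tensorD(4)[OF assms(1)]]) (use assms(2) in blast)

lemma tensor_op_eq: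
  assumes "hilbert_tensor t" "bounded_clinear T" "bounded_clinear T'" "\<And>h k. T (t h k) = T' (t h k)"
  shows "T = T'"
  by (rule bounded_clinear_eq_dense_span[OF assms(2,3) hilbert_tensorD(4)[OF assms(1)]]) (use assms(4) in blast)

text \<open>A list stands for a finite sum of elementary tensors. The same list gives the vector
  (\<open>a = id\<close>) and its image under \<open>a \<otimes> 1\<close>, so the graph of
  \<open>a \<otimes> 1\<close> can be written down although the list is not determined by the
  vector.\<close>

definition tensor_list ::
    "('h::chilbert_space \<Rightarrow> 'k::chilbert_space \<Rightarrow> 'hk::chilbert_space) \<Rightarrow> ('h \<Rightarrow> 'h) \<Rightarrow> ('h \<times> 'k) list \<Rightarrow> 'hk" where
  "tensor_list t a L = (\<Sum>(h, k)\<leftarrow>L. t (a h) k)"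

lemma tensor_list_sum:
  "tensor_list t a L = (\<Sum>i<length L. t (a (fst (L ! i))) (snd (L ! i)))"
  unfolding tensor_list_def by (simp add: sum_list_sum_nth atLeast0LessThan case_prod_beta)

lemma cinner_tensor_list:
  assumes "hilbert_tensor t"
  shows "cinner (tensor_list t a L) (tensor_list t b L) =
    (\<Sum>i<length L. \<Sum>j<length L. cinner (a (fst (L ! i))) (b (fst (L ! j))) * cinner (snd (L ! i)) (snd (L ! j)))"
  unfolding tensor_list_sum cinner_sum_left cinner_sum_right hilbert_tensorD(3)[OF assms]
  by (rule sum.swap)

text \<open>With \<open>1 - c a\<^sup>* a\<close> written as a sum of squares \<open>\<Sum>\<^sub>n d\<^sub>n\<^sup>2\<close>, the difference
  \<open>\<parallel>v\<parallel>\<^sup>2 - c \<parallel>(a \<otimes> 1) v\<parallel>\<^sup>2\<close> is \<open>\<Sum>\<^sub>n \<parallel>(d\<^sub>n \<otimes> 1) v\<parallel>\<^sup>2\<close>, so \<open>a \<otimes> 1\<close> is bounded.\<close>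

lemma tensor_list_norm_le:
  assumes t: "hilbert_tensor t" and a: "a \<in> bounded_ops" and K: "0 < K" "\<And>v. norm (a v) \<le> K * norm v"
  shows "norm (tensor_list t a L) \<le> K * norm (tensor_list t id L)"
proof -
  define c where "c = complex_of_real (1 / K\<^sup>2)"
  define D where "D = defect K a"
  have D_form: "cinner (D v) w = cinner v w - c * cinner (a v) (a w)" for v w
    unfolding D_def c_def by (rule cinner_defect[OF a])
  have cp: "contractive_positive D"
    unfolding D_def by (rule contractive_positive_defect[OF a K])
  have "(\<lambda>n. cinner (tensor_list t (square_terms D n) L) (tensor_list t (square_terms D n) L)) sums
      (\<Sum>i<length L. \<Sum>j<length L. cinner (D (fst (L ! i))) (fst (L ! j)) * cinner (snd (L ! i)) (snd (L ! j)))"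
    unfolding cinner_tensor_list[OF t] by (intro sums_sum sums_mult2 square_terms_sums cp)
  also have "(\<Sum>i<length L. \<Sum>j<length L. cinner (D (fst (L ! i))) (fst (L ! j)) * cinner (snd (L ! i)) (snd (L ! j)))
      = cinner (tensor_list t id L) (tensor_list t id L) - c * cinner (tensor_list t a L) (tensor_list t a L)"
    unfolding cinner_tensor_list[OF t] D_form
    by (simp add: left_diff_distrib sum_subtractf sum_distrib_left mult.assoc)
  finally have "(\<lambda>n. Re (cinner (tensor_list t (square_terms D n) L) (tensor_list t (square_terms D n) L))) sums
      Re (cinner (tensor_list t id L) (tensor_list t id L) - c * cinner (tensor_list t a L) (tensor_list t a L))"
    by (rule sums_Re)
  from sums_le[OF _ sums_zero this]
  have "0 \<le> Re (cinner (tensor_list t id L) (tensor_list t id L) - c * cinner (tensor_list t a L) (tensor_list t a L))"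
    by (simp add: cinner_self)
  then have "0 \<le> (norm (tensor_list t id L))\<^sup>2 - (norm (tensor_list t a L))\<^sup>2 / K\<^sup>2"
    by (simp add: cinner_self c_def Re_divide_of_real flip: of_real_power of_real_mult of_real_divide)
  then have "(norm (tensor_list t a L))\<^sup>2 \<le> (K * norm (tensor_list t id L))\<^sup>2"
    using K(1) by (simp add: field_simps power_mult_distrib)
  then show ?thesis by (rule power2_le_imp_le) (use K(1) in simp)
qed

lemma tensor_left_exists:
  assumes t: "hilbert_tensor t" and a: "a \<in> bounded_ops"
  shows "\<exists>T\<in>bounded_ops. \<forall>h k. T (t h k) = t (a h) k"
proof -
  obtain K where K: "0 < K" "\<And>v. norm (a v) \<le> K * norm v"
    using bounded_clinear_bound a by (auto simp: bounded_ops_iff)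
  define R where "R = range (\<lambda>L. (tensor_list t id L, tensor_list t a L))"
  have scale: "tensor_list t b (map (\<lambda>(h, k). (c *\<^sub>C h, k)) L) = c *\<^sub>C tensor_list t b L"
    if "b \<in> bounded_ops" for b c L
    by (induction L)
      (auto simp: tensor_list_def scaleC_add_right ops_simps[OF that] clinear_scaleC[OF hilbert_tensorD(1)[OF t]])
  obtain T where T: "bounded_clinear T" "\<And>v w. (v, w) \<in> R \<Longrightarrow> T v = w"
  proof (rule extend_bounded_relation[of R K])
    have "(0, 0) = (tensor_list t id [], tensor_list t a [])" by (simp add: tensor_list_def)
    then show "(0, 0) \<in> R" unfolding R_def by blast
    show "(v + v', w + w') \<in> R" if vw: "(v, w) \<in> R" "(v', w') \<in> R" for v w v' w'
    proof -
      obtain L L' where "v = tensor_list t id L" "w = tensor_list t a L"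
        "v' = tensor_list t id L'" "w' = tensor_list t a L'" using vw unfolding R_def by blast
      then have "(v + v', w + w') = (tensor_list t id (L @ L'), tensor_list t a (L @ L'))"
        by (simp add: tensor_list_def)
      then show ?thesis unfolding R_def by blast
    qed
    show "(c *\<^sub>C v, c *\<^sub>C w) \<in> R" if vw: "(v, w) \<in> R" for c v w
    proof -
      obtain L where "v = tensor_list t id L" "w = tensor_list t a L" using vw unfolding R_def by blast
      then have "(c *\<^sub>C v, c *\<^sub>C w) = (tensor_list t id (map (\<lambda>(h, k). (c *\<^sub>C h, k)) L),
          tensor_list t a (map (\<lambda>(h, k). (c *\<^sub>C h, k)) L))"
        using scale[OF a] scale[OF bounded_ops_simps(1)] by simp
      then show ?thesis unfolding R_def by blast
    qed
    show "norm w \<le> K * norm v" if vw: "(v, w) \<in> R" for v w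
      using vw tensor_list_norm_le[OF t a K] unfolding R_def by auto
  qed (use K that in auto)
  have "T (t h k) = t (a h) k" for h k
  proof (rule T(2))
    have "(t h k, t (a h) k) = (tensor_list t id [(h, k)], tensor_list t a [(h, k)])"
      by (simp add: tensor_list_def)
    then show "(t h k, t (a h) k) \<in> R" unfolding R_def by blast
  qed
  then show ?thesis using T(1) by (intro bexI[of _ T]) (simp_all add: bounded_ops_iff)
qed

text \<open>\<open>a \<otimes> b\<close> is composed of \<open>a \<otimes> 1\<close> and
  \<open>1 \<otimes> b\<close>; the latter is the former for the flipped tensor product.\<close>

lemma tensor_op_exists:
  assumes t: "hilbert_tensor t" and a: "a \<in> bounded_ops" and b: "b \<in> bounded_ops"
  shows "\<exists>T\<in>bounded_ops. \<forall>h k. T (t h k) = t (a h) (b k)"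
proof -
  obtain T where T: "T \<in> bounded_ops" "\<forall>h k. T (t h k) = t (a h) k"
    using tensor_left_exists[OF t a] by blast
  obtain T' where T': "T' \<in> bounded_ops" "\<forall>k h. T' (t h k) = t h (b k)"
    using tensor_left_exists[OF hilbert_tensor_flip[OF t] b] by blast
  show ?thesis by (rule bexI[of _ "T \<circ> T'"]) (use T T' in auto)
qed

lemma tensor_op_unique:
  assumes t: "hilbert_tensor t" and T: "T \<in> bounded_ops" "\<And>h k. T (t h k) = t (a h) (b k)"
  shows "tensor_op t a b = T"
  unfolding tensor_op_def
proof (rule the_equality)
  show "T' = T" if "T' \<in> bounded_ops \<and> (\<forall>h k. T' (t h k) = t (a h) (b k))" for T'
    by (rule tensor_op_eq[OF t]) (use that T in \<open>auto simp: bounded_ops_iff\<close>)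
qed (use T in blast)

lemma tensor_op_props:
  assumes t: "hilbert_tensor t" and a: "a \<in> bounded_ops" and b: "b \<in> bounded_ops"
  shows "tensor_op t a b \<in> bounded_ops \<and> (\<forall>h k. tensor_op t a b (t h k) = t (a h) (b k))"
proof -
  obtain T where T: "T \<in> bounded_ops" "\<forall>h k. T (t h k) = t (a h) (b k)"
    using tensor_op_exists[OF assms] by blast
  then have "tensor_op t a b = T" by (intro tensor_op_unique[OF t]) auto
  then show ?thesis using T by simp
qed

lemma tensor_op_bounded:
    "hilbert_tensor t \<Longrightarrow> a \<in> bounded_ops \<Longrightarrow> b \<in> bounded_ops \<Longrightarrow> tensor_op t a b \<in> bounded_ops"
  and tensor_op_apply:
    "hilbert_tensor t \<Longrightarrow> a \<in> bounded_ops \<Longrightarrow> b \<in> bounded_ops \<Longrightarrow> tensor_op t a b (t h k) = t (a h) (b k)"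
  using tensor_op_props by blast+

lemma tensor_op_id: "hilbert_tensor t \<Longrightarrow> tensor_op t id id = id"
  by (rule tensor_op_unique) auto

lemma tensor_op_comp:
  assumes "hilbert_tensor t" "a \<in> bounded_ops" "b \<in> bounded_ops" "a' \<in> bounded_ops" "b' \<in> bounded_ops"
  shows "tensor_op t a b \<circ> tensor_op t a' b' = tensor_op t (a \<circ> a') (b \<circ> b')"
  by (rule tensor_op_unique[OF assms(1), symmetric])
    (use assms in \<open>auto simp: tensor_op_apply intro: tensor_op_bounded\<close>)

lemma tensor_op_adj:
  assumes t: "hilbert_tensor t" and a: "a \<in> bounded_ops" and b: "b \<in> bounded_ops"
  shows "adj (tensor_op t a b) = tensor_op t (adj a) (adj b)"
proof (rule tensor_op_unique[OF t, symmetric])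
  have T: "tensor_op t a b \<in> bounded_ops" by (rule tensor_op_bounded[OF assms])
  then show "adj (tensor_op t a b) \<in> bounded_ops" by (rule adj_bounded)
  show "adj (tensor_op t a b) (t h k) = t (adj a h) (adj b k)" for h k
    by (rule tensor_eqI[OF t])
      (simp add: adj_left[OF T] tensor_op_apply[OF assms] hilbert_tensorD(3)[OF t] adj_left[OF a] adj_left[OF b])
qed

abbreviation elementary_tensors ::
    "('h::chilbert_space \<Rightarrow> 'k::chilbert_space \<Rightarrow> 'hk::chilbert_space) \<Rightarrow>
     ('h \<Rightarrow> 'h) set \<Rightarrow> ('k \<Rightarrow> 'k) set \<Rightarrow> ('hk \<Rightarrow> 'hk) set" where
  "elementary_tensors t A B \<equiv> {tensor_op t a b | a b. a \<in> A \<and> b \<in> B}"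

lemma elementary_tensors_bounded:
  assumes "hilbert_tensor t" "A \<subseteq> bounded_ops" "B \<subseteq> bounded_ops"
  shows "elementary_tensors t A B \<subseteq> bounded_ops"
  using assms by (auto intro!: tensor_op_bounded)

lemma star_algebra_elementary_tensors:
  assumes t: "hilbert_tensor t" and A: "star_algebra A" and B: "star_algebra B"
  shows "star_algebra (lspan (elementary_tensors t A B))"
proof (rule star_algebra_lspan)
  note SA = star_algebraD[OF A] and SB = star_algebraD[OF B]
  show "elementary_tensors t A B \<subseteq> bounded_ops"
    by (rule elementary_tensors_bounded[OF t SA(1) SB(1)])
  show "id \<in> elementary_tensors t A B"
    using tensor_op_id[OF t] SA(2) SB(2) by (metis (mono_tags, lifting) mem_Collect_eq)
  fix x assume "x \<in> elementary_tensors t A B"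
  then obtain a b where x: "a \<in> A" "b \<in> B" "x = tensor_op t a b" by blast
  have "adj x = tensor_op t (adj a) (adj b)"
    unfolding x(3) by (rule tensor_op_adj[OF t SA(3)[OF x(1)] SB(3)[OF x(2)]])
  then show "adj x \<in> elementary_tensors t A B" using SA(7)[OF x(1)] SB(7)[OF x(2)] by blast
  fix y assume "y \<in> elementary_tensors t A B"
  then obtain a' b' where y: "a' \<in> A" "b' \<in> B" "y = tensor_op t a' b'" by blast
  have "x \<circ> y = tensor_op t (a \<circ> a') (b \<circ> b')"
    unfolding x(3) y(3)
    by (rule tensor_op_comp[OF t SA(3)[OF x(1)] SB(3)[OF x(2)] SA(3)[OF y(1)] SB(3)[OF y(2)]])
  then show "x \<circ> y \<in> elementary_tensors t A B" using SA(4)[OF x(1) y(1)] SB(4)[OF x(2) y(2)] by blast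
qed

lemma vn_generated_lspan:
  assumes "star_algebra (lspan S)"
  shows "vn_generated S \<subseteq> commutant (commutant (lspan S))"
proof (rule vn_generated_least)
  show "von_neumann_algebra (commutant (commutant (lspan S)))"
    using star_algebraD[OF assms] by (intro vna_bicommutant) auto
  show "S \<subseteq> commutant (commutant (lspan S))"
    using bicommutant_extensive[OF star_algebraD(1)[OF assms]] lspan.base by blast
qed

lemma vna_tensor:
  assumes "hilbert_tensor t" "A \<subseteq> bounded_ops" "B \<subseteq> bounded_ops"
  shows "von_neumann_algebra (tensor_vna t A B)"
  unfolding tensor_vna_def by (rule vna_vn_generated[OF elementary_tensors_bounded[OF assms]])

lemma tensor_vna_elementary: "a \<in> A \<Longrightarrow> b \<in> B \<Longrightarrow> tensor_op t a b \<in> tensor_vna t A B"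
  unfolding tensor_vna_def by (rule subsetD[OF vn_generated_subset]) blast

lemma tensor_vna_bicommutant:
  assumes "hilbert_tensor t" "star_algebra A" "star_algebra B" "x \<in> tensor_vna t A B"
  shows "x \<in> commutant (commutant (lspan (elementary_tensors t A B)))"
  using assms(4) vn_generated_lspan[OF star_algebra_elementary_tensors[OF assms(1-3)]]
  unfolding tensor_vna_def by blast

text \<open>The easy inclusion of the commutation theorem: the tensors of the two commutants form a
  selfadjoint set \<open>T\<close>, so its commutant is a von Neumann algebra, and it contains the
  elementary tensors of \<open>A\<close> and \<open>B\<close>.\<close>

lemma tensor_op_commutant:
  assumes t: "hilbert_tensor t" and A: "star_algebra A" and B: "star_algebra B"
    and X: "X \<in> commutant A" and Y: "Y \<in> commutant B" and x: "x \<in> tensor_vna t A B"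
  shows "x (tensor_op t X Y v) = tensor_op t X Y (x v)"
proof -
  note SA = star_algebraD[OF A] and SB = star_algebraD[OF B]
  have bA: "X \<in> bounded_ops" if "X \<in> commutant A" for X using that commutant_bounded by blast
  have bB: "Y \<in> bounded_ops" if "Y \<in> commutant B" for Y using that commutant_bounded by blast
  define T where "T = {tensor_op t X Y | X Y. X \<in> commutant A \<and> Y \<in> commutant B}"
  have Tb: "T \<subseteq> bounded_ops" unfolding T_def using bA bB tensor_op_bounded[OF t] by auto
  have adj_T: "adj S \<in> T" if S: "S \<in> T" for S
  proof -
    obtain X Y where XY: "X \<in> commutant A" "Y \<in> commutant B" "S = tensor_op t X Y"
      using S unfolding T_def by blast
    then show ?thesis
      unfolding T_def XY(3) tensor_op_adj[OF t bA[OF XY(1)] bB[OF XY(2)]]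
      using commutant_adj[OF SA(1,7)] commutant_adj[OF SB(1,7)] by blast
  qed
  have "vn_generated (elementary_tensors t A B) \<subseteq> commutant T"
  proof (rule vn_generated_least)
    have "von_neumann_algebra (commutant (commutant (commutant T)))"
      by (intro vna_bicommutant commutant_bounded commutant_adj Tb adj_T)
    then show "von_neumann_algebra (commutant T)" by (simp add: tricommutant[OF Tb])
    show "elementary_tensors t A B \<subseteq> commutant T"
    proof
      fix w assume "w \<in> elementary_tensors t A B"
      then obtain a b where ab: "a \<in> A" "b \<in> B" "w = tensor_op t a b" by blast
      have "w \<circ> S = S \<circ> w" if S: "S \<in> T" for S
      proof -
        obtain X Y where XY: "X \<in> commutant A" "Y \<in> commutant B" "S = tensor_op t X Y"
          using S unfolding T_def by blast
        have "X \<circ> a = a \<circ> X" "Y \<circ> b = b \<circ> Y"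
          using commutantD[OF XY(1) ab(1)] commutantD[OF XY(2) ab(2)] by (simp_all add: fun_eq_iff)
        then show ?thesis
          unfolding ab(3) XY(3)
          by (simp add: tensor_op_comp[OF t] SA(3)[OF ab(1)] SB(3)[OF ab(2)] bA[OF XY(1)] bB[OF XY(2)])
      qed
      then show "w \<in> commutant T"
        using tensor_op_bounded[OF t SA(3)[OF ab(1)] SB(3)[OF ab(2)]] ab(3) by (simp add: commutant_def)
    qed
  qed
  then have "x \<in> commutant T" using x unfolding tensor_vna_def by blast
  moreover have "tensor_op t X Y \<in> T" using X Y unfolding T_def by blast
  ultimately show ?thesis by (rule commutantD)
qed

subsection \<open>Slicing\<close>

text \<open>For fixed \<open>k\<close>, \<open>k'\<close> the slice \<open>h \<mapsto> \<langle>m (h \<otimes> k), \<cdot> \<otimes> k'\<rangle>\<close> commutes with \<open>A\<close> and with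
  its commutant, hence is a scalar.\<close>

lemma relative_commutant_of_left_factor:
  assumes t: "hilbert_tensor (t :: 'a::chilbert_space \<Rightarrow> 'b::chilbert_space \<Rightarrow> 'ab::chilbert_space)"
    and A: "factor A" and nz: "id \<noteq> ((\<lambda>_. 0) :: 'a \<Rightarrow> 'a)" and B: "von_neumann_algebra B"
    and m: "m \<in> tensor_vna t A B"
    and comm: "\<And>a v. a \<in> A \<Longrightarrow> m (tensor_op t a id v) = tensor_op t a id (m v)"
  shows "\<exists>c\<in>B. m = tensor_op t id c"
proof -
  have vA: "von_neumann_algebra A" and center: "A \<inter> commutant A = range (\<lambda>c v. c *\<^sub>C v)"
    using A by (auto simp: factor_def)
  note SA = star_algebraD[OF vna_star_algebra[OF vA]] and SB = star_algebraD[OF vna_star_algebra[OF B]]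
  have mb: "m \<in> bounded_ops"
    using m star_algebraD(3)[OF vna_star_algebra[OF vna_tensor[OF t SA(1) SB(1)]]] by blast
  have idb: "id \<in> bounded_ops" by (rule bounded_ops_simps(1))
  \<comment> \<open>Commutation with \<open>A\<close> is assumed; commutation with its commutant
    comes from \<open>m\<close> lying in the tensor product of \<open>A\<close> and
    \<open>B\<close>. Together they put each slice into the center of \<open>A\<close>.\<close>
  have commA': "m (tensor_op t a id v) = tensor_op t a id (m v)" if a: "a \<in> commutant A" for a v
    by (rule tensor_op_commutant[OF t vna_star_algebra[OF vA] vna_star_algebra[OF B] a commutant_id m])
  have slice: "\<exists>c. \<forall>h h'. cinner (m (t h k)) (t h' k') = c * cinner h h'" for k k'
  proof -
    define R where "R k = (\<lambda>h. t h k)" for k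
    have Rb: "bounded_clinear (R k)" for k unfolding R_def by (rule bounded_clinear_tensor_left[OF t])
    define s where "s = cadj (R k') \<circ> (m \<circ> R k)"
    have sb: "s \<in> bounded_ops"
      using mb Rb unfolding s_def bounded_ops_iff by (intro bounded_clinear_comp bounded_clinear_cadj)
    have s: "cinner (s h) h' = cinner (m (t h k)) (t h' k')" for h h'
      by (simp add: s_def cadj_left[OF Rb]) (simp add: R_def)
    have s_comm: "s (a h) = a (s h)"
      if a: "a \<in> bounded_ops" and ma: "\<And>v. m (tensor_op t a id v) = tensor_op t a id (m v)" for a h
    proof (rule cinner_eqI)
      fix h'
      have ta: "tensor_op t a id \<in> bounded_ops" by (rule tensor_op_bounded[OF t a idb])
      have "cinner (s (a h)) h' = cinner (m (tensor_op t a id (t h k))) (t h' k')"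
        by (simp add: s tensor_op_apply[OF t a idb])
      also have "\<dots> = cinner (m (t h k)) (adj (tensor_op t a id) (t h' k'))"
        unfolding ma by (simp add: adj_right[OF ta])
      also have "\<dots> = cinner (s h) (adj a h')"
        by (simp add: s tensor_op_adj[OF t a idb] tensor_op_apply[OF t adj_bounded[OF a] idb])
      also have "\<dots> = cinner (a (s h)) h'" by (rule adj_right[OF a])
      finally show "cinner (s (a h)) h' = cinner (a (s h)) h'" .
    qed
    have "s \<in> commutant A" using sb SA(3) comm s_comm by (intro commutantI) auto
    moreover have "s \<in> commutant (commutant A)"
      using sb commutant_bounded commA' s_comm by (intro commutantI) blast+
    ultimately have "s \<in> range (\<lambda>c v. c *\<^sub>C v)"
      using center vna_bicommutant_eq[OF vA] by blast
    then obtain c where "s = (\<lambda>v. c *\<^sub>C v)" by blast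
    then have "cinner (m (t h k)) (t h' k') = c * cinner h h'" for h h'
      using s[of h h'] by (simp add: cinner_simps)
    then show ?thesis by blast
  qed
  obtain h0 :: 'a where h0: "h0 \<noteq> 0" using nz by (auto simp: fun_eq_iff)
  \<comment> \<open>A unit vector in the first leg reads off the scalars of all slices; as they do
    not depend on the vectors of that leg, the operator \<open>c\<close> so obtained describes
    \<open>m\<close> completely.\<close>
  define h1 where "h1 = complex_of_real (1 / norm h0) *\<^sub>C h0"
  have h1: "cinner h1 h1 = 1" using h0 by (simp add: h1_def cinner_self norm_divide)
  have Lb: "bounded_clinear (t h1)" by (rule bounded_clinear_tensor_right[OF t])
  define c where "c = cadj (t h1) \<circ> (m \<circ> t h1)"
  have cb: "c \<in> bounded_ops"
    using mb Lb unfolding c_def bounded_ops_iff by (intro bounded_clinear_comp bounded_clinear_cadj)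
  have c: "cinner (c k) k' = cinner (m (t h1 k)) (t h1 k')" for k k'
    by (simp add: c_def cadj_left[OF Lb])
  have m_eq: "m (t h k) = t h (c k)" for h k
  proof (rule tensor_eqI[OF t])
    fix h' k'
    obtain d where d: "\<And>h h'. cinner (m (t h k)) (t h' k') = d * cinner h h'" using slice by blast
    have "cinner (c k) k' = d" using d[of h1 h1] by (simp add: c h1)
    then show "cinner (m (t h k)) (t h' k') = cinner (t h (c k)) (t h' k')"
      using d[of h h'] by (simp add: hilbert_tensorD(3)[OF t])
  qed
  have "tensor_op t id c = m" by (rule tensor_op_unique[OF t mb]) (simp add: m_eq)
  moreover have "c \<in> commutant (commutant B)"
  proof (rule commutantI[OF cb])
    fix b k assume b: "b \<in> commutant B"
    then have bb: "b \<in> bounded_ops" using commutant_bounded by blast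
    have "m (tensor_op t id b v) = tensor_op t id b (m v)" for v
      by (rule tensor_op_commutant[OF t vna_star_algebra[OF vA] vna_star_algebra[OF B] commutant_id b m])
    from this[of "t h1 k"] have "t h1 (c (b k)) = t h1 (b (c k))"
      by (simp add: tensor_op_apply[OF t idb bb] m_eq)
    then have "t h1 (c (b k) - b (c k)) = 0"
      by (simp add: clinear_diff[OF hilbert_tensorD(2)[OF t]])
    then have "norm h1 * norm (c (b k) - b (c k)) = 0" by (metis norm_tensor[OF t] norm_zero)
    moreover have "norm h1 \<noteq> 0" using h1 by auto
    ultimately show "c (b k) = b (c k)" by simp
  qed
  ultimately show ?thesis using vna_bicommutant_eq[OF B] by blast
qed

subsection \<open>Tensor products of vectors\<close>

text \<open>The tensor product of two amplified vectors, with the double index flattened. Its vector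
  state is the product of the vector states of \<open>\<alpha>\<close> and \<open>\<beta>\<close> on
  elementary tensors.\<close>

definition tensor_ell2 ::
    "('h::chilbert_space \<Rightarrow> 'k::chilbert_space \<Rightarrow> 'hk::chilbert_space) \<Rightarrow> 'h ell2 \<Rightarrow> 'k ell2 \<Rightarrow> 'hk ell2" where
  "tensor_ell2 t \<alpha> \<beta> = flatten (amp (\<lambda>h. amp (t h) \<beta>) \<alpha>)"

lemma bounded_clinear_tensor_amp:
  assumes t: "hilbert_tensor t"
  shows "bounded_clinear (\<lambda>h. amp (t h) \<beta>)"
proof (rule bounded_clinearI[where K = "norm \<beta>"])
  have tb: "bounded_clinear (t h)" for h by (rule bounded_clinear_tensor_right[OF t])
  show "clinear (\<lambda>h. amp (t h) \<beta>)"
    by (rule clinearI; rule ell2_eqI)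
      (simp_all add: coord_amp[OF tb] clinear_add[OF hilbert_tensorD(1)[OF t]] clinear_scaleC[OF hilbert_tensorD(1)[OF t]])
  show "norm (amp (t h) \<beta>) \<le> norm \<beta> * norm h" for h
    using norm_amp_le[OF tb, of "norm h" h \<beta>] by (simp add: norm_tensor[OF t] mult.commute)
qed

lemma coord_tensor_ell2:
  assumes t: "hilbert_tensor t"
  shows "coord (tensor_ell2 t \<alpha> \<beta>) m = t (coord \<alpha> (fst (prod_decode m))) (coord \<beta> (snd (prod_decode m)))"
  by (simp add: tensor_ell2_def coord_flatten coord_amp[OF bounded_clinear_tensor_amp[OF t]]
      coord_amp[OF bounded_clinear_tensor_right[OF t]])

lemma cinner_tensor_ell2:
  assumes t: "hilbert_tensor t"
  shows "cinner (tensor_ell2 t \<alpha> \<beta>) (tensor_ell2 t \<alpha>' \<beta>') = cinner \<alpha> \<alpha>' * cinner \<beta> \<beta>'"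
proof -
  have tb: "bounded_clinear (t h)" for h by (rule bounded_clinear_tensor_right[OF t])
  have inner: "cinner (amp (t h) \<beta>) (amp (t h') \<beta>') = cinner h h' * cinner \<beta> \<beta>'" for h h'
  proof (rule sums_unique2[OF cinner_ell2_sums])
    show "(\<lambda>n. cinner (coord (amp (t h) \<beta>) n) (coord (amp (t h') \<beta>') n)) sums (cinner h h' * cinner \<beta> \<beta>')"
      unfolding coord_amp[OF tb] hilbert_tensorD(3)[OF t] by (intro sums_mult cinner_ell2_sums)
  qed
  have tb': "bounded_clinear (\<lambda>h. amp (t h) \<beta>)" for \<beta> by (rule bounded_clinear_tensor_amp[OF t])
  show ?thesis
    unfolding tensor_ell2_def cinner_flatten
  proof (rule sums_unique2[OF cinner_ell2_sums])
    show "(\<lambda>n. cinner (coord (amp (\<lambda>h. amp (t h) \<beta>) \<alpha>) n) (coord (amp (\<lambda>h. amp (t h) \<beta>') \<alpha>') n)) sums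
        (cinner \<alpha> \<alpha>' * cinner \<beta> \<beta>')"
      unfolding coord_amp[OF tb'] inner by (intro sums_mult2 cinner_ell2_sums)
  qed
qed

lemma amp_tensor_op:
  assumes t: "hilbert_tensor t" and a: "a \<in> bounded_ops" and b: "b \<in> bounded_ops"
  shows "amp (tensor_op t a b) (tensor_ell2 t \<alpha> \<beta>) = tensor_ell2 t (amp a \<alpha>) (amp b \<beta>)"
  by (rule ell2_eqI)
    (simp add: coord_amp_op[OF tensor_op_bounded[OF assms]] coord_tensor_ell2[OF t]
      tensor_op_apply[OF assms] coord_amp_op[OF a] coord_amp_op[OF b])

section \<open>Hilbert sums\<close>

lemma hilbert_sumD:
  assumes "hilbert_sum I V"
  shows "i \<in> I \<Longrightarrow> clinear (V i)"
    and "i \<in> I \<Longrightarrow> j \<in> I \<Longrightarrow> cinner (V i \<xi>) (V j \<eta>) = (if i = j then cinner \<xi> \<eta> else 0)"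
    and "dense_span {V i \<xi> | i \<xi>. i \<in> I}"
  using assms by (auto simp: hilbert_sum_def)

lemma norm_hilbert_sum: "hilbert_sum I V \<Longrightarrow> i \<in> I \<Longrightarrow> norm (V i \<xi>) = norm \<xi>"
  by (rule norm_eqI_cinner) (simp add: hilbert_sumD(2))

lemma bounded_clinear_hilbert_sum: "hilbert_sum I V \<Longrightarrow> i \<in> I \<Longrightarrow> bounded_clinear (V i)"
  by (rule bounded_clinearI[where K = 1]) (simp_all add: hilbert_sumD norm_hilbert_sum)

lemma hilbert_sum_op_eq:
  assumes "hilbert_sum I V" "bounded_clinear T" "bounded_clinear T'"
    "\<And>i \<xi>. i \<in> I \<Longrightarrow> T (V i \<xi>) = T' (V i \<xi>)"
  shows "T = T'"
  by (rule bounded_clinear_eq_dense_span[OF assms(2,3) hilbert_sumD(3)[OF assms(1)]]) (use assms(4) in blast)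

lemma cadj_hilbert_sum:
  assumes "hilbert_sum I V" "i \<in> I" "j \<in> I"
  shows "cadj (V i) (V j \<xi>) = (if i = j then \<xi> else 0)"
proof (rule cinner_eqI)
  fix z
  show "cinner (cadj (V i) (V j \<xi>)) z = cinner (if i = j then \<xi> else 0) z"
    unfolding cadj_left[OF bounded_clinear_hilbert_sum[OF assms(1,2)]] hilbert_sumD(2)[OF assms(1,3,2)] by auto
qed

lemma hilbert_sum_eqI:
  assumes V: "hilbert_sum I V" and eq: "\<And>i. i \<in> I \<Longrightarrow> cadj (V i) u = cadj (V i) v"
  shows "u = v"
proof (rule dense_span_eqI[OF hilbert_sumD(3)[OF V]])
  fix s assume "s \<in> {V i \<xi> |i \<xi>. i \<in> I}"
  then obtain i \<xi> where i: "i \<in> I" "s = V i \<xi>" by blast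
  have "cinner (cadj (V i) u) \<xi> = cinner (cadj (V i) v) \<xi>" by (simp add: eq[OF i(1)])
  then show "cinner u s = cinner v s"
    by (simp add: i(2) cadj_left[OF bounded_clinear_hilbert_sum[OF V i(1)]])
qed

lemma norm_sum_hilbert_sum:
  assumes V: "hilbert_sum I V" and F: "finite F" and f: "inj_on f F" "f ` F \<subseteq> I"
  shows "(norm (\<Sum>i\<in>F. V (f i) (x i)))\<^sup>2 = (\<Sum>i\<in>F. (norm (x i))\<^sup>2)"
proof -
  have *: "cinner (V (f i) (x i)) (V (f j) (x j)) = (if j = i then complex_of_real ((norm (x i))\<^sup>2) else 0)"
    if "i \<in> F" "j \<in> F" for i j
  proof -
    have "f i \<in> I" "f j \<in> I" using that f(2) by auto
    then show ?thesis
      using hilbert_sumD(2)[OF V, of "f i" "f j" "x i" "x j"] inj_on_eq_iff[OF f(1) that]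
      by (simp add: cinner_self eq_commute[of j i])
  qed
  have "complex_of_real ((norm (\<Sum>i\<in>F. V (f i) (x i)))\<^sup>2)
      = (\<Sum>j\<in>F. \<Sum>i\<in>F. cinner (V (f i) (x i)) (V (f j) (x j)))"
    unfolding cinner_self[symmetric] cinner_sum_left cinner_sum_right ..
  also have "\<dots> = (\<Sum>j\<in>F. \<Sum>i\<in>F. if j = i then complex_of_real ((norm (x i))\<^sup>2) else 0)"
    by (intro sum.cong refl *)
  also have "\<dots> = complex_of_real (\<Sum>i\<in>F. (norm (x i))\<^sup>2)"
    using F by simp
  finally show ?thesis using of_real_eq_iff by blast
qed

text \<open>Covers both kinds of generators of a crossed product: \<open>f = id\<close> gives the
  diagonal operators \<open>\<pi> x\<close>, and identity blocks with a translation \<open>f\<close>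
  give the unitaries \<open>u h\<close>. Injectivity of \<open>f\<close> keeps the image blocks
  orthogonal.\<close>

lemma hilbert_sum_block_operator:
  fixes V :: "'i \<Rightarrow> 'h::chilbert_space \<Rightarrow> 'k::chilbert_space"
  assumes V: "hilbert_sum I V" and f: "inj_on f I" "f ` I \<subseteq> I" and K: "0 \<le> K"
    and T: "\<And>i. i \<in> I \<Longrightarrow> clinear (T i)" "\<And>i \<xi>. i \<in> I \<Longrightarrow> norm (T i \<xi>) \<le> K * norm \<xi>"
  shows "\<exists>S\<in>bounded_ops. \<forall>i\<in>I. \<forall>\<xi>. S (V i \<xi>) = V (f i) (T i \<xi>)"
proof -
  define v1 where "v1 F x = (\<Sum>i\<in>F. V i (x i))" for F x
  define v2 where "v2 F x = (\<Sum>i\<in>F. V (f i) (T i (x i)))" for F x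
  \<comment> \<open>Padding by 0 outside \<open>F\<close> allows two finitely supported vectors to
    be rewritten over a common index set before they are added.\<close>
  define adm where "adm F x \<longleftrightarrow> finite F \<and> F \<subseteq> I \<and> (\<forall>i. i \<notin> F \<longrightarrow> x i = 0)"
    for F and x :: "'i \<Rightarrow> 'h"
  define R where "R = {(v1 F x, v2 F x) | F x. adm F x}"
  have R_I: "(v1 F x, v2 F x) \<in> R" if "adm F x" for F x using that unfolding R_def by blast
  have fI: "f i \<in> I" if "i \<in> I" for i using f(2) that by blast
  note lin1 = hilbert_sumD(1)[OF V] and lin2 = hilbert_sumD(1)[OF V fI]
  have enlarge: "v1 F' x = v1 F x" "v2 F' x = v2 F x" if "adm F x" "finite F'" "F \<subseteq> F'" "F' \<subseteq> I" for F F' x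
  proof -
    have z: "\<forall>i\<in>F' - F. x i = 0" using that by (auto simp: adm_def)
    have "V i (x i) = 0" if "i \<in> F' - F" for i
      using that z \<open>F' \<subseteq> I\<close> clinear_zero[OF lin1] by auto
    then show "v1 F' x = v1 F x"
      unfolding v1_def by (intro sum.mono_neutral_right) (use that in auto)
    have "V (f i) (T i (x i)) = 0" if "i \<in> F' - F" for i
      using that z \<open>F' \<subseteq> I\<close> clinear_zero[OF T(1)] clinear_zero[OF lin2] by auto
    then show "v2 F' x = v2 F x"
      unfolding v2_def by (intro sum.mono_neutral_right) (use that in auto)
  qed
  obtain S where S: "bounded_clinear S" "\<And>v w. (v, w) \<in> R \<Longrightarrow> S v = w"
  proof (rule extend_bounded_relation[of R K])
    have "(0, 0) = (v1 {} (\<lambda>_. 0), v2 {} (\<lambda>_. 0))" "adm {} (\<lambda>_. 0)" by (auto simp: v1_def v2_def adm_def)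
    then show "(0, 0) \<in> R" using R_I by metis
    show "(v + v', w + w') \<in> R" if vw: "(v, w) \<in> R" "(v', w') \<in> R" for v w v' w'
    proof -
      obtain F x where a: "adm F x" "v = v1 F x" "w = v2 F x" using vw unfolding R_def by blast
      obtain F' x' where a': "adm F' x'" "v' = v1 F' x'" "w' = v2 F' x'" using vw unfolding R_def by blast
      define E where "E = F \<union> F'"
      have E: "finite E" "F \<subseteq> E" "F' \<subseteq> E" "E \<subseteq> I" using a(1) a'(1) by (auto simp: E_def adm_def)
      have "adm E (\<lambda>i. x i + x' i)" using a(1) a'(1) by (auto simp: E_def adm_def)
      moreover have "v1 E (\<lambda>i. x i + x' i) = v + v'"
      proof -
        have "v1 E (\<lambda>i. x i + x' i) = (\<Sum>i\<in>E. V i (x i) + V i (x' i))"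
          unfolding v1_def using E(4) by (intro sum.cong refl clinear_add lin1) auto
        then show ?thesis
          using enlarge(1)[OF a(1) E(1,2,4)] enlarge(1)[OF a'(1) E(1,3,4)]
          unfolding a(2) a'(2) by (simp add: sum.distrib v1_def)
      qed
      moreover have "v2 E (\<lambda>i. x i + x' i) = w + w'"
      proof -
        have "v2 E (\<lambda>i. x i + x' i) = (\<Sum>i\<in>E. V (f i) (T i (x i)) + V (f i) (T i (x' i)))"
          unfolding v2_def using E(4) by (intro sum.cong refl) (auto simp: clinear_add[OF T(1)] clinear_add[OF lin2])
        then show ?thesis
          using enlarge(2)[OF a(1) E(1,2,4)] enlarge(2)[OF a'(1) E(1,3,4)]
          unfolding a(3) a'(3) by (simp add: sum.distrib v2_def)
      qed
      ultimately show ?thesis using R_I[of E "\<lambda>i. x i + x' i"] by simp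
    qed
    show "(c *\<^sub>C v, c *\<^sub>C w) \<in> R" if vw: "(v, w) \<in> R" for c v w
    proof -
      obtain F x where a: "adm F x" "v = v1 F x" "w = v2 F x" using vw unfolding R_def by blast
      have FI: "F \<subseteq> I" using a(1) by (simp add: adm_def)
      have "adm F (\<lambda>i. c *\<^sub>C x i)" using a(1) by (simp add: adm_def)
      moreover have "v1 F (\<lambda>i. c *\<^sub>C x i) = c *\<^sub>C v"
        unfolding a(2) v1_def complex_vector.scale_sum_right
        using FI by (intro sum.cong refl clinear_scaleC lin1) auto
      moreover have "v2 F (\<lambda>i. c *\<^sub>C x i) = c *\<^sub>C w"
        unfolding a(3) v2_def complex_vector.scale_sum_right
        using FI by (intro sum.cong refl) (auto simp: clinear_scaleC[OF T(1)] clinear_scaleC[OF lin2])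
      ultimately show ?thesis using R_I[of F "\<lambda>i. c *\<^sub>C x i"] by simp
    qed
    show "norm w \<le> K * norm v" if vw: "(v, w) \<in> R" for v w
    proof -
      obtain F x where a: "adm F x" "v = v1 F x" "w = v2 F x" using vw unfolding R_def by blast
      have F: "finite F" "F \<subseteq> I" using a(1) by (auto simp: adm_def)
      have nv: "(norm v)\<^sup>2 = (\<Sum>i\<in>F. (norm (x i))\<^sup>2)"
        unfolding a(2) v1_def using norm_sum_hilbert_sum[OF V F(1), of id x] F(2) by simp
      have nw: "(norm w)\<^sup>2 = (\<Sum>i\<in>F. (norm (T i (x i)))\<^sup>2)"
        unfolding a(3) v2_def
        using norm_sum_hilbert_sum[OF V F(1) inj_on_subset[OF f(1) F(2)], of "\<lambda>i. T i (x i)"] F(2) f(2) by auto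
      have "(norm w)\<^sup>2 \<le> (\<Sum>i\<in>F. K\<^sup>2 * (norm (x i))\<^sup>2)"
        unfolding nw
      proof (rule sum_mono)
        fix i assume "i \<in> F"
        then have "norm (T i (x i)) \<le> K * norm (x i)" using F(2) T(2) by blast
        from power_mono[OF this, of 2] show "(norm (T i (x i)))\<^sup>2 \<le> K\<^sup>2 * (norm (x i))\<^sup>2"
          by (simp add: power_mult_distrib)
      qed
      also have "\<dots> = (K * norm v)\<^sup>2"
        unfolding power_mult_distrib nv by (simp add: sum_distrib_left)
      finally show ?thesis by (rule power2_le_imp_le) (use K in simp)
    qed
  qed (use K that in auto)
  have "S (V i \<xi>) = V (f i) (T i \<xi>)" if i: "i \<in> I" for i \<xi>
  proof (rule S(2))
    define x where "x j = (if j = i then \<xi> else 0)" for j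
    have "adm {i} x" "v1 {i} x = V i \<xi>" "v2 {i} x = V (f i) (T i \<xi>)"
      using i by (simp_all add: adm_def v1_def v2_def x_def)
    then show "(V i \<xi>, V (f i) (T i \<xi>)) \<in> R" using R_I[of "{i}" x] by simp
  qed
  then show ?thesis using S(1) by (intro bexI[of _ S]) (simp_all add: bounded_ops_iff)
qed

text \<open>Bessel's inequality for orthogonal isometries. They are abstract because the application
  is to the amplified maps \<open>amp (V k)\<close>.\<close>

lemma finite_large_coefficients:
  assumes V: "\<And>i. i \<in> I \<Longrightarrow> bounded_clinear (W i)"
    and ortho: "\<And>i j v w. i \<in> I \<Longrightarrow> j \<in> I \<Longrightarrow> cinner (W i v) (W j w) = (if i = j then cinner v w else 0)"
    and d: "0 < d"
  shows "finite {i \<in> I. d \<le> norm (cadj (W i) v)}"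
proof (rule ccontr)
  let ?J = "{i \<in> I. d \<le> norm (cadj (W i) v)}"
  assume "infinite ?J"
  obtain n where n: "(norm v)\<^sup>2 / d\<^sup>2 < real n" using reals_Archimedean2 by blast
  obtain F where F: "finite F" "F \<subseteq> ?J" "card F = n"
    using infinite_arbitrarily_large[OF \<open>infinite ?J\<close>] by blast
  \<comment> \<open>The projection of \<open>v\<close> onto the chosen blocks; its squared norm
    \<open>b\<close> is at most that of \<open>v\<close>, but at least \<open>n\<close> times the
    square of \<open>d\<close>.\<close>
  define s where "s = (\<Sum>i\<in>F. W i (cadj (W i) v))"
  have FI: "i \<in> I" "d \<le> norm (cadj (W i) v)" if "i \<in> F" for i using F(2) that by auto
  define b where "b = (\<Sum>i\<in>F. (norm (cadj (W i) v))\<^sup>2)"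
  have vs: "cinner v s = complex_of_real b"
    unfolding s_def b_def cinner_sum_right of_real_sum
    by (intro sum.cong refl) (simp add: cadj_left[OF V[OF FI(1)], symmetric] cinner_self)
  have "cinner s s = (\<Sum>j\<in>F. \<Sum>i\<in>F. if j = i then complex_of_real ((norm (cadj (W i) v))\<^sup>2) else 0)"
    unfolding s_def cinner_sum_left cinner_sum_right
    by (intro sum.cong refl) (auto simp: ortho[OF FI(1) FI(1)] cinner_self)
  then have ss: "cinner s s = complex_of_real b" using F(1) by (simp add: b_def)
  have "cinner (v - s) (v - s) = cinner v v - complex_of_real b"
    using vs ss cinner_commute[of s v] by (simp add: cinner_simps)
  then have "(norm (v - s))\<^sup>2 = (norm v)\<^sup>2 - b"
    unfolding cinner_self of_real_diff[symmetric] of_real_eq_iff .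
  then have "b \<le> (norm v)\<^sup>2" by (metis diff_ge_0_iff_ge zero_le_power2)
  moreover have "real n * d\<^sup>2 \<le> b"
  proof -
    have "(\<Sum>i\<in>F. d\<^sup>2) \<le> b"
      unfolding b_def using FI(2) d by (intro sum_mono power_mono) auto
    then show ?thesis using F(3) by simp
  qed
  ultimately show False using n d by (simp add: field_simps)
qed

section \<open>Trace vectors of bicommutants\<close>

text \<open>One argument at a time: in the form \<open>cinner (x \<Omega>) (adj y \<Omega>)\<close>
  both sides of the trace identity are vector functionals of \<open>x\<close>, and such an identity
  extends from \<open>S\<close> to its bicommutant.\<close>

lemma tracial_vector_bicommutant:
  assumes S: "star_algebra S" and tr: "tracial_vector S \<Omega>"
  shows "tracial_vector (commutant (commutant S)) \<Omega>"
proof -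
  have S'': "x \<in> bounded_ops" if "x \<in> commutant (commutant S)" for x using that commutant_bounded by blast
  have weak: "cinner (x v) w = cinner (x v') w'"
    if x: "x \<in> commutant (commutant S)" and eq: "\<And>s. s \<in> S \<Longrightarrow> cinner (s v) w = cinner (s v') w'" for x v w v' w'
  proof -
    have s: "cinner (amp s (ell2_single 0 v)) (ell2_single 0 w) = cinner (s v) w" if "s \<in> bounded_ops" for s v w
      using that by (simp add: amp_single bounded_ops_iff cinner_single_right coord_single)
    have "cinner (amp x (ell2_single 0 v)) (ell2_single 0 w) = cinner (amp x (ell2_single 0 v')) (ell2_single 0 w')"
      by (rule bicommutant_ultraweak[OF S x]) (simp add: s star_algebraD(3)[OF S] eq)
    then show ?thesis by (simp add: s S''[OF x])
  qed
  have 1: "cinner (x (y \<Omega>)) \<Omega> = cinner (y (x \<Omega>)) \<Omega>" if x: "x \<in> commutant (commutant S)" and y: "y \<in> S" for x y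
  proof -
    have yb: "y \<in> bounded_ops" by (rule star_algebraD(3)[OF S y])
    have "cinner (x (y \<Omega>)) \<Omega> = cinner (x \<Omega>) (adj y \<Omega>)"
    proof (rule weak[OF x])
      show "cinner (s (y \<Omega>)) \<Omega> = cinner (s \<Omega>) (adj y \<Omega>)" if "s \<in> S" for s
        using tr that y by (simp add: tracial_vector_def adj_right[OF yb])
    qed
    then show ?thesis by (simp add: adj_right[OF yb])
  qed
  have "cinner (x (y \<Omega>)) \<Omega> = cinner (y (x \<Omega>)) \<Omega>"
    if x: "x \<in> commutant (commutant S)" and y: "y \<in> commutant (commutant S)" for x y
  proof -
    have yb: "y \<in> bounded_ops" by (rule S''[OF y])
    have "cinner (x (y \<Omega>)) \<Omega> = cinner (x \<Omega>) (adj y \<Omega>)"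
    proof (rule weak[OF x])
      show "cinner (s (y \<Omega>)) \<Omega> = cinner (s \<Omega>) (adj y \<Omega>)" if "s \<in> S" for s
        using 1[OF y that] by (simp add: adj_right[OF yb])
    qed
    then show ?thesis by (simp add: adj_right[OF yb])
  qed
  then show ?thesis by (simp add: tracial_vector_def)
qed

lemma tracial_vector_antimono: "tracial_vector S \<Omega> \<Longrightarrow> T \<subseteq> S \<Longrightarrow> tracial_vector T \<Omega>"
  by (auto simp: tracial_vector_def)

lemma tracial_vector_lspan:
  assumes S: "S \<subseteq> bounded_ops" and tr: "tracial_vector (amp ` S) \<Omega>"
  shows "tracial_vector (amp ` lspan S) \<Omega>"
proof -
  have b: "x \<in> bounded_ops" if "x \<in> lspan S" for x
    using that by induction (use S in auto)
  have 1: "cinner (amp x (amp y \<Omega>)) \<Omega> = cinner (amp y (amp x \<Omega>)) \<Omega>" if "x \<in> lspan S" "y \<in> S" for x y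
    using that(1)
  proof induction
    case (base x)
    then show ?case using tr that(2) by (simp add: tracial_vector_def)
  next
    case (plus x x')
    have y: "amp y \<in> bounded_ops" using that(2) S amp_bounded_ops by blast
    show ?case
      using plus by (simp add: amp_op_plus b ops_simps[OF y] cinner_simps)
  next
    case (scaleC x c)
    have y: "amp y \<in> bounded_ops" using that(2) S amp_bounded_ops by blast
    show ?case
      using scaleC by (simp add: amp_op_scaleC b ops_simps[OF y] cinner_simps)
  qed
  have "cinner (amp x (amp y \<Omega>)) \<Omega> = cinner (amp y (amp x \<Omega>)) \<Omega>" if "y \<in> lspan S" and x: "x \<in> lspan S" for x y
    using that(1)
  proof induction
    case (base y)
    then show ?case using 1[OF x] by simp
  next
    case (plus y y')
    show ?case
      using plus by (simp add: amp_op_plus b ops_simps[OF amp_bounded_ops[OF b[OF x]]] cinner_simps)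
  next
    case (scaleC y c)
    show ?case
      using scaleC by (simp add: amp_op_scaleC b ops_simps[OF amp_bounded_ops[OF b[OF x]]] cinner_simps)
  qed
  then show ?thesis by (simp add: tracial_vector_def)
qed

lemma tracial_vector_amp_bicommutant:
  assumes S: "star_algebra S" and tr: "tracial_vector (amp ` S) \<Omega>"
  shows "tracial_vector (amp ` commutant (commutant S)) \<Omega>"
proof (rule tracial_vector_antimono[OF tracial_vector_bicommutant[OF star_algebra_amp[OF S] tr]])
  show "amp ` commutant (commutant S) \<subseteq> commutant (commutant (amp ` S))"
    using amp_bicommutant[OF star_algebraD(1)[OF S]] by blast
qed

section \<open>Crossed products\<close>

locale crossed_system =
  fixes G :: "('g, 's) monoid_scheme" (structure)
    and M :: "('h::chilbert_space \<Rightarrow> 'h) set"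
    and \<theta> :: "'g \<Rightarrow> ('h \<Rightarrow> 'h) \<Rightarrow> ('h \<Rightarrow> 'h)"
    and V :: "'g \<Rightarrow> 'h \<Rightarrow> 'k::chilbert_space"
  assumes grp: "group G" and vM: "von_neumann_algebra M"
    and action: "normal_action G M \<theta>" and sumV: "hilbert_sum (carrier G) V"
begin

sublocale group G by (rule grp)

abbreviation "\<pi> \<equiv> crossed_embed G V \<theta>"
abbreviation "u \<equiv> crossed_unitary G V"

lemmas SM = star_algebraD[OF vna_star_algebra[OF vM]]
lemmas V_bcl = bounded_clinear_hilbert_sum[OF sumV]
lemmas V_inner = hilbert_sumD(2)[OF sumV]
lemmas V_cadj = cadj_hilbert_sum[OF sumV]

lemma automorphism: "g \<in> carrier G \<Longrightarrow> star_automorphism M (\<theta> g)"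
  using action by (simp add: normal_action_def vna_action_def)

lemmas \<theta>_simps = star_automorphismD[OF automorphism]

lemma \<theta>_id: "g \<in> carrier G \<Longrightarrow> \<theta> g id = id"
  by (rule star_automorphism_id[OF automorphism SM(2)])

lemma \<theta>_one: "x \<in> M \<Longrightarrow> \<theta> \<one> x = x"
  using action by (simp add: normal_action_def vna_action_def)

lemma \<theta>_mult: "g \<in> carrier G \<Longrightarrow> h \<in> carrier G \<Longrightarrow> x \<in> M \<Longrightarrow> \<theta> (g \<otimes> h) x = \<theta> g (\<theta> h x)"
  using action by (simp add: normal_action_def vna_action_def)

lemma \<theta>_inv: "g \<in> carrier G \<Longrightarrow> x \<in> M \<Longrightarrow> \<theta> g (\<theta> (inv g) x) = x" "g \<in> carrier G \<Longrightarrow> x \<in> M \<Longrightarrow> \<theta> (inv g) (\<theta> g x) = x"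
  using \<theta>_mult[of g "inv g" x] \<theta>_mult[of "inv g" g x] by (simp_all add: \<theta>_one)

lemma \<theta>_zero: "g \<in> carrier G \<Longrightarrow> \<theta> g (\<lambda>_. 0) = (\<lambda>_. 0)"
  using \<theta>_simps(3)[of g id 0] SM(2) by simp

lemma \<theta>_normal: "g \<in> carrier G \<Longrightarrow> ultraweak_functional M \<phi> \<Longrightarrow> ultraweak_functional M (\<phi> \<circ> \<theta> g)"
  using action by (simp add: normal_action_def)

lemma \<theta>_norm_le:
  "g \<in> carrier G \<Longrightarrow> x \<in> M \<Longrightarrow> 0 < K \<Longrightarrow> (\<And>v. norm (x v) \<le> K * norm v) \<Longrightarrow> norm (\<theta> g x v) \<le> K * norm v"
  by (rule normal_automorphism_norm_le[OF vM automorphism \<theta>_normal])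

lemma \<theta>_ultraweak:
  assumes "g \<in> carrier G"
  obtains \<alpha> \<beta> where "\<And>x. x \<in> M \<Longrightarrow> cinner (amp (\<theta> g x) v) w = cinner (amp x \<alpha>) \<beta>"
proof -
  have "ultraweak_functional M (\<lambda>x. cinner (amp x v) w)"
    unfolding ultraweak_functional_iff[OF SM(1)] by blast
  from \<theta>_normal[OF assms this] show ?thesis
    unfolding ultraweak_functional_iff[OF SM(1)] comp_def using that by blast
qed

lemma \<pi>_props:
  assumes x: "x \<in> M"
  shows "\<pi> x \<in> bounded_ops \<and> (\<forall>g\<in>carrier G. \<forall>\<xi>. \<pi> x (V g \<xi>) = V g (\<theta> (inv g) x \<xi>))"
proof -
  obtain K where K: "0 < K" "\<And>v. norm (x v) \<le> K * norm v"
    using bounded_clinear_bound SM(3)[OF x] by (auto simp: bounded_ops_iff)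
  have "\<exists>S\<in>bounded_ops. \<forall>g\<in>carrier G. \<forall>\<xi>. S (V g \<xi>) = V (id g) (\<theta> (inv g) x \<xi>)"
  \<comment> \<open>One bound \<open>K\<close> of \<open>x\<close> serves for all blocks, because
    \<open>\<theta>_norm_le\<close> holds uniformly in the group element.\<close>
  proof (rule hilbert_sum_block_operator[OF sumV, where K = K])
    show "clinear (\<theta> (inv g) x)" if "g \<in> carrier G" for g
      using that x by (intro bounded_ops_clinear SM(3) \<theta>_simps(1)) auto
    show "norm (\<theta> (inv g) x \<xi>) \<le> K * norm \<xi>" if "g \<in> carrier G" for g \<xi>
      by (rule \<theta>_norm_le[OF _ x K]) (use that in simp)
  qed (use K in auto)
  then obtain S where S: "S \<in> bounded_ops" "\<forall>g\<in>carrier G. \<forall>\<xi>. S (V g \<xi>) = V g (\<theta> (inv g) x \<xi>)" by auto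
  have "\<pi> x = S"
    unfolding crossed_embed_def
  proof (rule the_equality)
    show "T = S" if "T \<in> bounded_ops \<and> (\<forall>g\<in>carrier G. \<forall>\<xi>. T (V g \<xi>) = V g (\<theta> (inv g) x \<xi>))" for T
      by (rule hilbert_sum_op_eq[OF sumV]) (use that S in \<open>auto simp: bounded_ops_iff\<close>)
  qed (use S in blast)
  then show ?thesis using S by simp
qed

lemma \<pi>_bounded: "x \<in> M \<Longrightarrow> \<pi> x \<in> bounded_ops"
  and \<pi>_apply: "x \<in> M \<Longrightarrow> g \<in> carrier G \<Longrightarrow> \<pi> x (V g \<xi>) = V g (\<theta> (inv g) x \<xi>)"
  using \<pi>_props by blast+

lemma u_props:
  assumes h: "h \<in> carrier G"
  shows "u h \<in> bounded_ops \<and> (\<forall>g\<in>carrier G. \<forall>\<xi>. u h (V g \<xi>) = V (h \<otimes> g) \<xi>)"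
proof -
  have "\<exists>S\<in>bounded_ops. \<forall>g\<in>carrier G. \<forall>\<xi>. S (V g \<xi>) = V (h \<otimes> g) (id \<xi>)"
  proof (rule hilbert_sum_block_operator[OF sumV, where K = 1])
    show "inj_on (\<lambda>g. h \<otimes> g) (carrier G)" by (rule inj_on_cmult[OF h])
    show "(\<lambda>g. h \<otimes> g) ` carrier G \<subseteq> carrier G" using h by auto
  qed (auto intro: clinearI)
  then obtain S where S: "S \<in> bounded_ops" "\<forall>g\<in>carrier G. \<forall>\<xi>. S (V g \<xi>) = V (h \<otimes> g) \<xi>" by auto
  have "u h = S"
    unfolding crossed_unitary_def
  proof (rule the_equality)
    show "T = S" if "T \<in> bounded_ops \<and> (\<forall>g\<in>carrier G. \<forall>\<xi>. T (V g \<xi>) = V (h \<otimes> g) \<xi>)" for T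
      by (rule hilbert_sum_op_eq[OF sumV]) (use that S in \<open>auto simp: bounded_ops_iff\<close>)
  qed (use S in blast)
  then show ?thesis using S by simp
qed

lemma u_bounded: "h \<in> carrier G \<Longrightarrow> u h \<in> bounded_ops"
  and u_apply: "h \<in> carrier G \<Longrightarrow> g \<in> carrier G \<Longrightarrow> u h (V g \<xi>) = V (h \<otimes> g) \<xi>"
  using u_props by blast+

lemma op_eqI:
  "T \<in> bounded_ops \<Longrightarrow> T' \<in> bounded_ops \<Longrightarrow> (\<And>g \<xi>. g \<in> carrier G \<Longrightarrow> T (V g \<xi>) = T' (V g \<xi>)) \<Longrightarrow> T = T'"
  by (rule hilbert_sum_op_eq[OF sumV]) (auto simp: bounded_ops_iff)

lemma \<pi>_comp: "x \<in> M \<Longrightarrow> y \<in> M \<Longrightarrow> \<pi> x \<circ> \<pi> y = \<pi> (x \<circ> y)"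
  by (rule op_eqI) (auto simp: \<pi>_bounded \<pi>_apply \<theta>_simps SM(4))

lemma \<pi>_id: "\<pi> id = id"
  by (rule op_eqI) (auto simp: \<pi>_bounded \<pi>_apply \<theta>_id SM(2))

lemma u_comp: "g \<in> carrier G \<Longrightarrow> h \<in> carrier G \<Longrightarrow> u g \<circ> u h = u (g \<otimes> h)"
  by (rule op_eqI) (auto simp: u_bounded u_apply m_assoc)

lemma u_one: "u \<one> = id"
  by (rule op_eqI) (auto simp: u_bounded u_apply)

lemma \<pi>_u: 
  assumes "g \<in> carrier G" "x \<in> M"
  shows "\<pi> x \<circ> u g = u g \<circ> \<pi> (\<theta> (inv g) x)"
proof (rule op_eqI)
  fix h \<xi> assume h: "h \<in> carrier G"
  have "\<theta> (inv (g \<otimes> h)) x = \<theta> (inv h) (\<theta> (inv g) x)"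
    using assms h by (simp add: inv_mult_group \<theta>_mult)
  then show "(\<pi> x \<circ> u g) (V h \<xi>) = (u g \<circ> \<pi> (\<theta> (inv g) x)) (V h \<xi>)"
    using assms h by (simp add: u_apply \<pi>_apply \<theta>_simps(1))
qed (use assms in \<open>auto simp: \<pi>_bounded u_bounded \<theta>_simps(1)\<close>)

lemma \<pi>_adj:
  assumes "x \<in> M"
  shows "adj (\<pi> x) = \<pi> (adj x)"
proof (rule op_eqI)
  fix g \<xi> assume g: "g \<in> carrier G"
  show "adj (\<pi> x) (V g \<xi>) = \<pi> (adj x) (V g \<xi>)"
  proof (rule hilbert_sum_eqI[OF sumV], rule cinner_eqI)
    fix h z assume h: "h \<in> carrier G"
    have b: "\<theta> (inv h) x \<in> bounded_ops" using assms h by (intro SM(3) \<theta>_simps(1)) auto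
    show "cinner (cadj (V h) (adj (\<pi> x) (V g \<xi>))) z = cinner (cadj (V h) (\<pi> (adj x) (V g \<xi>))) z"
      using assms g h
      by (simp add: cadj_left[OF V_bcl] adj_left[OF \<pi>_bounded] \<pi>_apply SM(7) V_inner \<theta>_simps(5) adj_left[OF b])
  qed
qed (use assms in \<open>auto simp: \<pi>_bounded SM(7) intro: adj_bounded\<close>)

lemma u_adj:
  assumes "g \<in> carrier G"
  shows "adj (u g) = u (inv g)"
proof (rule op_eqI)
  fix k \<xi> assume k: "k \<in> carrier G"
  show "adj (u g) (V k \<xi>) = u (inv g) (V k \<xi>)"
  proof (rule hilbert_sum_eqI[OF sumV], rule cinner_eqI)
    fix h z assume h: "h \<in> carrier G"
    have "k = g \<otimes> h \<longleftrightarrow> inv g \<otimes> k = h" using assms h k by (metis inv_solve_left)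
    then show "cinner (cadj (V h) (adj (u g) (V k \<xi>))) z = cinner (cadj (V h) (u (inv g) (V k \<xi>))) z"
      using assms k h
      by (simp add: cadj_left[OF V_bcl] adj_left[OF u_bounded] u_apply V_inner)
  qed
qed (use assms in \<open>auto simp: u_bounded intro: adj_bounded\<close>)

text \<open>By the covariance relation \<open>\<pi>_u\<close> these words are closed under products
  and adjoints, so their linear span is already a star algebra.\<close>

abbreviation generators :: "('k \<Rightarrow> 'k) set" where
  "generators \<equiv> {u g \<circ> \<pi> x | g x. g \<in> carrier G \<and> x \<in> M}"

lemma generators_bounded: "generators \<subseteq> bounded_ops"
  by (auto simp: u_bounded \<pi>_bounded)

lemma generators_comp:
  assumes "g \<in> carrier G" "h \<in> carrier G" "x \<in> M" "y \<in> M"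
  shows "(u g \<circ> \<pi> x) \<circ> (u h \<circ> \<pi> y) = u (g \<otimes> h) \<circ> \<pi> (\<theta> (inv h) x \<circ> y)"
proof -
  have "(u g \<circ> \<pi> x) \<circ> (u h \<circ> \<pi> y) = u g \<circ> (\<pi> x \<circ> u h) \<circ> \<pi> y" by (simp add: comp_assoc)
  also have "\<dots> = (u g \<circ> u h) \<circ> (\<pi> (\<theta> (inv h) x) \<circ> \<pi> y)"
    unfolding \<pi>_u[OF assms(2,3)] by (simp add: comp_assoc)
  also have "\<dots> = u (g \<otimes> h) \<circ> \<pi> (\<theta> (inv h) x \<circ> y)"
    using assms by (simp add: u_comp \<pi>_comp \<theta>_simps(1))
  finally show ?thesis .
qed

lemma star_algebra_generators: "star_algebra (lspan generators)"
proof (rule star_algebra_lspan[OF generators_bounded])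
  have "id = u \<one> \<circ> \<pi> id" by (simp add: u_one \<pi>_id)
  then show "id \<in> generators" using SM(2) one_closed by blast
  fix x assume "x \<in> generators"
  then obtain g m where x: "g \<in> carrier G" "m \<in> M" "x = u g \<circ> \<pi> m" by blast
  have "adj x = \<pi> (adj m) \<circ> u (inv g)"
    using x by (simp add: adj_comp u_bounded \<pi>_bounded u_adj \<pi>_adj)
  also have "\<dots> = u (inv g) \<circ> \<pi> (\<theta> g (adj m))"
    using x \<pi>_u[of "inv g" "adj m"] by (simp add: SM(7))
  finally show "adj x \<in> generators" using x SM(7) \<theta>_simps(1) by blast
  fix y assume "y \<in> generators"
  then obtain h n where y: "h \<in> carrier G" "n \<in> M" "y = u h \<circ> \<pi> n" by blast
  have "x \<circ> y = u (g \<otimes> h) \<circ> \<pi> (\<theta> (inv h) m \<circ> n)"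
    unfolding x(3) y(3) by (rule generators_comp[OF x(1) y(1) x(2) y(2)])
  moreover have "\<theta> (inv h) m \<circ> n \<in> M" using x y by (intro SM(4) \<theta>_simps(1)) auto
  ultimately show "x \<circ> y \<in> generators" using x(1) y(1) m_closed by blast
qed

abbreviation "P \<equiv> crossed_product G V \<theta> M"

lemma P_generated: "P \<subseteq> commutant (commutant (lspan generators))"
  unfolding crossed_product_def
proof (rule vn_generated_least)
  note S = star_algebraD[OF star_algebra_generators]
  show "von_neumann_algebra (commutant (commutant (lspan generators)))"
    by (rule vna_bicommutant[OF S(1,7)])
  have "\<pi> x \<in> lspan generators" if "x \<in> M" for x
  proof (rule lspan.base)
    have "\<pi> x = u \<one> \<circ> \<pi> x" by (simp add: u_one)
    then show "\<pi> x \<in> generators" using that one_closed by blast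
  qed
  moreover have "u g \<in> lspan generators" if "g \<in> carrier G" for g
  proof (rule lspan.base)
    have "u g = u g \<circ> \<pi> id" by (simp add: \<pi>_id)
    then show "u g \<in> generators" using that SM(2) by blast
  qed
  ultimately show "\<pi> ` M \<union> u ` carrier G \<subseteq> commutant (commutant (lspan generators))"
    using bicommutant_extensive[OF S(1)] by blast
qed

lemma crossed_product_bounded: "M' \<subseteq> M \<Longrightarrow> \<pi> ` M' \<union> u ` carrier G \<subseteq> bounded_ops"
  using \<pi>_bounded u_bounded by blast

lemma vna_crossed_product: "M' \<subseteq> M \<Longrightarrow> von_neumann_algebra (crossed_product G V \<theta> M')"
  unfolding crossed_product_def by (rule vna_vn_generated[OF crossed_product_bounded])

lemma crossed_product_\<pi>: "x \<in> M' \<Longrightarrow> \<pi> x \<in> crossed_product G V \<theta> M'"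
  and crossed_product_u: "g \<in> carrier G \<Longrightarrow> u g \<in> crossed_product G V \<theta> M'"
  unfolding crossed_product_def by (rule subsetD[OF vn_generated_subset]; simp)+

lemmas SP = star_algebraD[OF vna_star_algebra[OF vna_crossed_product[OF subset_refl]]]

subsection \<open>Fourier coefficients\<close>

text \<open>The block of \<open>x\<close> in row \<open>h\<close> and column \<open>\<one>\<close>.
  It corresponds to the formal expansion of \<open>x\<close> as a sum of
  \<open>u h \<circ> \<pi> (coef h x)\<close>, with coefficients to the right of the
  unitaries.\<close>

definition coef :: "'g \<Rightarrow> ('k \<Rightarrow> 'k) \<Rightarrow> ('h \<Rightarrow> 'h)" where
  "coef h x = cadj (V h) \<circ> (x \<circ> V \<one>)"

lemma coef_bounded: "h \<in> carrier G \<Longrightarrow> x \<in> bounded_ops \<Longrightarrow> coef h x \<in> bounded_ops"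
  unfolding coef_def bounded_ops_iff
  by (intro bounded_clinear_comp bounded_clinear_cadj V_bcl one_closed)

lemma cinner_amp_coef:
  assumes "h \<in> carrier G" "x \<in> bounded_ops"
  shows "cinner (amp (coef h x) v) w = cinner (amp x (amp (V \<one>) v)) (amp (V h) w)"
proof -
  have b: "bounded_clinear x" "bounded_clinear (V \<one>)" "bounded_clinear (V h)"
    using assms V_bcl by (auto simp: bounded_ops_iff)
  have "amp (coef h x) v = cadj (amp (V h)) (amp x (amp (V \<one>) v))"
    unfolding coef_def using b
    by (simp add: amp_comp bounded_clinear_comp bounded_clinear_cadj cadj_amp)
  then show ?thesis by (simp add: cadj_left[OF bounded_clinear_amp[OF b(3)]])
qed

lemma cinner_coef:
  assumes "h \<in> carrier G"
  shows "cinner (coef h x v) w = cinner (x (V \<one> v)) (V h w)"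
  by (simp add: coef_def cadj_left[OF V_bcl[OF assms]])

lemma generator_shift:
  assumes "k \<in> carrier G" "m \<in> M" "g \<in> carrier G" "h \<in> carrier G"
  shows "cadj (V (h \<otimes> g)) ((u k \<circ> \<pi> m) (V g \<xi>)) = (if k = h then \<theta> (inv g) m \<xi> else 0)"
  using assms by (simp add: \<pi>_apply u_apply V_cadj eq_commute[of h k])

lemma coef_generator:
  assumes "k \<in> carrier G" "m \<in> M" "h \<in> carrier G"
  shows "coef h (u k \<circ> \<pi> m) = (if k = h then m else (\<lambda>_. 0))"
proof
  fix \<xi>
  show "coef h (u k \<circ> \<pi> m) \<xi> = (if k = h then m else (\<lambda>_. 0)) \<xi>"
    using generator_shift[OF assms(1,2) one_closed assms(3), of \<xi>] assms
    by (simp add: coef_def \<theta>_one)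
qed

lemma coef_plus:
  "h \<in> carrier G \<Longrightarrow> coef h (\<lambda>v. x v + y v) = (\<lambda>v. coef h x v + coef h y v)"
  by (simp add: coef_def fun_eq_iff clinear_add[OF bounded_clinear_clinear[OF bounded_clinear_cadj[OF V_bcl]]])

lemma coef_scaleC:
  "h \<in> carrier G \<Longrightarrow> coef h (\<lambda>v. c *\<^sub>C x v) = (\<lambda>v. c *\<^sub>C coef h x v)"
  by (simp add: coef_def fun_eq_iff clinear_scaleC[OF bounded_clinear_clinear[OF bounded_clinear_cadj[OF V_bcl]]])

lemma coef_lspan:
  assumes s: "s \<in> lspan generators" and h: "h \<in> carrier G" and g: "g \<in> carrier G"
  shows "coef h s \<in> M \<and> (\<forall>\<xi>. cadj (V (h \<otimes> g)) (s (V g \<xi>)) = \<theta> (inv g) (coef h s) \<xi>)"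
  using s
proof induction
  case (base s)
  then obtain k m where km: "k \<in> carrier G" "m \<in> M" "s = u k \<circ> \<pi> m" by blast
  have "(\<lambda>_. 0) \<in> M" by (rule star_algebra_zero[OF vna_star_algebra[OF vM]])
  then show ?case
    unfolding km(3) coef_generator[OF km(1,2) h] generator_shift[OF km(1,2) g h]
    using km(2) g by (auto simp: \<theta>_zero)
next
  case (plus x y)
  have lin: "clinear (cadj (V (h \<otimes> g)))"
    using g h by (intro bounded_clinear_clinear bounded_clinear_cadj V_bcl) auto
  show ?case
    using plus g h by (simp add: coef_plus SM(5) \<theta>_simps(2) clinear_add[OF lin])
next
  case (scaleC x c)
  have lin: "clinear (cadj (V (h \<otimes> g)))"
    using g h by (intro bounded_clinear_clinear bounded_clinear_cadj V_bcl) auto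
  show ?case
    using scaleC g h by (simp add: coef_scaleC SM(6) \<theta>_simps(3) clinear_scaleC[OF lin])
qed

text \<open>The principle for transferring identities from words to \<open>P\<close>: matrix entries
  of \<open>x\<close>, of its coefficients, and of images of coefficients under
  \<open>\<theta> g\<close> can all be written as such functionals of \<open>x\<close>.\<close>

lemma P_ultraweak:
  assumes x: "x \<in> P" and eq: "\<And>s. s \<in> lspan generators \<Longrightarrow> cinner (amp s v1) w1 = cinner (amp s v2) w2"
  shows "cinner (amp x v1) w1 = cinner (amp x v2) w2"
  by (rule bicommutant_ultraweak[OF star_algebra_generators _ eq]) (use x P_generated in blast)+

lemma cinner_amp_single:
  "x \<in> bounded_ops \<Longrightarrow> cinner (amp x (ell2_single 0 v)) (ell2_single 0 w) = cinner (x v) w"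
  by (simp add: amp_single bounded_ops_iff cinner_single_right coord_single)

text \<open>For \<open>T\<close> in the commutant of \<open>M\<close>, both
  \<open>cinner (coef h x (T v)) w\<close> and \<open>cinner (T (coef h x v)) w\<close> are vector
  functionals of \<open>x\<close>, and they agree on words, whose coefficients lie in
  \<open>M\<close>.\<close>

lemma coef_mem:
  assumes x: "x \<in> P" and h: "h \<in> carrier G"
  shows "coef h x \<in> M"
proof -
  have "coef h x \<in> commutant (commutant M)"
  proof (rule commutantI)
    show "coef h x \<in> bounded_ops" by (rule coef_bounded[OF h SP(3)[OF x]])
    fix T v assume T: "T \<in> commutant M"
    have Tb: "T \<in> bounded_ops" using T commutant_bounded by blast
    show "coef h x (T v) = T (coef h x v)"
    proof (rule cinner_eqI)
      fix w
      let ?v1 = "ell2_single 0 (V \<one> (T v))" and ?w1 = "ell2_single 0 (V h w)"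
      let ?v2 = "ell2_single 0 (V \<one> v)" and ?w2 = "ell2_single 0 (V h (adj T w))"
      have eq1: "cinner (amp s ?v1) ?w1 = cinner (coef h s (T v)) w" if "s \<in> bounded_ops" for s
        by (simp add: cinner_amp_single[OF that] cinner_coef[OF h])
      have eq2: "cinner (amp s ?v2) ?w2 = cinner (T (coef h s v)) w" if "s \<in> bounded_ops" for s
        by (simp add: cinner_amp_single[OF that] cinner_coef[OF h, symmetric] adj_right[OF Tb])
      have "cinner (amp x ?v1) ?w1 = cinner (amp x ?v2) ?w2"
      proof (rule P_ultraweak[OF x])
        fix s assume s: "s \<in> lspan generators"
        then have sb: "s \<in> bounded_ops" using star_algebraD(3)[OF star_algebra_generators] by blast
        have "coef h s \<in> M" using coef_lspan[OF s h h] by blast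
        then show "cinner (amp s ?v1) ?w1 = cinner (amp s ?v2) ?w2"
          unfolding eq1[OF sb] eq2[OF sb] using commutantD[OF T, of "coef h s" v] by simp
      qed
      then show "cinner (coef h x (T v)) w = cinner (T (coef h x v)) w"
        unfolding eq1[OF SP(3)[OF x]] eq2[OF SP(3)[OF x]] .
    qed
  qed
  then show ?thesis by (simp add: vna_bicommutant_eq[OF vM])
qed

text \<open>Normality of the action is essential: it turns the matrix entry of
  \<open>\<theta> (inv g) (coef h x)\<close> into a normal functional of \<open>coef h x\<close>,
  hence of \<open>x\<close>, so that the identity for words extends to \<open>P\<close>.\<close>

lemma coef_shift:
  assumes x: "x \<in> P" and h: "h \<in> carrier G" and g: "g \<in> carrier G"
  shows "cadj (V (h \<otimes> g)) (x (V g \<xi>)) = \<theta> (inv g) (coef h x) \<xi>"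
proof (rule cinner_eqI)
  fix \<eta>
  have hg: "h \<otimes> g \<in> carrier G" "inv g \<in> carrier G" using g h by auto
  obtain \<alpha> \<beta> where \<alpha>\<beta>:
    "\<And>y. y \<in> M \<Longrightarrow> cinner (amp (\<theta> (inv g) y) (ell2_single 0 \<xi>)) (ell2_single 0 \<eta>) = cinner (amp y \<alpha>) \<beta>"
    using \<theta>_ultraweak[OF hg(2)] by blast
  let ?v1 = "ell2_single 0 (V g \<xi>)" and ?w1 = "ell2_single 0 (V (h \<otimes> g) \<eta>)"
  let ?v2 = "amp (V \<one>) \<alpha>" and ?w2 = "amp (V h) \<beta>"
  have eq1: "cinner (amp s ?v1) ?w1 = cinner (cadj (V (h \<otimes> g)) (s (V g \<xi>))) \<eta>" if "s \<in> bounded_ops" for s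
    by (simp add: cinner_amp_single[OF that] cadj_left[OF V_bcl[OF hg(1)]])
  have eq2: "cinner (amp s ?v2) ?w2 = cinner (\<theta> (inv g) (coef h s) \<xi>) \<eta>"
    if "s \<in> bounded_ops" "coef h s \<in> M" for s
    using \<alpha>\<beta>[OF that(2)] cinner_amp_single[OF SM(3)[OF \<theta>_simps(1)[OF hg(2) that(2)]]]
    by (simp add: cinner_amp_coef[OF h that(1)])
  have "cinner (amp x ?v1) ?w1 = cinner (amp x ?v2) ?w2"
  proof (rule P_ultraweak[OF x])
    fix s assume s: "s \<in> lspan generators"
    then have sb: "s \<in> bounded_ops" using star_algebraD(3)[OF star_algebra_generators] by blast
    show "cinner (amp s ?v1) ?w1 = cinner (amp s ?v2) ?w2"
      using coef_lspan[OF s h g] eq1[OF sb] eq2[OF sb] by simp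
  qed
  then show "cinner (cadj (V (h \<otimes> g)) (x (V g \<xi>))) \<eta> = cinner (\<theta> (inv g) (coef h x) \<xi>) \<eta>"
    unfolding eq1[OF SP(3)[OF x]] eq2[OF SP(3)[OF x] coef_mem[OF x h]] .
qed

text \<open>By \<open>coef_shift\<close> the block in row \<open>k\<close> and column
  \<open>g\<close> is determined by the coefficient at \<open>k \<otimes> inv g\<close>, so the
  column at \<open>\<one>\<close> determines the operator.\<close>

lemma coef_eqI:
  assumes x: "x \<in> P" and y: "y \<in> P" and eq: "\<And>h. h \<in> carrier G \<Longrightarrow> coef h x = coef h y"
  shows "x = y"
proof (rule op_eqI[OF SP(3)[OF x] SP(3)[OF y]])
  fix g \<xi> assume g: "g \<in> carrier G"
  show "x (V g \<xi>) = y (V g \<xi>)"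
  proof (rule hilbert_sum_eqI[OF sumV])
    fix k assume k: "k \<in> carrier G"
    define h where "h = k \<otimes> inv g"
    have h: "h \<in> carrier G" "h \<otimes> g = k" using g k by (auto simp: h_def m_assoc)
    show "cadj (V k) (x (V g \<xi>)) = cadj (V k) (y (V g \<xi>))"
      using coef_shift[OF x h(1) g] coef_shift[OF y h(1) g] eq[OF h(1)] h(2) by simp
  qed
qed

lemma coef_diagonal:
  assumes x: "x \<in> P" and z: "\<And>h. h \<in> carrier G \<Longrightarrow> h \<noteq> \<one> \<Longrightarrow> coef h x = (\<lambda>_. 0)"
  shows "x = \<pi> (coef \<one> x)"
proof (rule coef_eqI[OF x])
  have m: "coef \<one> x \<in> M" by (rule coef_mem[OF x one_closed])
  then show "\<pi> (coef \<one> x) \<in> P" by (rule crossed_product_\<pi>)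
  fix h assume h: "h \<in> carrier G"
  have "coef h (\<pi> (coef \<one> x)) = coef h (u \<one> \<circ> \<pi> (coef \<one> x))" by (simp add: u_one)
  then show "coef h x = coef h (\<pi> (coef \<one> x))"
    using coef_generator[OF one_closed m h] z[OF h] by auto
qed

text \<open>The right factor moves column \<open>\<one>\<close> to column \<open>inv g\<close>, the
  left factor moves row \<open>h \<otimes> inv g\<close> to row
  \<open>g \<otimes> h \<otimes> inv g\<close>; the block found there is computed by
  \<open>coef_shift\<close>.\<close>

lemma coef_conjugate:
  assumes x: "x \<in> P" and g: "g \<in> carrier G" and h: "h \<in> carrier G"
  shows "coef (g \<otimes> h \<otimes> inv g) (u g \<circ> x \<circ> u (inv g)) = \<theta> g (coef h x)"
proof
  fix \<xi>
  have k: "g \<otimes> h \<otimes> inv g \<in> carrier G" "inv g \<in> carrier G" "h \<otimes> inv g \<in> carrier G" using g h by auto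
  have ad: "cadj (V (g \<otimes> h \<otimes> inv g)) (u g v) = cadj (V (h \<otimes> inv g)) v" for v
  proof (rule cinner_eqI)
    fix w
    have "inv g \<otimes> (g \<otimes> h \<otimes> inv g) = h \<otimes> inv g" using g h by (simp add: m_assoc[symmetric])
    then have "u (inv g) (V (g \<otimes> h \<otimes> inv g) w) = V (h \<otimes> inv g) w" using k by (simp add: u_apply)
    then show "cinner (cadj (V (g \<otimes> h \<otimes> inv g)) (u g v)) w = cinner (cadj (V (h \<otimes> inv g)) v) w"
      using adj_right[OF u_bounded[OF g], of v "V (g \<otimes> h \<otimes> inv g) w"]
      by (simp add: cadj_left[OF V_bcl] k u_adj[OF g])
  qed
  have "coef (g \<otimes> h \<otimes> inv g) (u g \<circ> x \<circ> u (inv g)) \<xi> = cadj (V (h \<otimes> inv g)) (x (V (inv g) \<xi>))"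
    using k by (simp add: coef_def ad u_apply)
  also have "\<dots> = \<theta> g (coef h x) \<xi>" using coef_shift[OF x h k(2), of \<xi>] g by simp
  finally show "coef (g \<otimes> h \<otimes> inv g) (u g \<circ> x \<circ> u (inv g)) \<xi> = \<theta> g (coef h x) \<xi>" .
qed

lemma \<pi>_conjugate:
  assumes "g \<in> carrier G" "x \<in> M"
  shows "\<pi> (\<theta> g x) = u g \<circ> \<pi> x \<circ> u (inv g)"
proof -
  have "\<pi> (\<theta> g x) \<circ> u g = u g \<circ> \<pi> x"
    using \<pi>_u[OF assms(1) \<theta>_simps(1)[OF assms]] \<theta>_inv(2)[OF assms] by simp
  then have "\<pi> (\<theta> g x) \<circ> (u g \<circ> u (inv g)) = u g \<circ> \<pi> x \<circ> u (inv g)" by (simp add: comp_assoc[symmetric])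
  then show ?thesis using assms by (simp add: u_comp u_one)
qed

lemma \<pi>_inject:
  assumes "x \<in> M" "y \<in> M" "\<pi> x = \<pi> y"
  shows "x = y"
proof -
  have "coef \<one> (u \<one> \<circ> \<pi> x) = x" "coef \<one> (u \<one> \<circ> \<pi> y) = y"
    using coef_generator[OF one_closed _ one_closed] assms(1,2) by simp_all
  then show ?thesis using assms(3) by argo
qed

end

subsection \<open>The trace of a crossed product\<close>

locale traced_crossed_system = crossed_system +
  fixes \<omega>
  assumes \<omega>_tracial: "tracial_vector (amp ` M) \<omega>"
    and \<omega>_separating: "\<And>x. x \<in> M \<Longrightarrow> amp x \<omega> = 0 \<Longrightarrow> x = (\<lambda>_. 0)"
    and \<omega>_invariant: "\<And>g x. g \<in> carrier G \<Longrightarrow> x \<in> M \<Longrightarrow> cinner (amp (\<theta> g x) \<omega>) \<omega> = cinner (amp x \<omega>) \<omega>"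
begin

text \<open>The vector \<open>\<delta>\<^sub>1 \<otimes> \<omega>\<close>. Its vector state on
  \<open>P\<close> is the state of \<open>\<omega>\<close> applied to the coefficient at
  \<open>\<one>\<close>.\<close>

definition "\<Omega> = amp (V \<one>) \<omega>"

lemma amp_generator_\<Omega>:
  assumes "k \<in> carrier G" "m \<in> M"
  shows "amp (u k \<circ> \<pi> m) \<Omega> = amp (V k) (amp m \<omega>)"
proof (rule ell2_eqI)
  fix n
  have b: "u k \<circ> \<pi> m \<in> bounded_ops" using assms by (auto simp: u_bounded \<pi>_bounded)
  show "coord (amp (u k \<circ> \<pi> m) \<Omega>) n = coord (amp (V k) (amp m \<omega>)) n"
    using assms unfolding \<Omega>_def
    by (simp add: coord_amp_op[OF b] coord_amp[OF V_bcl] coord_amp_op[OF SM(3)] \<pi>_apply u_apply \<theta>_one)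
qed

lemma amp_\<pi>_\<Omega>: "m \<in> M \<Longrightarrow> amp (\<pi> m) \<Omega> = amp (V \<one>) (amp m \<omega>)"
  using amp_generator_\<Omega>[OF one_closed, of m] by (simp add: u_one)

lemma cinner_amp_V:
  assumes "g \<in> carrier G" "h \<in> carrier G"
  shows "cinner (amp (V g) v) (amp (V h) w) = (if g = h then cinner v w else 0)"
proof (rule sums_unique2[OF cinner_ell2_sums])
  show "(\<lambda>n. cinner (coord (amp (V g) v) n) (coord (amp (V h) w) n)) sums (if g = h then cinner v w else 0)"
    using assms cinner_ell2_sums[of v w] by (auto simp: coord_amp[OF V_bcl] V_inner)
qed

lemma norm_amp_V: "g \<in> carrier G \<Longrightarrow> norm (amp (V g) v) = norm v"
  by (rule norm_eqI_cinner) (simp add: cinner_amp_V)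

text \<open>Fourier coefficients can be read off the vector \<open>amp x \<Omega>\<close> alone,
  which allows them to be extended to vectors that come from no operator.\<close>

lemma cadj_amp_V_\<Omega>:
  assumes "h \<in> carrier G" "x \<in> bounded_ops"
  shows "cadj (amp (V h)) (amp x \<Omega>) = amp (coef h x) \<omega>"
  by (rule cinner_eqI)
    (simp add: cadj_left[OF bounded_clinear_amp[OF V_bcl[OF assms(1)]]] cinner_amp_coef[OF assms] \<Omega>_def)

lemma norm_\<theta>_\<omega>:
  assumes "g \<in> carrier G" "x \<in> M"
  shows "norm (amp (\<theta> g x) \<omega>) = norm (amp x \<omega>)"
proof -
  have *: "cinner (amp x \<omega>) (amp x \<omega>) = cinner (amp (adj x \<circ> x) \<omega>) \<omega>" if x: "x \<in> M" for x
    using adj_left[OF amp_bounded_ops[OF SM(3)[OF x]], of "amp x \<omega>" \<omega>]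
    by (simp add: amp_op_comp SM(3) SM(7) x adj_amp)
  have "cinner (amp (\<theta> g (adj x \<circ> x)) \<omega>) \<omega> = cinner (amp (adj x \<circ> x) \<omega>) \<omega>"
    using assms by (intro \<omega>_invariant SM(4,7))
  then show ?thesis
    using assms by (intro norm_eqI_cinner) (simp add: * \<theta>_simps(1,4,5) SM(7))
qed

text \<open>Both sides vanish unless \<open>g\<close> and \<open>h\<close> are inverse to each
  other; in that case invariance under \<open>\<theta> h\<close> and the trace property on
  \<open>M\<close> exchange the factors.\<close>

lemma generators_tracial: "tracial_vector (amp ` generators) \<Omega>"
proof -
  have eq: "cinner (amp (u g \<circ> \<pi> x) (amp (u h \<circ> \<pi> y) \<Omega>)) \<Omega> =
      (if g \<otimes> h = \<one> then cinner (amp (\<theta> (inv h) x) (amp y \<omega>)) \<omega> else 0)"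
    if "g \<in> carrier G" "h \<in> carrier G" "x \<in> M" "y \<in> M" for g h x y
  proof -
    have b: "u g \<circ> \<pi> x \<in> bounded_ops" "u h \<circ> \<pi> y \<in> bounded_ops" "\<theta> (inv h) x \<in> M"
      using that by (auto simp: u_bounded \<pi>_bounded \<theta>_simps(1))
    have "amp (u g \<circ> \<pi> x) (amp (u h \<circ> \<pi> y) \<Omega>) = amp (u (g \<otimes> h) \<circ> \<pi> (\<theta> (inv h) x \<circ> y)) \<Omega>"
      using amp_op_comp[OF b(1,2)] generators_comp[OF that] by simp
    also have "\<dots> = amp (V (g \<otimes> h)) (amp (\<theta> (inv h) x \<circ> y) \<omega>)"
      using that b(3) by (intro amp_generator_\<Omega> SM(4)) auto
    finally have "cinner (amp (u g \<circ> \<pi> x) (amp (u h \<circ> \<pi> y) \<Omega>)) \<Omega> =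
        (if g \<otimes> h = \<one> then cinner (amp (\<theta> (inv h) x \<circ> y) \<omega>) \<omega> else 0)"
      unfolding \<Omega>_def using that by (simp add: cinner_amp_V)
    then show ?thesis using amp_op_comp[OF SM(3)[OF b(3)] SM(3)[OF that(4)]] by simp
  qed
  have "cinner (amp (u g \<circ> \<pi> x) (amp (u h \<circ> \<pi> y) \<Omega>)) \<Omega> = cinner (amp (u h \<circ> \<pi> y) (amp (u g \<circ> \<pi> x) \<Omega>)) \<Omega>"
    if a: "g \<in> carrier G" "h \<in> carrier G" "x \<in> M" "y \<in> M" for g h x y
  proof (cases "g \<otimes> h = \<one>")
    case True
    then have g: "g = inv h" using a inv_equality by metis
    then have hg: "h \<otimes> g = \<one>" "inv g = h" using a by auto
    have \<theta>x: "\<theta> (inv h) x \<in> M" using a by (simp add: \<theta>_simps(1))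
    have \<theta>y: "\<theta> h y \<in> M" using a by (simp add: \<theta>_simps(1))
    have "cinner (amp (\<theta> (inv h) x) (amp y \<omega>)) \<omega> = cinner (amp y (amp (\<theta> (inv h) x) \<omega>)) \<omega>"
      using \<omega>_tracial \<theta>x a(4) by (auto simp: tracial_vector_def)
    also have "\<dots> = cinner (amp (y \<circ> \<theta> (inv h) x) \<omega>) \<omega>"
      using amp_op_comp[OF SM(3)[OF a(4)] SM(3)[OF \<theta>x]] by simp
    also have "\<dots> = cinner (amp (\<theta> h (y \<circ> \<theta> (inv h) x)) \<omega>) \<omega>"
      using \<omega>_invariant[OF a(2) SM(4)[OF a(4) \<theta>x]] by simp
    also have "\<theta> h (y \<circ> \<theta> (inv h) x) = \<theta> h y \<circ> x"
      using \<theta>_simps(4)[OF a(2) a(4) \<theta>x] \<theta>_inv(1)[OF a(2,3)] by simp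
    also have "cinner (amp (\<theta> h y \<circ> x) \<omega>) \<omega> = cinner (amp (\<theta> (inv g) y) (amp x \<omega>)) \<omega>"
      using amp_op_comp[OF SM(3)[OF \<theta>y] SM(3)[OF a(3)]] hg by simp
    finally show ?thesis unfolding eq[OF a] eq[OF a(2,1,4,3)] using True hg by simp
  next
    case False
    then have "h \<otimes> g \<noteq> \<one>" using a inv_comm by metis
    then show ?thesis unfolding eq[OF a] eq[OF a(2,1,4,3)] using False by simp
  qed
  then show ?thesis unfolding tracial_vector_def by fastforce
qed

lemma P_tracial: "tracial_vector (amp ` P) \<Omega>"
  using tracial_vector_antimono[OF tracial_vector_amp_bicommutant[OF star_algebra_generators
        tracial_vector_lspan[OF generators_bounded generators_tracial]] image_mono[OF P_generated]] .

lemma P_separating: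
  assumes x: "x \<in> P" and z: "amp x \<Omega> = 0"
  shows "x = (\<lambda>_. 0)"
proof (rule coef_eqI[OF x])
  show "(\<lambda>_. 0) \<in> P" by (rule star_algebra_zero[OF vna_star_algebra[OF vna_crossed_product[OF subset_refl]]])
  fix h assume h: "h \<in> carrier G"
  have b: "bounded_clinear (cadj (amp (V h)))" by (intro bounded_clinear_cadj bounded_clinear_amp V_bcl h)
  have "amp (coef h x) \<omega> = 0"
    using cadj_amp_V_\<Omega>[OF h SP(3)[OF x]] clinear_zero[OF bounded_clinear_clinear[OF b]] by (simp add: z)
  then have "coef h x = (\<lambda>_. 0)" by (rule \<omega>_separating[OF coef_mem[OF x h]])
  moreover have "coef h (\<lambda>_. 0) = (\<lambda>_. 0)"
    using clinear_zero[OF bounded_clinear_clinear[OF bounded_clinear_cadj[OF V_bcl[OF h]]]]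
    by (simp add: coef_def fun_eq_iff)
  ultimately show "coef h x = coef h (\<lambda>_. 0)" by simp
qed

lemma P_eqI:
  assumes x: "x \<in> P" and y: "y \<in> P" and eq: "amp x \<Omega> = amp y \<Omega>"
  shows "x = y"
proof -
  have "(\<lambda>v. x v - y v) = (\<lambda>_. 0)"
    by (rule P_separating[OF star_algebra_minus[OF vna_star_algebra[OF vna_crossed_product[OF subset_refl]] x y]])
      (simp add: amp_op_minus SP(3) x y eq)
  then show ?thesis by (simp add: fun_eq_iff)
qed

text \<open>Kept as a relation: a candidate such as \<open>z \<circ> y\<close> is verified by the
  orthogonality condition, and \<open>is_expectation_unique\<close> identifies two candidates for
  the same \<open>x\<close>.\<close>

definition is_expectation where
  "is_expectation N x y \<longleftrightarrow> y \<in> N \<and> (\<forall>n\<in>N. cinner (amp x \<Omega> - amp y \<Omega>) (amp n \<Omega>) = 0)"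

lemma expectation:
  assumes N: "von_neumann_algebra N" and NP: "N \<subseteq> P" and x: "x \<in> P"
  shows "\<exists>y. is_expectation N x y"
proof -
  have "\<exists>y\<in>amp ` N. \<forall>n\<in>amp ` N. cinner (amp x \<Omega> - y \<Omega>) (n \<Omega>) = 0"
  proof (rule conditional_expectation[OF vna_amp[OF N]])
    show "star_algebra (amp ` P)"
      by (rule star_algebra_amp[OF vna_star_algebra[OF vna_crossed_product[OF subset_refl]]])
    show "amp ` N \<subseteq> amp ` P" using NP by blast
    show "separating (amp ` N) \<Omega>"
      unfolding separating_def using P_separating NP by (fastforce simp: fun_eq_iff)
  qed (use P_tracial x in auto)
  then show ?thesis unfolding is_expectation_def by auto
qed

lemma is_expectation_unique:
  assumes N: "von_neumann_algebra N" and NP: "N \<subseteq> P"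
    and y: "is_expectation N x y" and z: "is_expectation N x z"
  shows "y = z"
proof -
  note sN = vna_star_algebra[OF N]
  have m: "y \<in> N" "z \<in> N" using y z by (auto simp: is_expectation_def)
  have d: "(\<lambda>v. y v - z v) \<in> N" by (rule star_algebra_minus[OF sN m])
  have *: "amp (\<lambda>v. y v - z v) \<Omega> = amp y \<Omega> - amp z \<Omega>"
    using m star_algebraD(3)[OF sN] by (simp add: amp_op_minus)
  have "cinner (amp x \<Omega> - amp z \<Omega> - (amp x \<Omega> - amp y \<Omega>)) (amp (\<lambda>v. y v - z v) \<Omega>) = 0"
    using y z d unfolding is_expectation_def cinner_diff_left[of "amp x \<Omega> - amp z \<Omega>"] by simp
  then have "cinner (amp y \<Omega> - amp z \<Omega>) (amp y \<Omega> - amp z \<Omega>) = 0" unfolding * by simp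
  then show ?thesis using m NP by (intro P_eqI) auto
qed

lemma trace_commute:
  assumes "x \<in> P" "y \<in> P"
  shows "cinner (amp x (amp y \<Omega>)) \<Omega> = cinner (amp y (amp x \<Omega>)) \<Omega>"
  using P_tracial assms by (auto simp: tracial_vector_def)

lemma is_expectation_left:
  assumes N: "von_neumann_algebra N" and NP: "N \<subseteq> P" and x: "x \<in> P"
    and y: "is_expectation N x y" and z: "z \<in> N"
  shows "is_expectation N (z \<circ> x) (z \<circ> y)"
  unfolding is_expectation_def
proof (intro conjI ballI)
  note sN = star_algebraD[OF vna_star_algebra[OF N]]
  have yN: "y \<in> N" using y by (simp add: is_expectation_def)
  show "z \<circ> y \<in> N" by (rule sN(4)[OF z yN])
  fix n assume n: "n \<in> N"
  have b: "x \<in> bounded_ops" "y \<in> bounded_ops" "z \<in> bounded_ops" "amp z \<in> bounded_ops" "adj z \<in> bounded_ops" "n \<in> bounded_ops"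
    using SP(3)[OF x] sN(3) yN z n by (auto intro: amp_bounded_ops adj_bounded)
  have "cinner (amp (z \<circ> x) \<Omega> - amp (z \<circ> y) \<Omega>) (amp n \<Omega>) = cinner (amp z (amp x \<Omega> - amp y \<Omega>)) (amp n \<Omega>)"
    by (simp add: amp_op_comp b ops_simps[OF b(4)])
  also have "\<dots> = cinner (amp x \<Omega> - amp y \<Omega>) (adj (amp z) (amp n \<Omega>))"
    by (rule adj_right[OF b(4), symmetric])
  also have "adj (amp z) (amp n \<Omega>) = amp (adj z \<circ> n) \<Omega>"
    using amp_op_comp[OF b(5,6)] by (simp add: adj_amp[OF b(3)])
  also have "cinner (amp x \<Omega> - amp y \<Omega>) (amp (adj z \<circ> n) \<Omega>) = 0"
    using y sN(4)[OF sN(7)[OF z] n] by (simp add: is_expectation_def)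
  finally show "cinner (amp (z \<circ> x) \<Omega> - amp (z \<circ> y) \<Omega>) (amp n \<Omega>) = 0" .
qed

text \<open>Unlike left multiplication, right multiplication does not act on orbit vectors through
  an adjoint; the trace moves the factor \<open>z\<close> to the other side as \<open>adj z\<close>,
  to the right of \<open>n\<close>.\<close>

lemma is_expectation_right:
  assumes N: "von_neumann_algebra N" and NP: "N \<subseteq> P" and x: "x \<in> P"
    and y: "is_expectation N x y" and z: "z \<in> N"
  shows "is_expectation N (x \<circ> z) (y \<circ> z)"
  unfolding is_expectation_def
proof (intro conjI ballI)
  note sN = star_algebraD[OF vna_star_algebra[OF N]]
  have yN: "y \<in> N" using y by (simp add: is_expectation_def)
  show "y \<circ> z \<in> N" by (rule sN(4)[OF yN z])
  fix n assume n: "n \<in> N"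
  have *: "cinner (amp (w \<circ> z) \<Omega>) (amp n \<Omega>) = cinner (amp w \<Omega>) (amp (n \<circ> adj z) \<Omega>)" if w: "w \<in> P" for w
  proof -
    have P: "n \<in> P" "z \<in> P" "adj n \<in> P" "adj z \<in> P" using n z NP SP(7) by auto
    have "cinner (amp (w \<circ> z) \<Omega>) (amp n \<Omega>) = cinner (amp (adj n \<circ> w) (amp z \<Omega>)) \<Omega>"
      using adj_left[OF amp_bounded_ops[OF SP(3)[OF P(1)]]]
      by (simp add: amp_op_comp SP(3) w P adj_amp)
    also have "\<dots> = cinner (amp z (amp (adj n \<circ> w) \<Omega>)) \<Omega>"
      by (rule trace_commute[OF SP(4)[OF P(3) w] P(2)])
    also have "\<dots> = cinner (amp w \<Omega>) (amp n (adj (amp z) \<Omega>))"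
      using adj_left[OF amp_bounded_ops[OF SP(3)[OF P(1)]], of "amp w \<Omega>" "adj (amp z) \<Omega>"]
        adj_right[OF amp_bounded_ops[OF SP(3)[OF P(2)]], of "amp (adj n \<circ> w) \<Omega>" \<Omega>]
      by (simp add: amp_op_comp SP(3) w P adj_amp)
    also have "\<dots> = cinner (amp w \<Omega>) (amp (n \<circ> adj z) \<Omega>)"
      by (simp add: amp_op_comp SP(3) P adj_amp)
    finally show ?thesis .
  qed
  have "n \<circ> adj z \<in> N" by (rule sN(4)[OF n sN(7)[OF z]])
  then show "cinner (amp (x \<circ> z) \<Omega> - amp (y \<circ> z) \<Omega>) (amp n \<Omega>) = 0"
    using y *[OF x] *[of y] yN NP by (auto simp: is_expectation_def cinner_diff_left)
qed

text \<open>The difference between \<open>x\<close> and its expectation is orthogonal to the orbit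
  of \<open>N\<close>, while the hypothesis places it in the closure of that orbit. This is how
  membership is shown throughout, without operator topologies.\<close>

lemma mem_of_closure:
  assumes N: "von_neumann_algebra N" and NP: "N \<subseteq> P" and x: "x \<in> P"
    and cl: "amp x \<Omega> \<in> closure ((\<lambda>n. amp n \<Omega>) ` N)"
  shows "x \<in> N"
proof -
  obtain y where y: "y \<in> N" "\<And>n. n \<in> N \<Longrightarrow> cinner (amp x \<Omega> - amp y \<Omega>) (amp n \<Omega>) = 0"
    using expectation[OF N NP x] unfolding is_expectation_def by blast
  have 1: "cinner (amp x \<Omega> - amp y \<Omega>) (amp x \<Omega>) = 0"
    by (rule cinner_zero_closure[OF _ cl]) (use y(2) in auto)
  have "cinner (amp x \<Omega> - amp y \<Omega>) (amp x \<Omega> - amp y \<Omega>) = 0"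
    unfolding cinner_diff_right[of "amp x \<Omega> - amp y \<Omega>" "amp x \<Omega>"] 1 y(2)[OF y(1)] by simp
  then have "amp x \<Omega> = amp y \<Omega>" by simp
  then have "x = y" using P_eqI[OF x] y(1) NP by blast
  then show ?thesis using y(1) by simp
qed

end

section \<open>Diagonal actions\<close>

text \<open>The version of \<open>separating_commutant_cyclic\<close> for a vector of the
  amplification: its coordinates separate \<open>N\<close> only jointly. The projection onto the
  closed span of their orbits under the commutant lies in \<open>N\<close>, and its complement
  annihilates every coordinate.\<close>

lemma separating_family_cyclic:
  assumes N: "von_neumann_algebra N" and sep: "\<And>x. x \<in> N \<Longrightarrow> amp x \<Omega> = 0 \<Longrightarrow> x = (\<lambda>_. 0)"
  shows "dense_span {X (coord \<Omega> k) | X k. X \<in> commutant N}"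
proof -
  let ?D = "{X (coord \<Omega> k) | X k. X \<in> commutant N}"
  define S where "S = complex_vector.span ?D"
  note sN = star_algebraD[OF vna_star_algebra[OF N]]
  have sN': "star_algebra (commutant N)" by (rule star_algebra_commutant[OF sN(1,7)])
  have cS: "csubspace S" unfolding S_def by (rule complex_vector.subspace_span)
  obtain e where e: "bounded_clinear e" "\<And>v. e v \<in> closure S" "\<And>v s. s \<in> closure S \<Longrightarrow> cinner (v - e v) s = 0"
    "\<And>s. s \<in> closure S \<Longrightarrow> e s = s" "\<And>v. norm (e v) \<le> norm v" "\<And>v w. cinner (e v) w = cinner v (e w)"
    by (rule projection_exists[OF cS]) (rule that)
  have inv: "X s \<in> S" if X: "X \<in> commutant N" and s: "s \<in> S" for X s
    using s unfolding S_def
  proof (induction rule: complex_vector.span_induct_alt)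
    case base
    then show ?case
      using clinear_zero[OF bounded_ops_clinear[OF star_algebraD(3)[OF sN' X]]] complex_vector.span_zero by simp
  next
    case (step c x y)
    then obtain Y k where Y: "Y \<in> commutant N" "x = Y (coord \<Omega> k)" by blast
    have "(X \<circ> Y) (coord \<Omega> k) \<in> ?D" using star_algebraD(4)[OF sN' X Y(1)] by blast
    then have "(X \<circ> Y) (coord \<Omega> k) \<in> complex_vector.span ?D" by (rule complex_vector.span_base)
    then have "X x \<in> complex_vector.span ?D" unfolding Y(2) comp_apply .
    then show ?case
      using step(2) ops_simps(1,3)[OF star_algebraD(3)[OF sN' X]]
      by (simp add: complex_vector.span_add complex_vector.span_scale)
  qed
  have "e \<in> commutant (commutant N)"
  proof (rule commutantI)
    fix X v assume X: "X \<in> commutant N"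
    show "e (X v) = X (e v)"
      using X inv inv[OF star_algebraD(7)[OF sN' X]] star_algebraD(3)[OF sN' X]
      by (intro projection_commutes[OF e(1,2,4,6)]) auto
  qed (use e(1) in \<open>simp add: bounded_ops_iff\<close>)
  then have eN: "e \<in> N" by (simp add: vna_bicommutant_eq[OF N])
  have "(\<lambda>v. id v - e v) \<in> N" by (rule star_algebra_minus[OF vna_star_algebra[OF N] sN(2) eN])
  moreover have "amp (\<lambda>v. id v - e v) \<Omega> = 0"
  proof (rule ell2_eqI)
    fix n
    have "id (coord \<Omega> n) \<in> ?D" using star_algebraD(2)[OF sN'] by blast
    then have "coord \<Omega> n \<in> S" unfolding S_def by (simp add: complex_vector.span_base)
    then have "e (coord \<Omega> n) = coord \<Omega> n" by (intro e(4) closure_subset[THEN subsetD])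
    then show "coord (amp (\<lambda>v. id v - e v) \<Omega>) n = coord 0 n"
      using calculation sN(3) by (simp add: coord_amp_op)
  qed
  ultimately have "(\<lambda>v. id v - e v) = (\<lambda>_. 0)" by (rule sep)
  then have "e v = v" for v by (simp add: fun_eq_iff)
  then have "v \<in> closure S" for v using e(2)[of v] by simp
  then show ?thesis unfolding dense_span_def S_def by blast
qed

lemma
  assumes A: "tracial_von_neumann_algebra A \<tau>" and \<Omega>: "\<And>x. x \<in> A \<Longrightarrow> \<tau> x = cinner (amp x \<Omega>) \<Omega>"
  shows trace_vector_inner: "x \<in> A \<Longrightarrow> y \<in> A \<Longrightarrow> cinner (amp x \<Omega>) (amp y \<Omega>) = \<tau> (adj y \<circ> x)"
    and trace_vector_separating: "x \<in> A \<Longrightarrow> amp x \<Omega> = 0 \<Longrightarrow> x = (\<lambda>_. 0)"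
    and trace_vector_norm: "norm \<Omega> = 1"
    and trace_vector_commute: "x \<in> A \<Longrightarrow> y \<in> A \<Longrightarrow> cinner (amp (x \<circ> y) \<Omega>) \<Omega> = cinner (amp (y \<circ> x) \<Omega>) \<Omega>"
proof -
  have vA: "von_neumann_algebra A" and tr: "faithful_normal_trace A \<tau>"
    using A by (auto simp: tracial_von_neumann_algebra_def)
  note sA = star_algebraD[OF vna_star_algebra[OF vA]]
  show inner: "cinner (amp x \<Omega>) (amp y \<Omega>) = \<tau> (adj y \<circ> x)" if xy: "x \<in> A" "y \<in> A" for x y
  proof -
    have "\<tau> (adj y \<circ> x) = cinner (adj (amp y) (amp x \<Omega>)) \<Omega>"
      using \<Omega>[OF sA(4)[OF sA(7)[OF xy(2)] xy(1)]] amp_op_comp[OF sA(3)[OF sA(7)[OF xy(2)]] sA(3)[OF xy(1)]]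
      by (simp add: adj_amp sA(3) xy)
    then show ?thesis by (simp add: adj_left[OF amp_bounded_ops[OF sA(3)[OF xy(2)]]])
  qed
  show "x = (\<lambda>_. 0)" if "x \<in> A" "amp x \<Omega> = 0" for x
    using inner[OF that(1,1)] that tr by (simp add: faithful_normal_trace_def)
  have "complex_of_real ((norm \<Omega>)\<^sup>2) = 1"
    using \<Omega>[OF sA(2)] tr by (simp add: faithful_normal_trace_def cinner_self)
  then have "(norm \<Omega>)\<^sup>2 = 1\<^sup>2" unfolding of_real_eq_1_iff by simp
  then show "norm \<Omega> = 1" by (rule power2_eq_imp_eq) simp_all
  show "cinner (amp (x \<circ> y) \<Omega>) \<Omega> = cinner (amp (y \<circ> x) \<Omega>) \<Omega>" if "x \<in> A" "y \<in> A" for x y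
    using \<Omega>[OF sA(4)[OF that]] \<Omega>[OF sA(4)[OF that(2,1)]] tr that by (simp add: faithful_normal_trace_def)
qed

lemma elementary_tensors_tracial:
  assumes t: "hilbert_tensor t" and sA: "star_algebra A" and sB: "star_algebra B"
    and A: "\<And>x y. x \<in> A \<Longrightarrow> y \<in> A \<Longrightarrow> cinner (amp (x \<circ> y) \<alpha>) \<alpha> = cinner (amp (y \<circ> x) \<alpha>) \<alpha>"
    and B: "\<And>x y. x \<in> B \<Longrightarrow> y \<in> B \<Longrightarrow> cinner (amp (x \<circ> y) \<beta>) \<beta> = cinner (amp (y \<circ> x) \<beta>) \<beta>"
  shows "tracial_vector (amp ` tensor_vna t A B) (tensor_ell2 t \<alpha> \<beta>)"
proof -
  note SA = star_algebraD[OF sA] and SB = star_algebraD[OF sB]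
  let ?\<omega> = "tensor_ell2 t \<alpha> \<beta>"
  have eq: "cinner (amp (tensor_op t a b) (amp (tensor_op t a' b') ?\<omega>)) ?\<omega> =
      cinner (amp (a \<circ> a') \<alpha>) \<alpha> * cinner (amp (b \<circ> b') \<beta>) \<beta>"
    if "a \<in> A" "b \<in> B" "a' \<in> A" "b' \<in> B" for a b a' b'
    using that by (simp add: amp_tensor_op[OF t] SA(3) SB(3) cinner_tensor_ell2[OF t] amp_op_comp)
  have "tracial_vector (amp ` elementary_tensors t A B) ?\<omega>"
    unfolding tracial_vector_def
  proof (intro ballI)
    fix x y assume "x \<in> amp ` elementary_tensors t A B" "y \<in> amp ` elementary_tensors t A B"
    then obtain a b a' b' where *: "a \<in> A" "b \<in> B" "a' \<in> A" "b' \<in> B"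
      "x = amp (tensor_op t a b)" "y = amp (tensor_op t a' b')" by blast
    show "cinner (x (y ?\<omega>)) ?\<omega> = cinner (y (x ?\<omega>)) ?\<omega>"
      unfolding *(5,6) eq[OF *(1-4)] eq[OF *(3,4,1,2)] A[OF *(1,3)] B[OF *(2,4)] ..
  qed
  then have "tracial_vector (amp ` lspan (elementary_tensors t A B)) ?\<omega>"
    by (rule tracial_vector_lspan[OF elementary_tensors_bounded[OF t SA(1) SB(1)]])
  from tracial_vector_amp_bicommutant[OF star_algebra_elementary_tensors[OF t sA sB] this]
  show ?thesis
    by (rule tracial_vector_antimono) (use tensor_vna_bicommutant[OF t sA sB] in blast)
qed

text \<open>\<open>x\<close> annihilates every product of coordinates of \<open>\<alpha>\<close> and
  \<open>\<beta>\<close>. As it commutes with tensors of operators from the two commutants, it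
  annihilates products of vectors that are total in each leg.\<close>

lemma tensor_separating:
  assumes t: "hilbert_tensor t" and A: "von_neumann_algebra A" and B: "von_neumann_algebra B"
    and sepA: "\<And>x. x \<in> A \<Longrightarrow> amp x \<alpha> = 0 \<Longrightarrow> x = (\<lambda>_. 0)"
    and sepB: "\<And>x. x \<in> B \<Longrightarrow> amp x \<beta> = 0 \<Longrightarrow> x = (\<lambda>_. 0)"
    and x: "x \<in> tensor_vna t A B" and z: "amp x (tensor_ell2 t \<alpha> \<beta>) = 0"
  shows "x = (\<lambda>_. 0)"
proof -
  note SA = star_algebraD[OF vna_star_algebra[OF A]] and SB = star_algebraD[OF vna_star_algebra[OF B]]
  have xb: "x \<in> bounded_ops"
    using x star_algebraD(3)[OF vna_star_algebra[OF vna_tensor[OF t SA(1) SB(1)]]] by blast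
  have xbc: "bounded_clinear x" using xb by (simp add: bounded_ops_iff)
  have 0: "x (t (coord \<alpha> k) (coord \<beta> n)) = 0" for k n
    using arg_cong[OF z, of "\<lambda>v. coord v (prod_encode (k, n))"]
    by (simp add: coord_amp_op[OF xb] coord_tensor_ell2[OF t])
  have 1: "x (t (X (coord \<alpha> k)) (Y (coord \<beta> n))) = 0" if X: "X \<in> commutant A" and Y: "Y \<in> commutant B" for X Y k n
  proof -
    have b: "X \<in> bounded_ops" "Y \<in> bounded_ops" using X Y commutant_bounded by blast+
    show ?thesis
      using tensor_op_commutant[OF t vna_star_algebra[OF A] vna_star_algebra[OF B] X Y x, of "t (coord \<alpha> k) (coord \<beta> n)"]
        clinear_zero[OF bounded_ops_clinear[OF tensor_op_bounded[OF t b]]]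
      by (simp add: tensor_op_apply[OF t b] 0)
  qed
  \<comment> \<open>With the second leg fixed, totality in the first leg allows an arbitrary
    \<open>h\<close>; the second leg is then treated in the same way.\<close>
  have 2: "x (t h (Y (coord \<beta> n))) = 0" if Y: "Y \<in> commutant B" for h Y n
  proof -
    have "(x \<circ> (\<lambda>h. t h (Y (coord \<beta> n)))) = (\<lambda>_. 0)"
    proof (rule bounded_clinear_eq_dense_span[OF _ _ separating_family_cyclic[OF A sepA]])
      show "bounded_clinear (x \<circ> (\<lambda>h. t h (Y (coord \<beta> n))))"
        by (rule bounded_clinear_comp[OF xbc bounded_clinear_tensor_left[OF t]])
      show "(x \<circ> (\<lambda>h. t h (Y (coord \<beta> n)))) s = 0" if "s \<in> {X (coord \<alpha> k) |X k. X \<in> commutant A}" for s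
        using that 1[OF _ Y] by auto
    qed simp_all
    then show ?thesis by (simp add: fun_eq_iff)
  qed
  have "(x \<circ> t h) = (\<lambda>_. 0)" for h
  proof (rule bounded_clinear_eq_dense_span[OF _ _ separating_family_cyclic[OF B sepB]])
    show "bounded_clinear (x \<circ> t h)"
      by (rule bounded_clinear_comp[OF xbc bounded_clinear_tensor_right[OF t]])
    show "(x \<circ> t h) s = 0" if "s \<in> {Y (coord \<beta> n) |Y n. Y \<in> commutant B}" for s
      using that 2 by auto
  qed simp_all
  then show ?thesis
    by (intro tensor_op_eq[OF t xbc]) (simp_all add: fun_eq_iff)
qed

section \<open>The crossed product of a diagonal action, with its trace vector\<close>

locale diagonal_crossed_system =
  fixes G :: "('g, 's) monoid_scheme" (structure)
    and A :: "('a::chilbert_space \<Rightarrow> 'a) set" and \<tau>\<^sub>A :: "('a \<Rightarrow> 'a) \<Rightarrow> complex"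
    and B :: "('b::chilbert_space \<Rightarrow> 'b) set" and \<tau>\<^sub>B :: "('b \<Rightarrow> 'b) \<Rightarrow> complex"
    and \<sigma> :: "'g \<Rightarrow> ('a \<Rightarrow> 'a) \<Rightarrow> ('a \<Rightarrow> 'a)"
    and \<rho> :: "'g \<Rightarrow> ('b \<Rightarrow> 'b) \<Rightarrow> ('b \<Rightarrow> 'b)"
    and t :: "'a \<Rightarrow> 'b \<Rightarrow> 'ab::chilbert_space"
    and \<theta> :: "'g \<Rightarrow> ('ab \<Rightarrow> 'ab) \<Rightarrow> ('ab \<Rightarrow> 'ab)"
    and V :: "'g \<Rightarrow> 'ab \<Rightarrow> 'k::chilbert_space"
    and \<alpha> :: "'a ell2" and \<beta> :: "'b ell2"
  assumes grp: "group G"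
    and A: "tracial_von_neumann_algebra A \<tau>\<^sub>A" and B: "tracial_von_neumann_algebra B \<tau>\<^sub>B"
    and \<sigma>: "trace_preserving_action G A \<tau>\<^sub>A \<sigma>" and \<rho>: "trace_preserving_action G B \<tau>\<^sub>B \<rho>"
    and t: "hilbert_tensor t" and \<theta>: "diagonal_action G t A B \<sigma> \<rho> \<theta>"
    and V: "hilbert_sum (carrier G) V"
    and \<alpha>: "\<And>x. x \<in> A \<Longrightarrow> \<tau>\<^sub>A x = cinner (amp x \<alpha>) \<alpha>"
    and \<beta>: "\<And>x. x \<in> B \<Longrightarrow> \<tau>\<^sub>B x = cinner (amp x \<beta>) \<beta>"
begin

lemma vA: "von_neumann_algebra A" and vB: "von_neumann_algebra B"
  using A B by (auto simp: tracial_von_neumann_algebra_def)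

lemmas sA = vna_star_algebra[OF vA] and sB = vna_star_algebra[OF vB]
lemmas SA = star_algebraD[OF sA] and SB = star_algebraD[OF sB]

lemma \<sigma>_automorphism: "g \<in> carrier G \<Longrightarrow> star_automorphism A (\<sigma> g)"
  and \<sigma>_trace: "g \<in> carrier G \<Longrightarrow> a \<in> A \<Longrightarrow> \<tau>\<^sub>A (\<sigma> g a) = \<tau>\<^sub>A a"
  using \<sigma> by (auto simp: trace_preserving_action_def vna_action_def)

lemmas \<sigma>_mem = star_automorphismD(1)[OF \<sigma>_automorphism]
lemmas \<sigma>_id = star_automorphism_id[OF \<sigma>_automorphism SA(2)]

lemma \<rho>_automorphism: "g \<in> carrier G \<Longrightarrow> star_automorphism B (\<rho> g)"
  and \<rho>_trace: "g \<in> carrier G \<Longrightarrow> b \<in> B \<Longrightarrow> \<tau>\<^sub>B (\<rho> g b) = \<tau>\<^sub>B b"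
  and \<rho>_one: "b \<in> B \<Longrightarrow> \<rho> \<one> b = b"
  and \<rho>_mult: "g \<in> carrier G \<Longrightarrow> h \<in> carrier G \<Longrightarrow> b \<in> B \<Longrightarrow> \<rho> (g \<otimes> h) b = \<rho> g (\<rho> h b)"
  using \<rho> by (auto simp: trace_preserving_action_def vna_action_def)

lemmas \<rho>_mem = star_automorphismD(1)[OF \<rho>_automorphism]

lemma \<theta>_tensor: "g \<in> carrier G \<Longrightarrow> a \<in> A \<Longrightarrow> b \<in> B \<Longrightarrow> \<theta> g (tensor_op t a b) = tensor_op t (\<sigma> g a) (\<rho> g b)"
  using \<theta> by (auto simp: diagonal_action_def)

sublocale crossed_system G "tensor_vna t A B" \<theta> V
  by (rule crossed_system.intro)
    (use grp V \<theta> vna_tensor[OF t SA(1) SB(1)] in \<open>auto simp: diagonal_action_def\<close>)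

lemma cinner_amp_tensor_op:
  "a \<in> A \<Longrightarrow> b \<in> B \<Longrightarrow>
    cinner (amp (tensor_op t a b) (tensor_ell2 t \<alpha> \<beta>)) (tensor_ell2 t \<alpha> \<beta>) = \<tau>\<^sub>A a * \<tau>\<^sub>B b"
  by (simp add: amp_tensor_op[OF t] SA(3) SB(3) cinner_tensor_ell2[OF t] \<alpha> \<beta>)

text \<open>By normality of \<open>\<theta> g\<close> both sides are normal functionals of
  \<open>x\<close>; on elementary tensors both are the product of the two invariant traces.\<close>

lemma \<theta>_invariant:
  assumes g: "g \<in> carrier G" and x: "x \<in> tensor_vna t A B"
  shows "cinner (amp (\<theta> g x) (tensor_ell2 t \<alpha> \<beta>)) (tensor_ell2 t \<alpha> \<beta>) =
    cinner (amp x (tensor_ell2 t \<alpha> \<beta>)) (tensor_ell2 t \<alpha> \<beta>)"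
proof -
  let ?\<omega> = "tensor_ell2 t \<alpha> \<beta>"
  obtain v w where vw: "\<And>x. x \<in> tensor_vna t A B \<Longrightarrow> cinner (amp (\<theta> g x) ?\<omega>) ?\<omega> = cinner (amp x v) w"
    using \<theta>_ultraweak[OF g] by blast
  have "cinner (amp x v) w = cinner (amp x ?\<omega>) ?\<omega>"
  proof (rule bicommutant_ultraweak[OF star_algebra_elementary_tensors[OF t sA sB] tensor_vna_bicommutant[OF t sA sB x]])
    note b = star_algebraD(3)[OF star_algebra_elementary_tensors[OF t sA sB]]
    fix s assume "s \<in> lspan (elementary_tensors t A B)"
    then show "cinner (amp s v) w = cinner (amp s ?\<omega>) ?\<omega>"
    proof induction
      case (base s)
      then obtain a b where s: "a \<in> A" "b \<in> B" "s = tensor_op t a b" by blast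
      show ?case
        unfolding s(3)
        by (simp add: vw[OF tensor_vna_elementary[OF s(1,2)], symmetric] \<theta>_tensor g s(1,2)
            cinner_amp_tensor_op \<sigma>_mem \<rho>_mem \<sigma>_trace \<rho>_trace)
    next
      case (plus x y)
      then show ?case by (simp add: amp_op_plus b cinner_simps)
    next
      case (scaleC x c)
      then show ?case by (simp add: amp_op_scaleC b cinner_simps)
    qed
  qed
  then show ?thesis using vw[OF x] by simp
qed

sublocale traced_crossed_system G "tensor_vna t A B" \<theta> V "tensor_ell2 t \<alpha> \<beta>"
proof
  show "tracial_vector (amp ` tensor_vna t A B) (tensor_ell2 t \<alpha> \<beta>)"
    by (intro elementary_tensors_tracial[OF t sA sB] trace_vector_commute[OF A \<alpha>] trace_vector_commute[OF B \<beta>])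
  show "x = (\<lambda>_. 0)" if "x \<in> tensor_vna t A B" "amp x (tensor_ell2 t \<alpha> \<beta>) = 0" for x
    using tensor_separating[OF t vA vB trace_vector_separating[OF A \<alpha>] trace_vector_separating[OF B \<beta>] that] .
qed (rule \<theta>_invariant)

abbreviation "\<iota> b \<equiv> \<pi> (tensor_op t id b)"

text \<open>The embedding of the vectors of \<open>B\<close> into those of the crossed product,
  isometric because \<open>\<alpha>\<close> is a unit vector. It is defined on all of the
  amplification, since compactness approximates by vectors that need not come from
  \<open>B\<close>.\<close>

definition "\<Psi> v = amp (V \<one>) (tensor_ell2 t \<alpha> v)"

lemma cinner_\<Psi>: "cinner (\<Psi> v) (\<Psi> w) = cinner v w"
  unfolding \<Psi>_def using cinner_amp_V[OF one_closed one_closed]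
  by (simp add: cinner_tensor_ell2[OF t] cinner_self[of \<alpha>] trace_vector_norm[OF A \<alpha>])

lemma norm_\<Psi>: "norm (\<Psi> v) = norm v"
  by (rule norm_eqI_cinner) (rule cinner_\<Psi>)

lemma bounded_clinear_\<Psi>: "bounded_clinear \<Psi>"
proof (rule bounded_clinearI[where K = 1])
  have tb: "clinear (t h)" for h by (rule hilbert_tensorD(2)[OF t])
  have Vb: "bounded_clinear (V \<one>)" by (rule V_bcl[OF one_closed])
  show "clinear \<Psi>"
    by (rule clinearI; rule ell2_eqI)
      (simp_all add: \<Psi>_def coord_amp[OF Vb] coord_tensor_ell2[OF t] clinear_add[OF tb] clinear_scaleC[OF tb]
        clinear_add[OF bounded_clinear_clinear[OF Vb]] clinear_scaleC[OF bounded_clinear_clinear[OF Vb]])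
qed (simp add: norm_\<Psi>)

lemma right_mem: "b \<in> B \<Longrightarrow> tensor_op t id b \<in> tensor_vna t A B"
  by (rule tensor_vna_elementary[OF SA(2)])

lemma \<iota>_P: "b \<in> B \<Longrightarrow> \<iota> b \<in> P"
  by (rule crossed_product_\<pi>[OF right_mem])

lemma amp_\<iota>_\<Omega>: "b \<in> B \<Longrightarrow> amp (\<iota> b) \<Omega> = \<Psi> (amp b \<beta>)"
  by (simp add: amp_\<pi>_\<Omega> right_mem \<Psi>_def amp_tensor_op[OF t] SA(2,3) SB(3))

lemma \<iota>_conjugate:
  assumes "g \<in> carrier G" "b \<in> B"
  shows "\<iota> (\<rho> g b) = u g \<circ> \<iota> b \<circ> u (inv g)"
  using \<pi>_conjugate[OF assms(1) right_mem[OF assms(2)]] \<theta>_tensor[OF assms(1) SA(2) assms(2)]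
  by (simp add: \<sigma>_id assms(1))

end

section \<open>Fourier coefficients of the expectation onto an intermediate algebra\<close>

locale intermediate_algebra = diagonal_crossed_system +
  fixes N and e
  assumes vN: "von_neumann_algebra N" and NP: "N \<subseteq> crossed_product G V \<theta> (tensor_vna t A B)"
    and AN: "crossed_product G V \<theta> (left_copy t A) \<subseteq> N"
    and e: "orbit_projection (amp ` N) (amp (V \<one>\<^bsub>G\<^esub>) (tensor_ell2 t \<alpha> \<beta>)) e"
begin

lemmas sN = vna_star_algebra[OF vN]
lemmas SN = star_algebraD[OF sN]

lemma left_mem: "a \<in> A \<Longrightarrow> tensor_op t a id \<in> tensor_vna t A B"
  by (rule tensor_vna_elementary[OF _ SB(2)])

lemma left_N: "a \<in> A \<Longrightarrow> \<pi> (tensor_op t a id) \<in> N"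
proof -
  assume "a \<in> A"
  then have "tensor_op t a id \<in> left_copy t A" by (auto simp: left_copy_def)
  then show ?thesis using crossed_product_\<pi> AN by blast
qed

lemma u_N: "g \<in> carrier G \<Longrightarrow> u g \<in> N"
  using crossed_product_u AN by blast

abbreviation "L \<equiv> (\<lambda>n. amp n \<Omega>) ` N"

lemma L_orbit: "(\<lambda>s. s \<Omega>) ` amp ` N = L"
  by (simp add: image_image)

lemmas e' = orbit_projectionD[OF e[folded \<Omega>_def], unfolded L_orbit]

lemma e_bcl: "bounded_clinear e"
  using e'(1) commutant_bounded by (auto simp: bounded_ops_iff[symmetric])

lemma e_expectation:
  assumes y: "is_expectation N x y"
  shows "e (amp x \<Omega>) = amp y \<Omega>"
proof -
  have yN: "y \<in> N" using y by (simp add: is_expectation_def)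
  have "e (amp x \<Omega> - amp y \<Omega>) = 0"
  proof (rule cinner_eqI)
    fix w
    have "cinner (amp x \<Omega> - amp y \<Omega>) (e w) = 0"
      by (rule cinner_zero_closure[OF _ e'(2)]) (use y in \<open>auto simp: is_expectation_def\<close>)
    then show "cinner (e (amp x \<Omega> - amp y \<Omega>)) w = cinner 0 w" by (simp add: e'(5))
  qed
  moreover have "e (amp y \<Omega>) = amp y \<Omega>"
    using yN by (intro e'(3) closure_subset[THEN subsetD] imageI)
  ultimately show ?thesis by (simp add: clinear_diff[OF bounded_clinear_clinear[OF e_bcl]])
qed

text \<open>The Fourier coefficient at \<open>h\<close> of the expectation, extended from elements
  of \<open>B\<close> to vectors. It is linear and contractive in \<open>v\<close>, so it can be
  applied to an approximating sum.\<close>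

definition coef_e where "coef_e h v = cadj (amp (V h)) (e (\<Psi> v))"

lemma bounded_clinear_coef_e:
  assumes "h \<in> carrier G"
  shows "bounded_clinear (coef_e h)"
proof -
  have "bounded_clinear (cadj (amp (V h)) \<circ> (e \<circ> \<Psi>))"
    by (intro bounded_clinear_comp bounded_clinear_cadj bounded_clinear_amp V_bcl assms e_bcl bounded_clinear_\<Psi>)
  then show ?thesis by (simp add: coef_e_def[abs_def] comp_def)
qed

lemma norm_coef_e_le:
  assumes "h \<in> carrier G"
  shows "norm (coef_e h v) \<le> norm v"
proof -
  have "norm (coef_e h v) \<le> 1 * norm (e (\<Psi> v))"
    unfolding coef_e_def
    by (rule norm_cadj_le[OF bounded_clinear_amp[OF V_bcl[OF assms]]]) (simp_all add: norm_amp_V assms)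
  also have "\<dots> \<le> norm v" using e'(4)[of "\<Psi> v"] by (simp add: norm_\<Psi>)
  finally show ?thesis .
qed

lemma coef_e_expectation:
  assumes b: "b \<in> B" and y: "is_expectation N (\<iota> b) y" and h: "h \<in> carrier G"
  shows "coef_e h (amp b \<beta>) = amp (coef h y) (tensor_ell2 t \<alpha> \<beta>)"
proof -
  have "y \<in> N" using y by (simp add: is_expectation_def)
  then show ?thesis
    using e_expectation[OF y] cadj_amp_V_\<Omega>[OF h SN(3)] by (simp add: coef_e_def amp_\<iota>_\<Omega>[OF b])
qed

text \<open>The expectation of an element with precompact orbit has a precompact orbit, so its
  Fourier coefficients are small outside a finite set, uniformly in \<open>g\<close>. Conjugation by \<open>g\<close>
  moves the coefficient at \<open>h \<noteq> 1\<close> out of this set.\<close>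

lemma coef_e_compact:
  assumes icc: "icc G" and f: "f \<in> B" and h: "h \<in> carrier G" "h \<noteq> \<one>"
    and compact: "\<And>\<epsilon>. 0 < \<epsilon> \<Longrightarrow> \<exists>n \<xi> \<kappa>. bdd_above {cmod (\<kappa> i g) | i g. i < (n::nat) \<and> g \<in> carrier G} \<and>
      (\<forall>g\<in>carrier G. norm (amp (\<rho> g f) \<beta> - (\<Sum>i<n. \<kappa> i g *\<^sub>C \<xi> i)) \<le> \<epsilon>)"
  shows "coef_e h (amp f \<beta>) = 0"
proof (rule ccontr)
  assume nz: "coef_e h (amp f \<beta>) \<noteq> 0"
  obtain y where y: "is_expectation N (\<iota> f) y" using expectation[OF vN NP \<iota>_P[OF f]] by blast
  then have yN: "y \<in> N" by (simp add: is_expectation_def)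
  define d where "d = norm (coef_e h (amp f \<beta>))"
  have d: "0 < d" using nz by (simp add: d_def)
  \<comment> \<open>The unitary \<open>u g\<close> lies in \<open>N\<close>, so the expectation
    commutes with conjugation by it; \<open>coef_conjugate\<close> then moves the coefficient and
    applies \<open>\<theta> g\<close>, which preserves the norm at the trace vector.\<close>
  have transport: "norm (coef_e (g \<otimes> h \<otimes> inv g) (amp (\<rho> g f) \<beta>)) = d" if g: "g \<in> carrier G" for g
  proof -
    have "is_expectation N (u g \<circ> \<iota> f \<circ> u (inv g)) (u g \<circ> y \<circ> u (inv g))"
      using g y yN NP \<iota>_P[OF f]
      by (intro is_expectation_right[OF vN NP] is_expectation_left[OF vN NP] u_N SP(4) crossed_product_u) auto
    then have "is_expectation N (\<iota> (\<rho> g f)) (u g \<circ> y \<circ> u (inv g))" by (simp add: \<iota>_conjugate[OF g f])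
    then have "coef_e (g \<otimes> h \<otimes> inv g) (amp (\<rho> g f) \<beta>)
        = amp (coef (g \<otimes> h \<otimes> inv g) (u g \<circ> y \<circ> u (inv g))) (tensor_ell2 t \<alpha> \<beta>)"
      using g h by (intro coef_e_expectation \<rho>_mem f) auto
    also have "\<dots> = amp (\<theta> g (coef h y)) (tensor_ell2 t \<alpha> \<beta>)"
      using coef_conjugate[OF _ g h(1)] yN NP by auto
    finally have "norm (coef_e (g \<otimes> h \<otimes> inv g) (amp (\<rho> g f) \<beta>)) = norm (amp (coef h y) (tensor_ell2 t \<alpha> \<beta>))"
      using norm_\<theta>_\<omega>[OF g coef_mem[OF _ h(1)]] yN NP by auto
    then show ?thesis by (simp add: d_def coef_e_expectation[OF f y h(1)])
  qed
  \<comment> \<open>The approximation error and the coefficient of the approximating sum will each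
    contribute at most \<open>d / 3\<close>, too little for a coefficient of norm
    \<open>d\<close>.\<close>
  have "0 < d / 3" using d by simp
  from compact[OF this] obtain n \<xi> \<kappa> where
    *: "bdd_above {cmod (\<kappa> i g) | i g. i < (n::nat) \<and> g \<in> carrier G} \<and>
      (\<forall>g\<in>carrier G. norm (amp (\<rho> g f) \<beta> - (\<Sum>i<n. \<kappa> i g *\<^sub>C \<xi> i)) \<le> d / 3)"
    by (elim exE) (rule that)
  then have bdd: "bdd_above {cmod (\<kappa> i g) | i g. i < (n::nat) \<and> g \<in> carrier G}" by (rule conjunct1)
  have approx: "norm (amp (\<rho> g f) \<beta> - (\<Sum>i<n. \<kappa> i g *\<^sub>C \<xi> i)) \<le> d / 3" if "g \<in> carrier G" for g
    using * that by (elim conjE bspec)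
  obtain C where C: "\<And>c. c \<in> {cmod (\<kappa> i g) | i g. i < (n::nat) \<and> g \<in> carrier G} \<Longrightarrow> c \<le> C"
    using bdd unfolding bdd_above_def by blast
  define C' where "C' = max C 1"
  have C': "cmod (\<kappa> i g) \<le> C'" "0 < C'" if "i < n" "g \<in> carrier G" for i g
  proof -
    have "cmod (\<kappa> i g) \<le> C" using that by (intro C) blast
    then show "cmod (\<kappa> i g) \<le> C'" "0 < C'" by (auto simp: C'_def)
  qed
  \<comment> \<open>Chosen so that \<open>n\<close> coefficients of norm at most
    \<open>\<delta>\<close>, with scalars bounded by \<open>C'\<close>, add up to at most
    \<open>d / 3\<close>. The summand 1 and the maximum in \<open>C'\<close> keep the divisor
    positive, also for \<open>n = 0\<close>.\<close>
  define \<delta> where "\<delta> = (d / 3) / ((real n + 1) * C')"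
  have C'0: "0 < C'" by (simp add: C'_def)
  have \<delta>: "0 < \<delta>" using d C'0 by (simp add: \<delta>_def)
  \<comment> \<open>The group elements at which one of the finitely many approximating vectors has a
    large coefficient. This set does not depend on \<open>g\<close>, and an infinite conjugacy class
    must leave it.\<close>
  define \<Phi> where "\<Phi> = (\<Union>i<n. {k \<in> carrier G. \<delta> \<le> norm (coef_e k (\<xi> i))})"
  have "finite {k \<in> carrier G. \<delta> \<le> norm (coef_e k v)}" for v
    unfolding coef_e_def
    by (rule finite_large_coefficients[OF _ _ \<delta>]) (simp_all add: bounded_clinear_amp V_bcl cinner_amp_V)
  then have fin: "finite \<Phi>" by (simp add: \<Phi>_def)
  have "infinite {g \<otimes> h \<otimes> inv g | g. g \<in> carrier G}" using icc h by (simp add: icc_def)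
  then have "\<not> {g \<otimes> h \<otimes> inv g | g. g \<in> carrier G} \<subseteq> \<Phi>" using fin finite_subset by blast
  then obtain g where g: "g \<in> carrier G" "g \<otimes> h \<otimes> inv g \<notin> \<Phi>" by blast
  define k where "k = g \<otimes> h \<otimes> inv g"
  have k: "k \<in> carrier G" using g h by (simp add: k_def)
  have small: "norm (coef_e k (\<xi> i)) \<le> \<delta>" if "i < n" for i
    using g(2) that k unfolding \<Phi>_def k_def[symmetric] by force
  note lin = clinear_simps[OF bounded_clinear_clinear[OF bounded_clinear_coef_e[OF k]]]
  let ?s = "\<Sum>i<n. \<kappa> i g *\<^sub>C \<xi> i"
  have "coef_e k (amp (\<rho> g f) \<beta>) = coef_e k (amp (\<rho> g f) \<beta> - ?s) + coef_e k ?s" by (simp add: lin)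
  then have "d \<le> norm (coef_e k (amp (\<rho> g f) \<beta> - ?s)) + norm (coef_e k ?s)"
    using transport[OF g(1), folded k_def] norm_triangle_ineq[of "coef_e k (amp (\<rho> g f) \<beta> - ?s)" "coef_e k ?s"]
    by simp
  moreover have "norm (coef_e k (amp (\<rho> g f) \<beta> - ?s)) \<le> d / 3"
    by (rule order_trans[OF norm_coef_e_le[OF k] approx[OF g(1)]])
  moreover have "norm (coef_e k ?s) \<le> d / 3"
  proof -
    have "norm (coef_e k ?s) \<le> (\<Sum>i<n. norm (\<kappa> i g *\<^sub>C coef_e k (\<xi> i)))"
      unfolding lin(5) lin(3) by (rule norm_sum)
    also have "\<dots> \<le> (\<Sum>i<n. C' * \<delta>)"
      using C'(1)[OF _ g(1)] small C'0 by (intro sum_mono) (auto intro!: mult_mono)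
    also have "\<dots> = real n * (C' * \<delta>)" by simp
    also have "\<dots> \<le> (real n + 1) * (C' * \<delta>)"
      using C'0 \<delta> by (intro mult_right_mono) auto
    also have "\<dots> = (real n + 1) * C' * \<delta>" by (simp only: mult.assoc)
    also have "\<dots> = d / 3"
    proof -
      have "0 < (real n + 1) * C'" using C'0 by (intro mult_pos_pos) auto
      then have "(real n + 1) * C' \<noteq> 0" by (rule less_imp_neq[THEN not_sym])
      moreover have "c * (x / c) = x" if "c \<noteq> 0" for c x :: real using that by simp
      ultimately show ?thesis unfolding \<delta>_def by blast
    qed
    finally show ?thesis .
  qed
  ultimately show False using d by linarith
qed

text \<open>Compactness is given in the realisation \<open>j\<close>, while \<open>coef_e\<close>
  acts on vectors \<open>amp b \<beta>\<close>. Both have the inner product defined by the trace, so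
  a contraction \<open>S\<close> carries one to the other, and the vanishing extends from the total
  set of compact elements by continuity.\<close>

lemma coef_e_zero:
  assumes icc: "icc G" and j: "L2_space B \<tau>\<^sub>B j" and compact: "compact_action G B j \<rho>"
    and b: "b \<in> B" and h: "h \<in> carrier G" "h \<noteq> \<one>"
  shows "coef_e h (amp b \<beta>) = 0"
proof -
  have j_add: "j (\<lambda>v. x v + y v) = j x + j y" if "x \<in> B" "y \<in> B" for x y
    using j that by (simp add: L2_space_def)
  have j_scale: "j (\<lambda>v. c *\<^sub>C x v) = c *\<^sub>C j x" if "x \<in> B" for c x
    using j that by (simp add: L2_space_def)
  have j_norm: "norm (amp x \<beta>) = norm (j x)" if "x \<in> B" for x
    by (rule norm_eqI_cinner) (use j that trace_vector_inner[OF B \<beta> that that] in \<open>simp add: L2_space_def\<close>)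
  obtain S where S: "bounded_clinear S" and Sj: "\<And>x. x \<in> B \<Longrightarrow> S (j x) = amp x \<beta>"
    and S_norm: "\<And>v. norm (S v) \<le> 1 * norm v"
    by (rule extend_from_algebra[OF sB, of j "\<lambda>x. amp x \<beta>" 1])
      (use that in \<open>auto simp: j_add j_scale j_norm SB(3) amp_op_plus amp_op_scaleC\<close>)
  have S_sum: "S (\<Sum>i<n. k i *\<^sub>C x i) = (\<Sum>i<n. k i *\<^sub>C S (x i))" for n :: nat and k x
    by (simp add: clinear_sum clinear_scaleC bounded_clinear_clinear[OF S])
  obtain F where F': "F \<subseteq> B \<and> dense_span (j ` F) \<and>
    (\<forall>f\<in>F. \<forall>\<epsilon>>0. \<exists>n \<xi> \<kappa>. bdd_above {cmod (\<kappa> i g) | i g. i < (n::nat) \<and> g \<in> carrier G} \<and>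
      (\<forall>g\<in>carrier G. norm (j (\<rho> g f) - (\<Sum>i<n. \<kappa> i g *\<^sub>C \<xi> i)) \<le> \<epsilon>))"
    using compact unfolding compact_action_def by (rule exE)
  then have F: "F \<subseteq> B" "dense_span (j ` F)" by simp_all
  have F_compact: "\<exists>n \<xi> \<kappa>. bdd_above {cmod (\<kappa> i g) | i g. i < (n::nat) \<and> g \<in> carrier G} \<and>
      (\<forall>g\<in>carrier G. norm (j (\<rho> g f) - (\<Sum>i<n. \<kappa> i g *\<^sub>C \<xi> i)) \<le> \<epsilon>)" if "f \<in> F" "0 < \<epsilon>" for f \<epsilon>
    using F'[THEN conjunct2, THEN conjunct2, rule_format, OF that] .
  have zero_F: "coef_e h (amp f \<beta>) = 0" if f: "f \<in> F" for f
  proof (rule coef_e_compact[OF icc _ h])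
    show fB: "f \<in> B" using f F(1) by blast
    fix \<epsilon> :: real assume "0 < \<epsilon>"
    from F_compact[OF f this] obtain n \<xi> \<kappa> where
      *: "bdd_above {cmod (\<kappa> i g) | i g. i < (n::nat) \<and> g \<in> carrier G}"
      "\<forall>g\<in>carrier G. norm (j (\<rho> g f) - (\<Sum>i<n. \<kappa> i g *\<^sub>C \<xi> i)) \<le> \<epsilon>"
      by (elim exE conjE) (rule that)
    have "norm (amp (\<rho> g f) \<beta> - (\<Sum>i<n. \<kappa> i g *\<^sub>C S (\<xi> i))) \<le> \<epsilon>" if g: "g \<in> carrier G" for g
    proof -
      have "amp (\<rho> g f) \<beta> - (\<Sum>i<n. \<kappa> i g *\<^sub>C S (\<xi> i)) = S (j (\<rho> g f) - (\<Sum>i<n. \<kappa> i g *\<^sub>C \<xi> i))"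
        by (simp add: clinear_diff[OF bounded_clinear_clinear[OF S]] S_sum Sj \<rho>_mem g fB)
      then show ?thesis using S_norm[of "j (\<rho> g f) - (\<Sum>i<n. \<kappa> i g *\<^sub>C \<xi> i)"] *(2) g by force
    qed
    then show "\<exists>n \<xi> \<kappa>. bdd_above {cmod (\<kappa> i g) | i g. i < (n::nat) \<and> g \<in> carrier G} \<and>
        (\<forall>g\<in>carrier G. norm (amp (\<rho> g f) \<beta> - (\<Sum>i<n. \<kappa> i g *\<^sub>C \<xi> i)) \<le> \<epsilon>)"
      using *(1) by (intro exI[of _ n] exI[of _ "\<lambda>i. S (\<xi> i)"] exI[of _ \<kappa>]) blast
  qed
  have "coef_e h \<circ> S = (\<lambda>_. 0)"
  proof (rule bounded_clinear_eq_dense_span[OF _ _ F(2)])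
    show "bounded_clinear (coef_e h \<circ> S)"
      by (rule bounded_clinear_comp[OF bounded_clinear_coef_e[OF h(1)] S])
    show "(coef_e h \<circ> S) s = 0" if "s \<in> j ` F" for s
      using that zero_F Sj F(1) by auto
  qed simp
  then show ?thesis using Sj[OF b] by (metis comp_apply)
qed

text \<open>With only the coefficient at \<open>\<one>\<close> left, the expectation is
  \<open>\<pi> m\<close>. Injectivity of \<open>\<pi>\<close> brings the commutation with
  \<open>A\<close> down to \<open>m\<close>, where slicing by the factor \<open>A\<close>
  applies.\<close>

lemma expectation_right:
  assumes A: "II1_factor A" and zero: "\<And>h b. h \<in> carrier G \<Longrightarrow> h \<noteq> \<one> \<Longrightarrow> b \<in> B \<Longrightarrow> coef_e h (amp b \<beta>) = 0"
    and b: "b \<in> B"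
  shows "\<exists>c\<in>B. is_expectation N (\<iota> b) (\<iota> c)"
proof -
  obtain y where y: "is_expectation N (\<iota> b) y" using expectation[OF vN NP \<iota>_P[OF b]] by blast
  then have yN: "y \<in> N" by (simp add: is_expectation_def)
  then have yP: "y \<in> P" using NP by blast
  have "coef h y = (\<lambda>_. 0)" if h: "h \<in> carrier G" "h \<noteq> \<one>" for h
    using zero[OF h b] coef_e_expectation[OF b y h(1)] by (intro \<omega>_separating coef_mem[OF yP h(1)]) simp
  then have y_eq: "y = \<pi> (coef \<one> y)" by (rule coef_diagonal[OF yP])
  define m where "m = coef \<one> y"
  have m: "m \<in> tensor_vna t A B" unfolding m_def by (rule coef_mem[OF yP one_closed])
  have y_m: "y = \<pi> m" using y_eq by (simp add: m_def)
  have "m (tensor_op t a id v) = tensor_op t a id (m v)" if a: "a \<in> A" for a v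
  proof -
    \<comment> \<open>The copies of \<open>a\<close> and \<open>b\<close> commute, so multiplying
      \<open>y\<close> by the copy of \<open>a\<close> on either side gives an expectation of one
      and the same element; uniqueness makes the two products equal.\<close>
    have comm: "\<pi> (tensor_op t a id) \<circ> \<iota> b = \<iota> b \<circ> \<pi> (tensor_op t a id)"
      using a b by (simp add: \<pi>_comp left_mem right_mem tensor_op_comp[OF t] SA(2,3) SB(2,3))
    have "is_expectation N (\<iota> b \<circ> \<pi> (tensor_op t a id)) (\<pi> (tensor_op t a id) \<circ> y)"
      using is_expectation_left[OF vN NP \<iota>_P[OF b] y left_N[OF a]] by (simp add: comm)
    then have "\<pi> (tensor_op t a id) \<circ> y = y \<circ> \<pi> (tensor_op t a id)"
      by (rule is_expectation_unique[OF vN NP _ is_expectation_right[OF vN NP \<iota>_P[OF b] y left_N[OF a]]])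
    then have "\<pi> (tensor_op t a id \<circ> m) = \<pi> (m \<circ> tensor_op t a id)"
      unfolding y_m using a m by (simp add: \<pi>_comp left_mem)
    then have "tensor_op t a id \<circ> m = m \<circ> tensor_op t a id"
      using a m by (intro \<pi>_inject SM(4) left_mem)
    then show ?thesis by (simp add: fun_eq_iff)
  qed
  then obtain c where "c \<in> B" "m = tensor_op t id c"
    using relative_commutant_of_left_factor[OF t _ _ vB m] A unfolding II1_factor_def by blast
  then show ?thesis using y y_m by auto
qed

section \<open>The subalgebra \<open>C\<close> and the two inclusions\<close>

definition C where "C = {c \<in> B. \<iota> c \<in> N}"

text \<open>The isometry \<open>\<Psi>\<close> carries an approximation by elements of
  \<open>C\<close> to one of \<open>amp (\<iota> c) \<Omega>\<close> by elements of
  \<open>N\<close>. This supplies the closedness behind \<open>vna_C\<close>.\<close>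

lemma mem_C_of_closure:
  assumes c: "c \<in> B" and cl: "amp c \<beta> \<in> closure ((\<lambda>b. amp b \<beta>) ` C)"
  shows "c \<in> C"
proof -
  have "\<Psi> (amp c \<beta>) \<in> closure L"
  proof (rule bounded_clinear_closure[OF bounded_clinear_\<Psi> _ cl])
    fix s assume "s \<in> (\<lambda>b. amp b \<beta>) ` C"
    then obtain d where "d \<in> B" "\<iota> d \<in> N" "s = amp d \<beta>" by (auto simp: C_def)
    then show "\<Psi> s \<in> L" using amp_\<iota>_\<Omega>[of d] by (intro image_eqI[of _ _ "\<iota> d"]) auto
  qed
  then have "\<iota> c \<in> N"
    by (intro mem_of_closure[OF vN NP \<iota>_P[OF c]]) (simp add: amp_\<iota>_\<Omega>[OF c])
  then show ?thesis using c by (simp add: C_def)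
qed

lemma star_algebra_C: "star_algebra C"
  unfolding star_algebra_def
proof (intro conjI ballI allI)
  show "C \<subseteq> bounded_ops" using SB(1) by (auto simp: C_def)
  show "id \<in> C" using SB(2) SN(2) by (simp add: C_def tensor_op_id[OF t] \<pi>_id)
next
  fix x y assume x: "x \<in> C" and y: "y \<in> C"
  have xy: "x \<in> B" "y \<in> B" "\<iota> x \<in> N" "\<iota> y \<in> N" using x y by (auto simp: C_def)
  have "\<iota> (x \<circ> y) = \<iota> x \<circ> \<iota> y"
    using xy by (simp add: \<pi>_comp right_mem tensor_op_comp[OF t] SA(2,3) SB(3))
  then show "x \<circ> y \<in> C" using xy by (simp add: C_def SB(4) SN(4))
  have s: "(\<lambda>v. x v + y v) \<in> B" by (rule SB(5)[OF xy(1,2)])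
  \<comment> \<open>Additivity of \<open>\<iota>\<close> is tested on the separating vector
    \<open>\<Omega>\<close>, where \<open>\<iota> b\<close> becomes
    \<open>\<Psi> (amp b \<beta>)\<close>, visibly linear in \<open>b\<close>.\<close>
  have "\<iota> (\<lambda>v. x v + y v) = (\<lambda>v. \<iota> x v + \<iota> y v)"
  proof (rule P_eqI[OF \<iota>_P[OF s]])
    show "(\<lambda>v. \<iota> x v + \<iota> y v) \<in> P" using xy by (intro SP(5) \<iota>_P)
    show "amp (\<iota> (\<lambda>v. x v + y v)) \<Omega> = amp (\<lambda>v. \<iota> x v + \<iota> y v) \<Omega>"
      using xy by (simp add: amp_\<iota>_\<Omega> s amp_op_plus SN(3) SB(3)
          clinear_add[OF bounded_clinear_clinear[OF bounded_clinear_\<Psi>]])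
  qed
  then show "(\<lambda>v. x v + y v) \<in> C" using xy s by (simp add: C_def SN(5))
next
  fix c x assume "x \<in> C"
  then have x: "x \<in> B" "\<iota> x \<in> N" by (auto simp: C_def)
  have s: "(\<lambda>v. c *\<^sub>C x v) \<in> B" by (rule SB(6)[OF x(1)])
  have "\<iota> (\<lambda>v. c *\<^sub>C x v) = (\<lambda>v. c *\<^sub>C \<iota> x v)"
  proof (rule P_eqI[OF \<iota>_P[OF s]])
    show "(\<lambda>v. c *\<^sub>C \<iota> x v) \<in> P" using x by (intro SP(6) \<iota>_P)
    show "amp (\<iota> (\<lambda>v. c *\<^sub>C x v)) \<Omega> = amp (\<lambda>v. c *\<^sub>C \<iota> x v) \<Omega>"
      using x by (simp add: amp_\<iota>_\<Omega> s amp_op_scaleC SN(3) SB(3)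
          clinear_scaleC[OF bounded_clinear_clinear[OF bounded_clinear_\<Psi>]])
  qed
  then show "(\<lambda>v. c *\<^sub>C x v) \<in> C" using x s by (simp add: C_def SN(6))
next
  fix x assume "x \<in> C"
  then have x: "x \<in> B" "\<iota> x \<in> N" by (auto simp: C_def)
  have "\<iota> (adj x) = adj (\<iota> x)"
    using x tensor_op_adj[OF t SA(3)[OF SA(2)] SB(3)[OF x(1)]] by (simp add: \<pi>_adj right_mem)
  then show "adj x \<in> C" using x by (simp add: C_def SB(7) SN(7))
qed

text \<open>An element of the bicommutant of \<open>C\<close> lies in \<open>B\<close>, and its
  value at \<open>\<beta>\<close> is a limit of values of \<open>C\<close>;
  \<open>mem_C_of_closure\<close> then applies.\<close>

lemma vna_C: "von_neumann_algebra C"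
proof -
  note SC = star_algebraD[OF star_algebra_C]
  have "x \<in> C" if x: "x \<in> commutant (commutant C)" for x
  proof (rule mem_C_of_closure)
    show "x \<in> B"
      using x bicommutant_mono[of C B] vna_bicommutant_eq[OF vB] by (auto simp: C_def)
    show "amp x \<beta> \<in> closure ((\<lambda>b. amp b \<beta>) ` C)"
      by (rule bicommutant_ultraweak_orbit[OF star_algebra_C x])
  qed
  then show ?thesis
    unfolding von_neumann_algebra_def using SC(1,7) bicommutant_extensive[OF SC(1)] by blast
qed

lemma \<rho>_C:
  assumes g: "g \<in> carrier G"
  shows "\<rho> g ` C = C"
proof -
  have sub: "\<rho> g c \<in> C" if "g \<in> carrier G" "c \<in> C" for g c
  proof -
    have c: "c \<in> B" "\<iota> c \<in> N" using that by (auto simp: C_def)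
    have "u g \<circ> \<iota> c \<circ> u (inv g) \<in> N" using that(1) c by (intro SN(4) u_N) auto
    then show ?thesis using that(1) c by (simp add: C_def \<rho>_mem \<iota>_conjugate)
  qed
  have "c \<in> \<rho> g ` C" if c: "c \<in> C" for c
  proof (rule image_eqI)
    have "c \<in> B" using c by (simp add: C_def)
    then show "c = \<rho> g (\<rho> (inv g) c)"
      using \<rho>_mult[of g "inv g" c] g by (simp add: \<rho>_one)
    show "\<rho> (inv g) c \<in> C" using g c by (intro sub) auto
  qed
  then show ?thesis using sub[OF g] by blast
qed

lemma tensor_C_subset: "tensor_vna t A C \<subseteq> tensor_vna t A B"
  unfolding tensor_vna_def by (rule vn_generated_mono) (auto simp: C_def)

abbreviation "Q \<equiv> crossed_product G V \<theta> (tensor_vna t A C)"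

lemma elementary_split:
  assumes "a \<in> A" "b \<in> B"
  shows "\<pi> (tensor_op t a b) = \<pi> (tensor_op t a id) \<circ> \<iota> b"
  using assms by (simp add: \<pi>_comp left_mem right_mem tensor_op_comp[OF t] SA(2,3) SB(2,3))

text \<open>Vectors replace a continuity argument for \<open>\<pi>\<close>: the value of
  \<open>x\<close> at the trace vector is a limit of values of elementary tensors,
  \<open>amp (V \<one>)\<close> carries this limit to the orbit of \<open>\<Omega>\<close>, and
  \<open>mem_of_closure\<close> returns to operators.\<close>

lemma Q_subset: "Q \<subseteq> N"
  unfolding crossed_product_def
proof (rule vn_generated_least[OF vN])
  let ?\<omega> = "tensor_ell2 t \<alpha> \<beta>"
  note sAC = star_algebra_elementary_tensors[OF t sA star_algebra_C]
  have sLN: "csubspace L" using csubspace_orbit[OF star_algebra_amp[OF sN], of \<Omega>] by (simp add: image_image)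
  have VL: "amp (V \<one>) (amp s ?\<omega>) \<in> L" if "s \<in> lspan (elementary_tensors t A C)" for s
    using that
  proof induction
    case (base s)
    then obtain a c where s: "a \<in> A" "c \<in> B" "\<iota> c \<in> N" "s = tensor_op t a c" by (auto simp: C_def)
    have "\<pi> s \<in> N" unfolding s(4) elementary_split[OF s(1,2)] by (rule SN(4)[OF left_N[OF s(1)] s(3)])
    moreover have "s \<in> tensor_vna t A B" unfolding s(4) by (rule tensor_vna_elementary[OF s(1,2)])
    ultimately show ?case by (intro image_eqI[of _ _ "\<pi> s"]) (simp_all add: amp_\<pi>_\<Omega>)
  next
    case (plus x y)
    then show ?case
      using complex_vector.subspace_add[OF sLN] star_algebraD(3)[OF sAC]
        clinear_add[OF bounded_clinear_clinear[OF bounded_clinear_amp[OF V_bcl[OF one_closed]]]]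
      by (simp add: amp_op_plus)
  next
    case (scaleC x c)
    then show ?case
      using complex_vector.subspace_scale[OF sLN] star_algebraD(3)[OF sAC]
        clinear_scaleC[OF bounded_clinear_clinear[OF bounded_clinear_amp[OF V_bcl[OF one_closed]]]]
      by (simp add: amp_op_scaleC)
  qed
  have "\<pi> x \<in> N" if x: "x \<in> tensor_vna t A C" for x
  proof (rule mem_of_closure[OF vN NP])
    have xM: "x \<in> tensor_vna t A B" using x tensor_C_subset by blast
    then show "\<pi> x \<in> P" by (rule crossed_product_\<pi>)
    have "amp x ?\<omega> \<in> closure ((\<lambda>s. amp s ?\<omega>) ` lspan (elementary_tensors t A C))"
      by (rule bicommutant_ultraweak_orbit[OF sAC tensor_vna_bicommutant[OF t sA star_algebra_C x]])
    then have "amp (V \<one>) (amp x ?\<omega>) \<in> closure L"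
      by (rule bounded_clinear_closure[OF bounded_clinear_amp[OF V_bcl[OF one_closed]], rotated]) (use VL in auto)
    then show "amp (\<pi> x) \<Omega> \<in> closure L" by (simp add: amp_\<pi>_\<Omega>[OF xM])
  qed
  then show "\<pi> ` tensor_vna t A C \<union> u ` carrier G \<subseteq> N" using u_N by blast
qed

text \<open>The projection \<open>e\<close> commutes with \<open>N\<close>, so on a word built from
  \<open>u g\<close>, \<open>a\<close> and \<open>b\<close> it passes the first two factors and
  meets \<open>b\<close> alone, where \<open>ex\<close> supplies an element of \<open>C\<close>.
  Sums and limits are taken separately inside the tensor product and inside the crossed
  product.\<close>

lemma N_subset:
  assumes ex: "\<And>b. b \<in> B \<Longrightarrow> \<exists>c\<in>B. is_expectation N (\<iota> b) (\<iota> c)"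
  shows "N \<subseteq> Q"
proof
  fix y assume y: "y \<in> N"
  let ?\<omega> = "tensor_ell2 t \<alpha> \<beta>" and ?LQ = "(\<lambda>n. amp n \<Omega>) ` Q"
  have vQ: "von_neumann_algebra Q" by (rule vna_crossed_product[OF tensor_C_subset])
  note sQ = star_algebraD[OF vna_star_algebra[OF vQ]]
  have QP: "Q \<subseteq> P" using Q_subset NP by blast
  have cLQ: "csubspace (closure ?LQ)"
    using csubspace_closure[OF csubspace_orbit[OF star_algebra_amp[OF vna_star_algebra[OF vQ]], of \<Omega>]]
    by (simp add: image_image)
  have e_add: "e (v + w) = e v + e w" and e_scale: "e (c *\<^sub>C v) = c *\<^sub>C e v" for v w c
    by (simp_all add: clinear_simps[OF bounded_clinear_clinear[OF e_bcl]])
  have e_N: "e (amp n v) = amp n (e v)" if "n \<in> N" for n v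
    by (rule commutantD[OF e'(1) imageI[OF that]])
  note Vlin = clinear_simps[OF bounded_clinear_clinear[OF bounded_clinear_amp[OF V_bcl[OF one_closed]]]]
  note sAB = star_algebra_elementary_tensors[OF t sA sB]
  have 1: "e (amp (V \<one>) (amp s ?\<omega>)) \<in> closure ?LQ" if "s \<in> lspan (elementary_tensors t A B)" for s
    using that
  proof induction
    case (base s)
    then obtain a b where s: "a \<in> A" "b \<in> B" "s = tensor_op t a b" by blast
    obtain c where c: "c \<in> B" "is_expectation N (\<iota> b) (\<iota> c)" using ex[OF s(2)] by blast
    have cC: "c \<in> C" using c by (simp add: C_def is_expectation_def)
    have aQ: "\<pi> (tensor_op t a id) \<in> Q"
      using tensor_vna_elementary[OF s(1), of id C t] star_algebraD(2)[OF star_algebra_C]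
      by (intro crossed_product_\<pi>) auto
    have cQ: "\<iota> c \<in> Q"
      by (intro crossed_product_\<pi> tensor_vna_elementary[OF SA(2) cC])
    have "amp (V \<one>) (amp s ?\<omega>) = amp (\<pi> s) \<Omega>"
      unfolding s(3) by (simp add: amp_\<pi>_\<Omega>[OF tensor_vna_elementary[OF s(1,2)]])
    also have "\<dots> = amp (\<pi> (tensor_op t a id)) (amp (\<iota> b) \<Omega>)"
      unfolding s(3) elementary_split[OF s(1,2)]
      by (rule amp_op_comp[OF SN(3)[OF left_N[OF s(1)]] SP(3)[OF \<iota>_P[OF s(2)]]])
    finally have "e (amp (V \<one>) (amp s ?\<omega>)) = amp (\<pi> (tensor_op t a id)) (amp (\<iota> c) \<Omega>)"
      by (simp add: e_N[OF left_N[OF s(1)]] e_expectation[OF c(2)])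
    also have "\<dots> = amp (\<pi> (tensor_op t a id) \<circ> \<iota> c) \<Omega>"
      by (rule amp_op_comp[OF sQ(3)[OF aQ] sQ(3)[OF cQ], symmetric])
    finally show ?case
      using sQ(4)[OF aQ cQ] by (intro closure_subset[THEN subsetD] image_eqI)
  next
    case (plus x y)
    then show ?case
      using complex_vector.subspace_add[OF cLQ] star_algebraD(3)[OF sAB] by (simp add: amp_op_plus Vlin e_add)
  next
    case (scaleC x c)
    then show ?case
      using complex_vector.subspace_scale[OF cLQ] star_algebraD(3)[OF sAB] by (simp add: amp_op_scaleC Vlin e_scale)
  qed
  have cc: "v \<in> closure ?LQ" if "v \<in> closure (closure ?LQ)" for v using that by simp
  \<comment> \<open>The closed orbit of \<open>Q\<close> is reached on sums of elementary tensors;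
    continuity of \<open>e \<circ> amp (V \<one>)\<close> extends this to their bicommutant.\<close>
  have 2: "e (amp (\<pi> m) \<Omega>) \<in> closure ?LQ" if m: "m \<in> tensor_vna t A B" for m
  proof -
    have "(e \<circ> amp (V \<one>)) (amp m ?\<omega>) \<in> closure (closure ?LQ)"
    proof (rule bounded_clinear_closure[where f = "e \<circ> amp (V \<one>)"])
      show "bounded_clinear (e \<circ> amp (V \<one>))"
        by (rule bounded_clinear_comp[OF e_bcl bounded_clinear_amp[OF V_bcl[OF one_closed]]])
      show "amp m ?\<omega> \<in> closure ((\<lambda>s. amp s ?\<omega>) ` lspan (elementary_tensors t A B))"
        by (rule bicommutant_ultraweak_orbit[OF sAB tensor_vna_bicommutant[OF t sA sB m]])
      show "(e \<circ> amp (V \<one>)) v \<in> closure ?LQ" if "v \<in> (\<lambda>s. amp s ?\<omega>) ` lspan (elementary_tensors t A B)" for v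
        using that 1 by auto
    qed
    then show ?thesis using cc by (simp add: amp_\<pi>_\<Omega>[OF m])
  qed
  have 3: "e (amp s \<Omega>) \<in> closure ?LQ" if "s \<in> lspan generators" for s
    using that
  proof induction
    case (base s)
    then obtain g m where s: "g \<in> carrier G" "m \<in> tensor_vna t A B" "s = u g \<circ> \<pi> m" by blast
    have uQ: "u g \<in> Q" by (rule crossed_product_u[OF s(1)])
    have "amp s \<Omega> = amp (u g) (amp (\<pi> m) \<Omega>)"
      unfolding s(3) by (rule amp_op_comp[OF u_bounded[OF s(1)] \<pi>_bounded[OF s(2)]])
    then have eq: "e (amp s \<Omega>) = amp (u g) (e (amp (\<pi> m) \<Omega>))" by (simp add: e_N[OF u_N[OF s(1)]])
    show ?case
      unfolding eq
    proof (rule bounded_clinear_closure[OF _ _ 2[OF s(2)]])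
      show "bounded_clinear (amp (u g))" using u_bounded[OF s(1)] by (simp add: bounded_ops_iff bounded_clinear_amp)
      fix v assume "v \<in> ?LQ"
      then obtain n where n: "n \<in> Q" "v = amp n \<Omega>" by blast
      show "amp (u g) v \<in> ?LQ"
        unfolding n(2) using sQ(4)[OF uQ n(1)] amp_op_comp[OF sQ(3)[OF uQ] sQ(3)[OF n(1)], of \<Omega>]
        by (intro image_eqI[of _ _ "u g \<circ> n"]) simp_all
    qed
  next
    case (plus x y)
    then show ?case
      using complex_vector.subspace_add[OF cLQ] star_algebraD(3)[OF star_algebra_generators]
      by (simp add: amp_op_plus e_add)
  next
    case (scaleC x c)
    then show ?case
      using complex_vector.subspace_scale[OF cLQ] star_algebraD(3)[OF star_algebra_generators]
      by (simp add: amp_op_scaleC e_scale)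
  qed
  have "amp y \<Omega> \<in> closure ((\<lambda>s. amp s \<Omega>) ` lspan generators)"
    using y NP P_generated by (intro bicommutant_ultraweak_orbit[OF star_algebra_generators]) blast
  then have "e (amp y \<Omega>) \<in> closure (closure ?LQ)"
    by (rule bounded_clinear_closure[OF e_bcl, rotated]) (use 3 in auto)
  moreover have "e (amp y \<Omega>) = amp y \<Omega>"
    using y by (intro e'(3) closure_subset[THEN subsetD] imageI)
  ultimately have "amp y \<Omega> \<in> closure ?LQ" by simp
  then show "y \<in> Q" using y NP by (intro mem_of_closure[OF vQ QP]) auto
qed

end

theorem corollary3p13:
  fixes G :: "('g, 's) monoid_scheme"
    and A :: "('a::chilbert_space \<Rightarrow> 'a) set" and \<tau>\<^sub>A :: "('a \<Rightarrow> 'a) \<Rightarrow> complex"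
    and B :: "('b::chilbert_space \<Rightarrow> 'b) set" and \<tau>\<^sub>B :: "('b \<Rightarrow> 'b) \<Rightarrow> complex"
    and \<sigma> :: "'g \<Rightarrow> ('a \<Rightarrow> 'a) \<Rightarrow> ('a \<Rightarrow> 'a)"
    and \<rho> :: "'g \<Rightarrow> ('b \<Rightarrow> 'b) \<Rightarrow> ('b \<Rightarrow> 'b)"
    and j :: "('b \<Rightarrow> 'b) \<Rightarrow> 'l::chilbert_space"
    and t :: "'a \<Rightarrow> 'b \<Rightarrow> 'ab::chilbert_space"
    and \<theta> :: "'g \<Rightarrow> ('ab \<Rightarrow> 'ab) \<Rightarrow> ('ab \<Rightarrow> 'ab)"
    and V :: "'g \<Rightarrow> 'ab \<Rightarrow> 'k::chilbert_space"
    and N :: "('k \<Rightarrow> 'k) set"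
  assumes "group G" and "countable (carrier G)" and "icc G"
    and "tracial_von_neumann_algebra A \<tau>\<^sub>A" and "II1_factor A"
    and "tracial_von_neumann_algebra B \<tau>\<^sub>B"
    and "trace_preserving_action G A \<tau>\<^sub>A \<sigma>"
    and "trace_preserving_action G B \<tau>\<^sub>B \<rho>"
    and "L2_space B \<tau>\<^sub>B j" and "compact_action G B j \<rho>"
    and "hilbert_tensor t"
    and "diagonal_action G t A B \<sigma> \<rho> \<theta>"
    and "hilbert_sum (carrier G) V"
    and "von_neumann_algebra N"
    and "crossed_product G V \<theta> (left_copy t A) \<subseteq> N"
    and "N \<subseteq> crossed_product G V \<theta> (tensor_vna t A B)"
  shows "\<exists>C. von_neumann_algebra C \<and> C \<subseteq> B \<and>
           (\<forall>g\<in>carrier G. \<rho> g ` C = C) \<and>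
           N = crossed_product G V \<theta> (tensor_vna t A C)"
proof -
  obtain \<alpha> where \<alpha>: "\<And>x. x \<in> A \<Longrightarrow> \<tau>\<^sub>A x = cinner (amp x \<alpha>) \<alpha>"
    by (rule trace_vector_exists[OF assms(4)]) (rule that)
  obtain \<beta> where \<beta>: "\<And>x. x \<in> B \<Longrightarrow> \<tau>\<^sub>B x = cinner (amp x \<beta>) \<beta>"
    by (rule trace_vector_exists[OF assms(6)]) (rule that)
  obtain e where e: "orbit_projection (amp ` N) (amp (V \<one>\<^bsub>G\<^esub>) (tensor_ell2 t \<alpha> \<beta>)) e"
    using orbit_projection_exists[OF star_algebra_amp[OF vna_star_algebra[OF assms(14)]]] .
  interpret intermediate_algebra G A \<tau>\<^sub>A B \<tau>\<^sub>B \<sigma> \<rho> t \<theta> V \<alpha> \<beta> N e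
    by (intro intermediate_algebra.intro diagonal_crossed_system.intro intermediate_algebra_axioms.intro)
      (fact assms \<alpha> \<beta> e)+
  have "\<exists>c\<in>B. is_expectation N (\<iota> b) (\<iota> c)" if "b \<in> B" for b
    by (rule expectation_right[OF assms(5) coef_e_zero[OF assms(3,9,10)] that])
  then have "N = Q" using N_subset Q_subset by blast
  moreover have "C \<subseteq> B" by (auto simp: C_def)
  ultimately show ?thesis using vna_C \<rho>_C by blast
qed

end
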